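(* Let $C, A^1,\dots,A^m$ be real symmetric $n\times n$ matrices and $b\in\mathbb{R}^m$, and consider the primal-dual pair $$(\mathbf{P})\quad \min_X\ C\bullet X \ \text{ s.t. } A^i\bullet X=b_i\ (i=1,\dots,m),\ X\succeq 0,$$ $$(\mathbf{D})\quad \max_{y}\ b^Ty \ \text{ s.t. } C-\sum_{i=1}^m A^iy_i\succeq 0 .$$ Suppose $\mathbf{P}$ and $\mathbf{D}$ are feasible. Let $v_a:[0,\pi/2]\to\mathbb{R}$ be the limiting pd-regularized optimal value function $v_a(\theta)=\lim_{t\downarrow 0} v(t\cos\theta,t\sin\theta)$ (defined in the context). Then: 1. If the singularity degree of $\mathbf{D}$ is one, then $v_a$ is continuous at $\theta=\pi/2$. 2. If the singularity degree of $\mathbf{P}$ is one, then $v_a$ is continuous at $\theta=0$. 3. If the singularity degree of both $\mathbf{P}$ and $\mathbf{D}$ is one, then $v_a$ is continuous at $\theta=0$ and $\theta=\pi/2$; furthermore, if in addition the duality gap is nonzero, i.e. $v(\mathbf{P})\neq v(\mathbf{D})$, then $v_a$ is a monotonically decreasing continuous bijective function from $[0,\pi/2]$ onto $[v(\mathbf{D}),v(\mathbf{P})]$.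
   Context: $v(\mathbf{P})$ and $v(\mathbf{D})$ denote the optimal values of $\mathbf{P}$ and $\mathbf{D}$ (finite when both are feasible). $I$ is the identity matrix. For $\varepsilon,\eta\ge 0$ define the regularized problems $$\mathbf{P}(\varepsilon,\eta):\ \min_X (C+\varepsilon I)\bullet X \text{ s.t. } A^i\bullet X=b_i+\eta A^i\bullet I\ (i=1,\dots,m),\ X\succeq 0,$$ $$\mathbf{D}(\varepsilon,\eta):\ \max_{y}\ \sum_{i=1}^m (b_i+\eta A^i\bullet I)y_i \text{ s.t. } C-\sum_{i=1}^m A^iy_i+\varepsilon I\succeq 0.$$ For $(\varepsilon,\eta)\neq(0,0)$ with $\varepsilon,\eta\ge 0$, $v(\varepsilon,\eta)$ denotes the common optimal value of $\mathbf{P}(\varepsilon,\eta)$ and $\mathbf{D}(\varepsilon,\eta)$ (the pd-regularized optimal value function). The limit defining $v_a(\theta)$ exists for every $\theta\in[0,\pi/2]$ when $\mathbf{P},\mathbf{D}$ are feasible. Singularity degree one: $\mathbf{D}$ has singularity degree one if it is feasible and there exists a nonzero $X\succeq 0$ with $C\bullet X=0$ and $A^i\bullet X=0$ for all $i$, such that some $y\in\mathbb{R}^m$ has $C-\sum_i A^iy_i$ in the relative interior of the face $\{Z\succeq 0: Z\bullet X=0\}$ of the positive semidefinite cone. $\mathbf{P}$ has singularity degree one if it is feasible and there exists a nonzero $S\succeq 0$ of the form $S=\sum_i y_iA^i$ with $b^Ty=0$ (so $S\bullet X=0$ for every $X$ in the affine set $\{X: A^i\bullet X=b_i\ \forall i\}$),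 such that some $X$ with $A^i\bullet X=b_i$ for all $i$ lies in the relative interior of the face $\{Z\succeq 0: Z\bullet S=0\}$. *)

theory Defs
  imports "HOL-Analysis.Analysis"
begin

definition sym_mat :: "real^'n^'n \<Rightarrow> bool" where
  "sym_mat M \<longleftrightarrow> transpose M = M"

definition psd :: "real^'n^'n \<Rightarrow> bool" where
  "psd M \<longleftrightarrow> sym_mat M \<and> (\<forall>x. 0 \<le> x \<bullet> (M *v x))"

definition frob :: "real^'n^'n \<Rightarrow> real^'n^'n \<Rightarrow> real" where
  "frob A B = (\<Sum>i\<in>UNIV. \<Sum>j\<in>UNIV. A$i$j * B$i$j)"

definition opsum :: "('m::finite \<Rightarrow> real^'n^'n) \<Rightarrow> real^'m \<Rightarrow> real^'n^'n" where
  "opsum A y = (\<Sum>i\<in>UNIV. y$i *\<^sub>R A i)"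

definition primal_feasible ::
  "('m::finite \<Rightarrow> real^'n^'n) \<Rightarrow> real^'m \<Rightarrow> real^'n^'n \<Rightarrow> bool" where
  "primal_feasible A b X \<longleftrightarrow> psd X \<and> (\<forall>i. frob (A i) X = b$i)"

definition dual_feasible ::
  "real^'n^'n \<Rightarrow> ('m::finite \<Rightarrow> real^'n^'n) \<Rightarrow> real^'m \<Rightarrow> bool" where
  "dual_feasible C A y \<longleftrightarrow> psd (C - opsum A y)"

definition vP :: "real^'n^'n \<Rightarrow> ('m::finite \<Rightarrow> real^'n^'n) \<Rightarrow> real^'m \<Rightarrow> real" where
  "vP C A b = Inf {frob C X | X. primal_feasible A b X}"

definition vD :: "real^'n^'n \<Rightarrow> ('m::finite \<Rightarrow> real^'n^'n) \<Rightarrow> real^'m \<Rightarrow> real" where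
  "vD C A b = Sup {b \<bullet> y | y. dual_feasible C A y}"

definition regC :: "real^'n^'n \<Rightarrow> real \<Rightarrow> real^'n^'n" where
  "regC C eps = C + eps *\<^sub>R mat 1"

definition regb :: "('m::finite \<Rightarrow> real^'n^'n) \<Rightarrow> real^'m \<Rightarrow> real \<Rightarrow> real^'m" where
  "regb A b eta = b + eta *\<^sub>R (\<chi> i. frob (A i) (mat 1))"

text \<open>pd-regularized optimal value v(eps,eta): the optimal value of P(eps,eta)
  (which equals that of D(eps,eta) for (eps,eta) \<noteq> (0,0)).\<close>
definition vreg :: "real^'n^'n \<Rightarrow> ('m::finite \<Rightarrow> real^'n^'n) \<Rightarrow> real^'m \<Rightarrow> real \<Rightarrow> real \<Rightarrow> real" where
  "vreg C A b eps eta = vP (regC C eps) A (regb A b eta)"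

definition va :: "real^'n^'n \<Rightarrow> ('m::finite \<Rightarrow> real^'n^'n) \<Rightarrow> real^'m \<Rightarrow> real \<Rightarrow> real" where
  "va C A b \<theta> = Lim (at_right 0) (\<lambda>t. vreg C A b (t * cos \<theta>) (t * sin \<theta>))"

definition D_sing_deg_one :: "real^'n^'n \<Rightarrow> ('m::finite \<Rightarrow> real^'n^'n) \<Rightarrow> real^'m \<Rightarrow> bool" where
  "D_sing_deg_one C A b \<longleftrightarrow> (\<exists>y. dual_feasible C A y) \<and>
     (\<exists>X. X \<noteq> 0 \<and> psd X \<and> frob C X = 0 \<and> (\<forall>i. frob (A i) X = 0) \<and>
        (\<exists>y. C - opsum A y \<in> rel_interior {Z. psd Z \<and> frob Z X = 0}))"

definition P_sing_deg_one :: "real^'n^'n \<Rightarrow> ('m::finite \<Rightarrow> real^'n^'n) \<Rightarrow> real^'m \<Rightarrow> bool" where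
  "P_sing_deg_one C A b \<longleftrightarrow> (\<exists>X. primal_feasible A b X) \<and>
     (\<exists>y. opsum A y \<noteq> 0 \<and> psd (opsum A y) \<and> b \<bullet> y = 0 \<and>
        (\<exists>X. (\<forall>i. frob (A i) X = b$i) \<and>
             X \<in> rel_interior {Z. psd Z \<and> frob Z (opsum A y) = 0}))"

end

theory Submission
  imports Defs "HOL-Computational_Algebra.Polynomial"
begin

text \<open>
  Write \<open>L(\<epsilon>, \<eta>)\<close> for the limit of \<open>v(t\<epsilon>, t\<eta>)\<close> as \<open>t\<close> decreases to 0, so that
  \<open>v\<^sub>a(\<theta>) = L(cos \<theta>, sin \<theta>)\<close>. The limit exists because \<open>v(t\<epsilon>, t\<eta>) < c\<close> is a semialgebraic
  condition on \<open>t\<close>: writing a positive semidefinite matrix as a sum of squares \<open>w w\<^sup>T\<close> makes it purely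
  existential, and eliminating the quantifiers (Cohen--Hoermander) leaves finitely many sign
  conditions on polynomials in \<open>t\<close>, each of which is eventually constant.

  \<open>L\<close> is homogeneous of degree 0, \<open>L(r, 1)\<close> is concave and nondecreasing in \<open>r\<close>, and \<open>L(1, s)\<close> is
  convex in \<open>s\<close>. Hence \<open>v\<^sub>a\<close> is continuous inside the interval, and if \<open>v\<^sub>a\<close> is continuous at both ends
  it is either constant or strictly decreasing.

  Continuity at an end point is a Hoelder estimate. If \<open>D\<close> has singularity degree one with
  certificate \<open>X\<close>, every optimal slack \<open>S\<close> of the regularized dual satisfies \<open>S \<bullet> X = 0\<close>,
  \<open>S + \<epsilon> I \<succeq> 0\<close> and \<open>tr S = O(1/\<eta>)\<close>; the Cauchy--Schwarz inequality gives
  \<open>\<parallel>S X\<parallel> = O(\<surd>(\<epsilon>/\<eta>) + \<epsilon>)\<close>, so an equally small correction moves \<open>S\<close> back into the dual feasible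
  set and \<open>L(r, 1) \<le> v(D) + O(\<surd>r)\<close>. The primal side is the same.
\<close>

section \<open>Matching the signs of real polynomials\<close>

text \<open>Convergence along a ray cannot be read off from monotonicity: raising
  \<open>\<epsilon>\<close> can only raise the value, but shifting the right-hand side by
  \<open>\<eta>\<close> can move it either way, and \<open>Lim\<close> carries no information until
  convergence is proved. This is what calls for quantifier elimination.

  The elimination is semantic, without formulas. Two parameters at which finitely many coefficient
  functions have equal signs admit an increasing bijection of the line that matches the signs of all
  given polynomials; a witness for one parameter is thereby carried to a witness for the other.

  For strict decrease, concavity spreads a flat piece only towards \<open>\<theta> = 0\<close>, and
  convexity in the other slope is needed to spread it back towards \<open>\<theta> = pi / 2\<close>;
  the two end point estimates then identify v(P) with v(D).

  The optimal dual slack in the Hoelder estimate exists because \<open>\<eta> > 0\<close> supplies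
  the Slater point \<open>X + \<eta> *\<^sub>R mat 1\<close>.\<close>

definition slide :: "real \<Rightarrow> real \<Rightarrow> real \<Rightarrow> real \<Rightarrow> real \<Rightarrow> real" where
  "slide \<alpha> \<beta> u v z =
     (if z \<le> \<alpha> \<or> \<beta> \<le> z then z
      else if z \<le> u then \<alpha> + (z - \<alpha>) * ((v - \<alpha>) / (u - \<alpha>))
      else \<beta> - (\<beta> - z) * ((\<beta> - v) / (\<beta> - u)))"

lemma slide_cases:
  assumes "\<alpha> < u" "u < \<beta>" "\<alpha> < v" "v < \<beta>"
  shows "\<alpha> < z \<Longrightarrow> z \<le> u \<Longrightarrow> \<alpha> < slide \<alpha> \<beta> u v z \<and> slide \<alpha> \<beta> u v z \<le> v"
    and "u < z \<Longrightarrow> z < \<beta> \<Longrightarrow> v < slide \<alpha> \<beta> u v z \<and> slide \<alpha> \<beta> u v z < \<beta>"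
proof -
  assume z: "\<alpha> < z" "z \<le> u"
  have "(z - \<alpha>) * ((v - \<alpha>) / (u - \<alpha>)) \<le> (u - \<alpha>) * ((v - \<alpha>) / (u - \<alpha>))"
    using z assms by (intro mult_right_mono) auto
  then show "\<alpha> < slide \<alpha> \<beta> u v z \<and> slide \<alpha> \<beta> u v z \<le> v"
    using z assms by (auto simp: slide_def)
next
  assume z: "u < z" "z < \<beta>"
  have "(\<beta> - z) * ((\<beta> - v) / (\<beta> - u)) < (\<beta> - u) * ((\<beta> - v) / (\<beta> - u))"
    using z assms by (intro mult_strict_right_mono) auto
  then show "v < slide \<alpha> \<beta> u v z \<and> slide \<alpha> \<beta> u v z < \<beta>"
    using z assms by (auto simp: slide_def)
qed

text \<open>Swapping \<open>u\<close> and \<open>v\<close> inverts the slopes of both linear pieces.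
  This explicit inverse is the source of surjectivity in \<open>move_point\<close>.\<close>

lemma slide_slide:
  assumes "\<alpha> < u" "u < \<beta>" "\<alpha> < v" "v < \<beta>"
  shows "slide \<alpha> \<beta> u v (slide \<alpha> \<beta> v u z) = z"
proof -
  consider "z \<le> \<alpha> \<or> \<beta> \<le> z" | "\<alpha> < z" "z \<le> v" | "v < z" "z < \<beta>" by linarith
  then show ?thesis
  proof cases
    case 1
    then show ?thesis by (auto simp: slide_def)
  next
    case 2
    note s = slide_cases(1)[OF assms(3,4,1,2) 2]
    have e: "slide \<alpha> \<beta> v u z = \<alpha> + (z - \<alpha>) * ((u - \<alpha>) / (v - \<alpha>))"
      using 2 assms by (auto simp: slide_def)
    have "slide \<alpha> \<beta> u v (slide \<alpha> \<beta> v u z) = \<alpha> + (slide \<alpha> \<beta> v u z - \<alpha>) * ((v - \<alpha>) / (u - \<alpha>))"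
      using s assms by (auto simp: slide_def[of _ _ u v])
    also have "\<dots> = \<alpha> + (z - \<alpha>) * (((u - \<alpha>) / (v - \<alpha>)) * ((v - \<alpha>) / (u - \<alpha>)))"
      unfolding e by simp
    also have "\<dots> = z" using assms by simp
    finally show ?thesis .
  next
    case 3
    note s = slide_cases(2)[OF assms(3,4,1,2) 3]
    have e: "slide \<alpha> \<beta> v u z = \<beta> - (\<beta> - z) * ((\<beta> - u) / (\<beta> - v))"
      using 3 assms by (auto simp: slide_def)
    have "slide \<alpha> \<beta> u v (slide \<alpha> \<beta> v u z) = \<beta> - (\<beta> - slide \<alpha> \<beta> v u z) * ((\<beta> - v) / (\<beta> - u))"
      using s assms by (auto simp: slide_def[of _ _ u v])
    also have "\<dots> = \<beta> - (\<beta> - z) * (((\<beta> - u) / (\<beta> - v)) * ((\<beta> - v) / (\<beta> - u)))"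
      unfolding e by simp
    also have "\<dots> = z" using assms by simp
    finally show ?thesis .
  qed
qed

lemma strict_mono_slide:
  assumes "\<alpha> < u" "u < \<beta>" "\<alpha> < v" "v < \<beta>"
  shows "strict_mono (slide \<alpha> \<beta> u v)"
proof (rule strict_monoI)
  fix x y :: real assume xy: "x < y"
  note c1 = slide_cases(1)[OF assms] and c2 = slide_cases(2)[OF assms]
  have id: "slide \<alpha> \<beta> u v z = z" if "z \<le> \<alpha> \<or> \<beta> \<le> z" for z
    using that by (auto simp: slide_def)
  have m1: "slide \<alpha> \<beta> u v x < slide \<alpha> \<beta> u v y" if "\<alpha> < x" "y \<le> u"
  proof -
    have "(x - \<alpha>) * ((v - \<alpha>) / (u - \<alpha>)) < (y - \<alpha>) * ((v - \<alpha>) / (u - \<alpha>))"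
      using xy assms by (intro mult_strict_right_mono) auto
    then show ?thesis using that xy assms by (simp add: slide_def)
  qed
  have m2: "slide \<alpha> \<beta> u v x < slide \<alpha> \<beta> u v y" if "u < x" "y < \<beta>"
  proof -
    have "(\<beta> - y) * ((\<beta> - v) / (\<beta> - u)) < (\<beta> - x) * ((\<beta> - v) / (\<beta> - u))"
      using xy assms by (intro mult_strict_right_mono) auto
    then show ?thesis using that xy assms by (simp add: slide_def)
  qed
  consider "x \<le> \<alpha>" | "\<beta> \<le> x" | "\<alpha> < x" "x \<le> u" | "u < x" "x < \<beta>" by linarith
  then show "slide \<alpha> \<beta> u v x < slide \<alpha> \<beta> u v y"
  proof cases
    case 1
    have "y \<le> \<alpha> \<or> \<beta> \<le> y \<or> \<alpha> < slide \<alpha> \<beta> u v y"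
      using c1[of y] c2[of y] assms by linarith
    then show ?thesis using id[of x] id[of y] 1 xy by auto
  next
    case 2
    then show ?thesis using id[of x] id[of y] xy by auto
  next
    case 3
    consider "y \<le> u" | "u < y" "y < \<beta>" | "\<beta> \<le> y" by linarith
    then show ?thesis
      using m1 3 c1[of x] c2[of y] id[of y] assms by cases auto
  next
    case 4
    consider "y < \<beta>" | "\<beta> \<le> y" by linarith
    then show ?thesis using m2 4 c2[of x] id[of y] assms by cases auto
  qed
qed

text \<open>A local deformation of the line: composing a matching with \<open>h\<close> corrects its
  value at one root and changes no value outside the interval.\<close>

lemma move_point:
  fixes \<alpha> \<beta> u v :: real
  assumes "\<alpha> < u" "u < \<beta>" "\<alpha> < v" "v < \<beta>"
  obtains h where "strict_mono h" "surj h" "h u = v" "\<And>z. z \<le> \<alpha> \<or> \<beta> \<le> z \<Longrightarrow> h z = z"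
proof
  show "strict_mono (slide \<alpha> \<beta> u v)" using assms by (rule strict_mono_slide)
  show "surj (slide \<alpha> \<beta> u v)" by (rule surjI, rule slide_slide[OF assms])
  show "slide \<alpha> \<beta> u v u = v" using assms by (simp add: slide_def)
  show "\<And>z. z \<le> \<alpha> \<or> \<beta> \<le> z \<Longrightarrow> slide \<alpha> \<beta> u v z = z" by (auto simp: slide_def)
qed

lemma sgn_poly_eq_no_root:
  fixes p :: "real poly"
  assumes "\<And>z. min a b \<le> z \<Longrightarrow> z \<le> max a b \<Longrightarrow> poly p z \<noteq> 0"
  shows "sgn (poly p a) = sgn (poly p b)"
proof -
  have *: "sgn (poly p a) = sgn (poly p b)"
    if "a < b" "\<And>z. a \<le> z \<Longrightarrow> z \<le> b \<Longrightarrow> poly p z \<noteq> 0" for a b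
  proof (rule ccontr)
    assume ne: "sgn (poly p a) \<noteq> sgn (poly p b)"
    have "poly p a \<noteq> 0" "poly p b \<noteq> 0" using that by auto
    with ne have "poly p a * poly p b < 0" by (auto simp: sgn_if mult_less_0_iff split: if_splits)
    then show False using poly_IVT[OF that(1)] that(2) by (meson less_imp_le)
  qed
  show ?thesis
  proof (cases a b rule: linorder_cases)
    case less
    show ?thesis using less by (rule *) (use less assms in auto)
  next
    case greater
    show ?thesis using greater by (rule *[symmetric]) (use greater assms in auto)
  qed simp
qed

text \<open>Take \<open>x'\<close> with \<open>\<phi> x' = \<psi> x\<close>. A root of
  \<open>p\<close> lies on the same side of \<open>x\<close> and \<open>x'\<close>, because both
  maps agree there and are increasing; hence \<open>p\<close> has no root between them. A matching
  may thus be altered freely away from the roots.\<close>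

lemma matching_of_agree_on_roots:
  fixes p p' :: "real poly"
  assumes \<phi>: "strict_mono \<phi>" "surj \<phi>" and \<psi>: "strict_mono \<psi>"
    and match: "\<And>x. sgn (poly p x) = sgn (poly p' (\<phi> x))"
    and agree: "\<And>z. p \<noteq> 0 \<Longrightarrow> poly p z = 0 \<Longrightarrow> \<psi> z = \<phi> z"
  shows "sgn (poly p x) = sgn (poly p' (\<psi> x))"
proof -
  obtain x' where x': "\<phi> x' = \<psi> x" using \<phi>(2) by (metis surjD)
  have "sgn (poly p x) = sgn (poly p x')"
  proof (cases "p = 0 \<or> x = x' \<or> (\<forall>z. min x x' \<le> z \<longrightarrow> z \<le> max x x' \<longrightarrow> poly p z \<noteq> 0)")
    case True
    then show ?thesis using sgn_poly_eq_no_root[of x x' p] by auto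
  next
    case False
    then obtain z where z: "min x x' \<le> z" "z \<le> max x x'" "poly p z = 0" and ne: "x \<noteq> x'" and "p \<noteq> 0"
      by auto
    then have "\<psi> z = \<phi> z" using agree by auto
    then have "x < z \<longleftrightarrow> x' < z" "z < x \<longleftrightarrow> z < x'"
      using \<phi>(1) \<psi> x' by (metis strict_mono_less)+
    then show ?thesis using z ne by (auto simp: min_def max_def split: if_splits)
  qed
  then show ?thesis using match[of x'] x' by simp
qed

lemma poly_strict_mono_between:
  fixes q :: "real poly"
  assumes "\<And>z. a < z \<Longrightarrow> z < b \<Longrightarrow> poly (pderiv q) z > 0" "a \<le> x" "x < y" "y \<le> b"
  shows "poly q x < poly q y"
proof -
  obtain z where "x < z" "z < y" "poly q y - poly q x = (y - x) * poly (pderiv q) z"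
    using poly_MVT[OF assms(3)] by blast
  moreover have "(y - x) * poly (pderiv q) z > 0"
    using assms \<open>x < z\<close> \<open>z < y\<close> by (intro mult_pos_pos) auto
  ultimately show ?thesis by simp
qed

text \<open>Both polynomials increase strictly on their intervals, so the end point signs either
  settle everything or leave a single crossing. In the latter case \<open>root\<close> aligns the
  two crossings, and the order decides on either side.\<close>

lemma sgn_match_between_pos:
  fixes q q' :: "real poly"
  assumes d: "\<And>z. a < z \<Longrightarrow> z < b \<Longrightarrow> poly (pderiv q) z > 0"
    and d': "\<And>z. \<psi> a < z \<Longrightarrow> z < \<psi> b \<Longrightarrow> poly (pderiv q') z > 0"
    and sa: "sgn (poly q a) = sgn (poly q' (\<psi> a))"
    and sb: "sgn (poly q b) = sgn (poly q' (\<psi> b))"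
    and \<psi>: "strict_mono \<psi>"
    and root: "\<And>y. a < y \<Longrightarrow> y < b \<Longrightarrow> poly q y = 0 \<Longrightarrow> poly q' (\<psi> y) = 0"
    and x: "a < x" "x < b"
  shows "sgn (poly q x) = sgn (poly q' (\<psi> x))"
proof -
  have mono: "poly q s < poly q t" if "a \<le> s" "s < t" "t \<le> b" for s t
    using poly_strict_mono_between[of a b q s t] d that by blast
  have mono': "poly q' s < poly q' t" if "\<psi> a \<le> s" "s < t" "t \<le> \<psi> b" for s t
    using poly_strict_mono_between[of "\<psi> a" "\<psi> b" q' s t] d' that by blast
  have \<psi>x: "\<psi> a < \<psi> x" "\<psi> x < \<psi> b" using \<psi> x by (auto simp: strict_mono_less)
  have m: "poly q a < poly q x" "poly q x < poly q b" using mono x by auto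
  have m': "poly q' (\<psi> a) < poly q' (\<psi> x)" "poly q' (\<psi> x) < poly q' (\<psi> b)"
    using mono' \<psi>x by auto
  consider "poly q a \<ge> 0" | "poly q b \<le> 0" | "poly q a < 0" "poly q b > 0" by linarith
  then show ?thesis
  proof cases
    case 1
    then have "poly q' (\<psi> a) \<ge> 0" using sa by (auto simp: sgn_if split: if_splits)
    then show ?thesis using m m' 1 by auto
  next
    case 2
    then have "poly q' (\<psi> b) \<le> 0" using sb by (auto simp: sgn_if split: if_splits)
    then show ?thesis using m m' 2 by auto
  next
    case 3
    then obtain y where y: "a < y" "y < b" "poly q y = 0"
      using poly_IVT_pos[of a b q] x by auto
    then have y': "poly q' (\<psi> y) = 0" using root by auto
    have \<psi>y: "\<psi> a < \<psi> y" "\<psi> y < \<psi> b" using \<psi> y by (auto simp: strict_mono_less)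
    show ?thesis
    proof (cases x y rule: linorder_cases)
      case less
      then have "\<psi> x < \<psi> y" using \<psi> by (auto simp: strict_mono_less)
      then have "poly q' (\<psi> x) < 0" using mono'[of "\<psi> x" "\<psi> y"] \<psi>x \<psi>y y' by auto
      moreover have "poly q x < 0" using mono[of x y] less x y by auto
      ultimately show ?thesis by simp
    next
      case equal
      then show ?thesis using y y' by simp
    next
      case greater
      then have "\<psi> y < \<psi> x" using \<psi> by (auto simp: strict_mono_less)
      then have "poly q' (\<psi> x) > 0" using mono'[of "\<psi> y" "\<psi> x"] \<psi>x \<psi>y y' by auto
      moreover have "poly q x > 0" using mono[of y x] greater x y by auto
      ultimately show ?thesis by simp
    qed
  qed
qed

lemma sgn_minus_one_power: "sgn ((-1) ^ n :: real) = (-1) ^ n"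
  by (cases "even n") auto

lemma poly_sgn_at_infinity:
  fixes q :: "real poly"
  assumes "q \<noteq> 0"
  obtains M where "\<And>x. x \<ge> M \<Longrightarrow> sgn (poly q x) = sgn (lead_coeff q)"
    "\<And>x. x \<le> - M \<Longrightarrow> sgn (poly q x) = (-1) ^ degree q * sgn (lead_coeff q)"
proof -
  have *: "\<exists>M. \<forall>x\<ge>M. sgn (poly q x) = sgn (lead_coeff q)" if "q \<noteq> 0" for q :: "real poly"
  proof (cases "lead_coeff q > 0")
    case True
    obtain n where n: "\<forall>x\<ge>n. poly q x \<ge> lead_coeff q"
      using poly_pinfty_gt_lc[OF True] by blast
    have "poly q x > 0" if "x \<ge> n" for x using n that True by fastforce
    then show ?thesis using True by (intro exI[of _ n]) auto
  next
    case False
    then have neg: "lead_coeff q < 0" using that by (simp add: less_le not_less)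
    then have pos: "lead_coeff (- q) > 0" by (simp add: degree_minus)
    obtain n where n: "\<forall>x\<ge>n. poly (- q) x \<ge> lead_coeff (- q)"
      using poly_pinfty_gt_lc[OF pos] by blast
    have "poly (- q) x > 0" if "x \<ge> n" for x using n that pos by fastforce
    then have "\<And>x. x \<ge> n \<Longrightarrow> poly q x < 0" by simp
    then show ?thesis using neg by (intro exI[of _ n]) auto
  qed
  obtain M1 where M1: "\<And>x. x \<ge> M1 \<Longrightarrow> sgn (poly q x) = sgn (lead_coeff q)"
    using *[OF assms] by blast
  \<comment> \<open>Reflection in 0 reduces the behaviour at minus infinity to that at plus
    infinity.\<close>
  define r where "r = pcompose q [:0, -1:]"
  have r0: "r \<noteq> 0" using assms by (simp add: r_def pcompose_eq_0_iff)
  have lc: "lead_coeff r = lead_coeff q * (-1) ^ degree q"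
    unfolding r_def by (subst lead_coeff_comp) auto
  obtain M2 where M2: "\<And>x. x \<ge> M2 \<Longrightarrow> sgn (poly r x) = sgn (lead_coeff r)"
    using *[OF r0] by blast
  show ?thesis
  proof (rule that[of "max M1 M2"])
    show "sgn (poly q x) = sgn (lead_coeff q)" if "x \<ge> max M1 M2" for x using M1 that by simp
    fix x :: real assume "x \<le> - max M1 M2"
    then have "- x \<ge> M2" by linarith
    then have "sgn (poly r (- x)) = sgn (lead_coeff r)" by (rule M2)
    moreover have "poly r (- x) = poly q x" by (simp add: r_def poly_pcompose)
    ultimately show "sgn (poly q x) = (-1) ^ degree q * sgn (lead_coeff q)"
      by (simp add: lc sgn_mult sgn_minus_one_power)
  qed
qed

lemma finite_neighbours:
  fixes Z :: "real set"
  assumes "finite Z" "x \<notin> Z" "l \<in> Z" "l < x" "r \<in> Z" "x < r"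
  obtains a b where "a \<in> Z" "b \<in> Z" "a < x" "x < b" "\<And>z. z \<in> Z \<Longrightarrow> z \<le> a \<or> b \<le> z"
proof -
  let ?L = "{z \<in> Z. z < x}" and ?R = "{z \<in> Z. x < z}"
  have f: "finite ?L" "finite ?R" "?L \<noteq> {}" "?R \<noteq> {}" using assms by auto
  show ?thesis
  proof (rule that[of "Max ?L" "Min ?R"])
    show "Max ?L \<in> Z" "Max ?L < x" using Max_in[OF f(1,3)] by auto
    show "Min ?R \<in> Z" "x < Min ?R" using Min_in[OF f(2,4)] by auto
    fix z assume z: "z \<in> Z"
    then have "z < x \<or> x < z" using assms(2) by (cases z x rule: linorder_cases) auto
    then show "z \<le> Max ?L \<or> Min ?R \<le> z"
      using Max_ge[OF f(1), of z] Min_le[OF f(2), of z] z by auto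
  qed
qed

text \<open>The derivative keeps one sign on the interval, and the matching hands this sign to the
  image interval, every point of which is an image because \<open>\<psi>\<close> is onto. A negative
  derivative is treated by negating both polynomials.\<close>

lemma sgn_match_between:
  fixes q q' :: "real poly"
  assumes d: "\<And>z. a < z \<Longrightarrow> z < b \<Longrightarrow> poly (pderiv q) z \<noteq> 0"
    and match: "\<And>z. sgn (poly (pderiv q) z) = sgn (poly (pderiv q') (\<psi> z))"
    and sa: "sgn (poly q a) = sgn (poly q' (\<psi> a))"
    and sb: "sgn (poly q b) = sgn (poly q' (\<psi> b))"
    and \<psi>: "strict_mono \<psi>" "surj \<psi>"
    and root: "\<And>y. a < y \<Longrightarrow> y < b \<Longrightarrow> poly q y = 0 \<Longrightarrow> poly q' (\<psi> y) = 0"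
    and x: "a < x" "x < b"
  shows "sgn (poly q x) = sgn (poly q' (\<psi> x))"
proof -
  have const: "sgn (poly (pderiv q) z) = sgn (poly (pderiv q) x)" if "a < z" "z < b" for z
    by (rule sgn_poly_eq_no_root) (use d that x in \<open>auto simp: min_def max_def split: if_splits\<close>)
  have const': "sgn (poly (pderiv q') w) = sgn (poly (pderiv q) x)" if "\<psi> a < w" "w < \<psi> b" for w
  proof -
    obtain z where "w = \<psi> z" using \<psi>(2) by (metis surjD)
    then show ?thesis using that const[of z] match[of z] \<psi>(1) by (simp add: strict_mono_less)
  qed
  have dx: "poly (pderiv q) x \<noteq> 0" using d x by auto
  show ?thesis
  proof (cases "poly (pderiv q) x > 0")
    case True
    show ?thesis
    proof (rule sgn_match_between_pos[OF _ _ sa sb \<psi>(1) root x])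
      show "poly (pderiv q) z > 0" if "a < z" "z < b" for z
        using const[OF that] True by (simp add: sgn_1_pos)
      show "poly (pderiv q') z > 0" if "\<psi> a < z" "z < \<psi> b" for z
        using const'[OF that] True by (simp add: sgn_1_pos)
    qed
  next
    case False
    then have neg: "poly (pderiv q) x < 0" using dx by linarith
    have "sgn (poly (- q) x) = sgn (poly (- q') (\<psi> x))"
    proof (rule sgn_match_between_pos[where a=a and b=b, OF _ _ _ _ \<psi>(1) _ x])
      show "poly (pderiv (- q)) z > 0" if "a < z" "z < b" for z
        using const[OF that] neg by (simp add: pderiv_minus sgn_1_neg)
      show "poly (pderiv (- q')) z > 0" if "\<psi> a < z" "z < \<psi> b" for z
        using const'[OF that] neg by (simp add: pderiv_minus sgn_1_neg)
    qed (use sa sb root in \<open>auto simp: sgn_minus\<close>)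
    then show ?thesis by (simp add: sgn_minus)
  qed
qed

text \<open>Two roots would enclose a zero of the derivative. The mean value theorem on each side of
  \<open>y\<close> gives opposite signs at the end points, the datum from which
  \<open>extend_matching\<close> obtains a root of \<open>q'\<close> in the image interval.\<close>

lemma unique_simple_root_between:
  fixes q :: "real poly"
  assumes d: "\<And>z. a < z \<Longrightarrow> z < b \<Longrightarrow> poly (pderiv q) z \<noteq> 0"
    and y: "a < y" "y < b" "poly q y = 0"
  shows "a \<le> w \<Longrightarrow> w \<le> b \<Longrightarrow> poly q w = 0 \<Longrightarrow> w = y" and "poly q a * poly q b < 0"
proof -
  have inj: "w = y" if w: "a \<le> w" "w \<le> b" "poly q w = 0" and y: "a \<le> y" "y \<le> b" "poly q y = 0" for w y
  proof (rule ccontr)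
    assume ne: "w \<noteq> y"
    have "\<exists>z. min w y < z \<and> z < max w y \<and> poly q (max w y) - poly q (min w y) = (max w y - min w y) * poly (pderiv q) z"
      using ne by (intro poly_MVT) auto
    then obtain z where z: "min w y < z" "z < max w y"
      "poly q (max w y) - poly q (min w y) = (max w y - min w y) * poly (pderiv q) z"
      by blast
    have "poly (pderiv q) z \<noteq> 0" using z(1,2) w y d[of z] by (auto simp: min_def max_def split: if_splits)
    moreover have "poly q (max w y) = 0" "poly q (min w y) = 0" using w y by (auto simp: min_def max_def)
    ultimately show False using z(3) ne by (auto simp: min_def max_def split: if_splits)
  qed
  show "a \<le> w \<Longrightarrow> w \<le> b \<Longrightarrow> poly q w = 0 \<Longrightarrow> w = y"
    using inj[of w y] y by simp
  have const: "sgn (poly (pderiv q) z) = sgn (poly (pderiv q) y)" if "a < z" "z < b" for z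
    by (rule sgn_poly_eq_no_root) (use d that y in \<open>auto simp: min_def max_def split: if_splits\<close>)
  obtain z1 where z1: "a < z1" "z1 < y" "poly q y - poly q a = (y - a) * poly (pderiv q) z1"
    using poly_MVT[OF y(1)] by blast
  obtain z2 where z2: "y < z2" "z2 < b" "poly q b - poly q y = (b - y) * poly (pderiv q) z2"
    using poly_MVT[OF y(2)] by blast
  have s: "sgn (poly q a) = - sgn (poly (pderiv q) y)" "sgn (poly q b) = sgn (poly (pderiv q) y)"
  proof -
    have a: "poly q a = - ((y - a) * poly (pderiv q) z1)" using z1 y(3) by simp
    have b: "poly q b = (b - y) * poly (pderiv q) z2" using z2 y(3) by simp
    show "sgn (poly q a) = - sgn (poly (pderiv q) y)"
      unfolding a using const[of z1] z1 y by (simp add: sgn_mult sgn_minus)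
    show "sgn (poly q b) = sgn (poly (pderiv q) y)"
      unfolding b using const[of z2] z2 y by (simp add: sgn_mult)
  qed
  have "poly (pderiv q) y \<noteq> 0" using d y by auto
  then have "sgn (poly q a * poly q b) = -1" unfolding sgn_mult s by (simp add: sgn_if)
  then show "poly q a * poly q b < 0" by (simp add: sgn_1_neg)
qed

text \<open>
  A root of \<open>q\<close> that is not a root of some \<open>P j\<close> lies in an interval on which \<open>q\<close> is strictly monotone,
  and the signs at the ends of the interval force \<open>q'\<close> to have exactly one root in the image
  interval. It suffices to bend \<open>\<phi>\<close> inside that interval so that it maps the one root to the other.
\<close>

lemma extend_matching:
  fixes q q' :: "real poly" and P P' :: "'i \<Rightarrow> real poly"
  assumes fin: "finite J"
    and \<phi>: "strict_mono \<phi>" "surj \<phi>"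
    and match: "\<And>j x. j \<in> J \<Longrightarrow> sgn (poly (P j) x) = sgn (poly (P' j) (\<phi> x))"
    and k: "k \<in> J" "P k = pderiv q" "P' k = pderiv q'"
    and deg: "degree q' = degree q" "degree q > 0"
    and lead: "sgn (lead_coeff q) = sgn (lead_coeff q')"
    and root: "\<And>j x. j \<in> J \<Longrightarrow> P j \<noteq> 0 \<Longrightarrow> poly (P j) x = 0
                 \<Longrightarrow> sgn (poly q x) = sgn (poly q' (\<phi> x))"
  obtains \<psi> where "strict_mono \<psi>" "surj \<psi>"
    "\<And>j x. j \<in> J \<Longrightarrow> sgn (poly (P j) x) = sgn (poly (P' j) (\<psi> x))"
    "\<And>x. sgn (poly q x) = sgn (poly q' (\<psi> x))"
proof -
  have q0: "q \<noteq> 0" "q' \<noteq> 0" and dq0: "pderiv q \<noteq> 0" using deg by (auto simp: pderiv_eq_0_iff)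
  \<comment> \<open>Zero polynomials are excluded, which keeps the set finite. As
    \<open>pderiv q\<close> is among the \<open>P j\<close>, \<open>q\<close> is strictly monotone
    between neighbouring points.\<close>
  define Z0 where "Z0 = (\<Union>j\<in>{j\<in>J. P j \<noteq> 0}. {x. poly (P j) x = 0})"
  have finZ0: "finite Z0" unfolding Z0_def using fin by (auto intro: poly_roots_finite)
  obtain M1 where M1: "\<And>x. x \<ge> M1 \<Longrightarrow> sgn (poly q x) = sgn (lead_coeff q)"
    "\<And>x. x \<le> - M1 \<Longrightarrow> sgn (poly q x) = (-1) ^ degree q * sgn (lead_coeff q)"
    using poly_sgn_at_infinity[OF q0(1)] by metis
  obtain M2 where M2: "\<And>x. x \<ge> M2 \<Longrightarrow> sgn (poly q' x) = sgn (lead_coeff q')"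
    "\<And>x. x \<le> - M2 \<Longrightarrow> sgn (poly q' x) = (-1) ^ degree q' * sgn (lead_coeff q')"
    using poly_sgn_at_infinity[OF q0(2)] by metis
  obtain r2 where r2: "\<phi> r2 = M2" using \<phi>(2) by (metis surjD)
  obtain l2 where l2: "\<phi> l2 = - M2" using \<phi>(2) by (metis surjD)
  \<comment> \<open>Beyond \<open>l\<close> and \<open>r\<close> both \<open>q\<close> and the image
    under \<open>q'\<close> already show their signs at infinity, which the degree and the leading
    coefficient determine. The entries 1 and -1 only ensure \<open>l < r\<close>.\<close>
  define r where "r = max 1 (max M1 r2)"
  define l where "l = min (- 1) (min (- M1) l2)"
  define Z where "Z = insert l (insert r Z0)"
  have finZ: "finite Z" using finZ0 by (simp add: Z_def)
  have Zlr: "l \<in> Z" "r \<in> Z" by (auto simp: Z_def)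
  have lr: "l < r" by (simp add: l_def r_def)
  have out_r: "sgn (poly q x) = sgn (lead_coeff q) \<and> sgn (poly q' (\<psi> x)) = sgn (lead_coeff q)"
    if "r \<le> x" "strict_mono \<psi>" "\<psi> r = \<phi> r" for x \<psi>
  proof -
    have "M2 \<le> \<phi> r" using \<phi>(1) r2 by (metis max.cobounded2 max.coboundedI2 r_def strict_mono_less_eq)
    also have "\<dots> \<le> \<psi> x" using that by (metis strict_mono_less_eq)
    finally show ?thesis using M1(1)[of x] M2(1)[of "\<psi> x"] that(1) lead by (simp add: r_def)
  qed
  have out_l: "sgn (poly q x) = (-1) ^ degree q * sgn (lead_coeff q)
      \<and> sgn (poly q' (\<psi> x)) = (-1) ^ degree q * sgn (lead_coeff q)"
    if "x \<le> l" "strict_mono \<psi>" "\<psi> l = \<phi> l" for x \<psi>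
  proof -
    have "\<psi> x \<le> \<phi> l" using that by (metis strict_mono_less_eq)
    also have "\<dots> \<le> \<phi> l2" using \<phi>(1) by (simp add: l_def strict_mono_less_eq)
    finally have "\<psi> x \<le> - M2" using l2 by simp
    then show ?thesis using M1(2)[of x] M2(2)[of "\<psi> x"] that(1) lead deg by (simp add: l_def)
  qed
  have sZ: "sgn (poly q z) = sgn (poly q' (\<phi> z))" if "z \<in> Z" for z
  proof -
    consider "z = l" | "z = r" | "z \<in> Z0" using \<open>z \<in> Z\<close> unfolding Z_def by blast
    then show ?thesis
    proof cases
      case 3
      then show ?thesis using root unfolding Z0_def by blast
    qed (use out_r[of z \<phi>] out_l[of z \<phi>] \<phi> in simp_all)
  qed
  have dZ: "poly (pderiv q) z \<noteq> 0" if "z \<notin> Z" for z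
    using k dq0 that by (auto simp: Z_def Z0_def)
  have Pmatch: "sgn (poly (P j) x) = sgn (poly (P' j) (\<psi> x))"
    if "j \<in> J" "strict_mono \<psi>" "\<forall>z\<in>Z. \<psi> z = \<phi> z" for j x \<psi>
    by (rule matching_of_agree_on_roots[OF \<phi> that(2)])
       (use match that in \<open>auto simp: Z_def Z0_def\<close>)
  \<comment> \<open>The roots are aligned one at a time. A gap of \<open>Z\<close> holds at most one
    root of \<open>q\<close>, and each bend is the identity outside the image of its gap, so neither
    \<open>Z\<close> nor the roots treated earlier are disturbed.\<close>
  have step: "\<exists>\<psi>. strict_mono \<psi> \<and> surj \<psi> \<and> (\<forall>z\<in>Z. \<psi> z = \<phi> z) \<and> (\<forall>y\<in>Y. poly q' (\<psi> y) = 0)"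
    if "finite Y" "Y \<subseteq> {y. poly q y = 0 \<and> y \<notin> Z \<and> l < y \<and> y < r}" for Y
    using that
  proof (induction Y rule: finite_induct)
    case empty
    then show ?case using \<phi> by blast
  next
    case (insert y Y)
    then obtain \<psi> where \<psi>: "strict_mono \<psi>" "surj \<psi>" "\<forall>z\<in>Z. \<psi> z = \<phi> z" "\<forall>y\<in>Y. poly q' (\<psi> y) = 0"
      by auto
    have y: "poly q y = 0" "y \<notin> Z" "l < y" "y < r" using insert.prems by auto
    obtain a b where ab: "a \<in> Z" "b \<in> Z" "a < y" "y < b" "\<And>z. z \<in> Z \<Longrightarrow> z \<le> a \<or> b \<le> z"
      using finite_neighbours[OF finZ y(2) Zlr(1) y(3) Zlr(2) y(4)] by metis
    have dab: "poly (pderiv q) z \<noteq> 0" if "a < z" "z < b" for z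
      using dZ[of z] ab(5)[of z] that by auto
    note uniq = unique_simple_root_between[OF dab ab(3,4) y(1)]
    have \<psi>ab: "\<psi> a = \<phi> a" "\<psi> b = \<phi> b" using \<psi>(3) ab by auto
    have lt: "\<psi> a < \<psi> y" "\<psi> y < \<psi> b" "\<psi> a < \<psi> b" using \<psi>(1) ab by (auto simp: strict_mono_less)
    have "sgn (poly q' (\<psi> a) * poly q' (\<psi> b)) = sgn (poly q a * poly q b)"
      by (simp add: sgn_mult \<psi>ab sZ ab)
    then have "poly q' (\<psi> a) * poly q' (\<psi> b) < 0" using uniq(2) by (simp add: sgn_1_neg)
    then obtain y' where y': "\<psi> a < y'" "y' < \<psi> b" "poly q' y' = 0"
      using poly_IVT[OF lt(3)] by blast
    obtain h where h: "strict_mono h" "surj h" "h (\<psi> y) = y'" "\<And>z. z \<le> \<psi> a \<or> \<psi> b \<le> z \<Longrightarrow> h z = z"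
      using move_point[OF lt(1,2) y'(1,2)] by metis
    have "strict_mono (h \<circ> \<psi>)" using h(1) \<psi>(1) by (simp add: strict_mono_o)
    moreover have "surj (h \<circ> \<psi>)" using h(2) \<psi>(2) by (rule comp_surj[rotated])
    moreover have fixz: "(h \<circ> \<psi>) z = \<psi> z" if "z \<le> a \<or> b \<le> z" for z
      using that h(4)[of "\<psi> z"] \<psi>(1) by (auto simp: strict_mono_less_eq)
    moreover have "\<forall>z\<in>Z. (h \<circ> \<psi>) z = \<phi> z" using ab(5) fixz \<psi>(3) by metis
    moreover have "poly q' ((h \<circ> \<psi>) w) = 0" if "w \<in> insert y Y" for w
    proof (cases "w = y")
      case True
      then show ?thesis using h y' by simp
    next
      case False
      then have w: "w \<in> Y" "poly q w = 0" using that insert.prems by auto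
      then have "w \<le> a \<or> b \<le> w" using uniq(1)[of w] False by linarith
      then show ?thesis using fixz w \<psi>(4) by simp
    qed
    ultimately show ?case by blast
  qed
  have "finite {y. poly q y = 0 \<and> y \<notin> Z \<and> l < y \<and> y < r}"
    by (rule finite_subset[OF _ poly_roots_finite[OF q0(1)]]) auto
  from step[OF this subset_refl] obtain \<psi> where \<psi>: "strict_mono \<psi>" "surj \<psi>" "\<forall>z\<in>Z. \<psi> z = \<phi> z"
    and \<psi>r: "\<And>y. poly q y = 0 \<Longrightarrow> y \<notin> Z \<Longrightarrow> l < y \<Longrightarrow> y < r \<Longrightarrow> poly q' (\<psi> y) = 0"
    by blast
  show ?thesis
  proof (rule that[OF \<psi>(1,2)])
    show "sgn (poly (P j) x) = sgn (poly (P' j) (\<psi> x))" if "j \<in> J" for j x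
      using Pmatch that \<psi> by blast
    show "sgn (poly q x) = sgn (poly q' (\<psi> x))" for x
    proof -
      consider "x \<le> l" | "r \<le> x" | "x \<in> Z" | "x \<notin> Z" "l < x" "x < r" by linarith
      then show ?thesis
      proof cases
        case 1
        then show ?thesis using out_l[of x \<psi>] \<psi> Zlr by simp
      next
        case 2
        then show ?thesis using out_r[of x \<psi>] \<psi> Zlr by simp
      next
        case 3
        then show ?thesis using sZ \<psi>(3) by simp
      next
        case 4
        obtain a b where ab: "a \<in> Z" "b \<in> Z" "a < x" "x < b" "\<And>z. z \<in> Z \<Longrightarrow> z \<le> a \<or> b \<le> z"
          using finite_neighbours[OF finZ 4(1) Zlr(1) 4(2) Zlr(2) 4(3)] by metis
        have notZ: "z \<notin> Z" if "a < z" "z < b" for z using ab(5)[of z] that by auto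
        have lar: "l \<le> a" "b \<le> r" using ab(5)[OF Zlr(1)] ab(5)[OF Zlr(2)] 4 ab(3,4) by auto
        show ?thesis
        proof (rule sgn_match_between[OF _ _ _ _ \<psi>(1,2) _ ab(3,4)])
          show "sgn (poly (pderiv q) z) = sgn (poly (pderiv q') (\<psi> z))" for z
            using Pmatch[OF k(1) \<psi>(1,3)] k by simp
          show "poly q' (\<psi> y) = 0" if "a < y" "y < b" "poly q y = 0" for y
            using \<psi>r notZ that lar by simp
        qed (use dZ notZ sZ \<psi>(3) ab in auto)
      qed
    qed
  qed
qed

section \<open>Quantifier elimination for polynomial sign conditions\<close>

definition fun_ring :: "('p \<Rightarrow> real) set \<Rightarrow> bool" where
  "fun_ring R \<longleftrightarrow> (\<forall>c. (\<lambda>_. c) \<in> R) \<and>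
     (\<forall>f\<in>R. \<forall>g\<in>R. (\<lambda>p. f p + g p) \<in> R \<and> (\<lambda>p. f p * g p) \<in> R)"

text \<open>A polynomial whose coefficients vary with a parameter. The bound \<open>d\<close> is
  uniform, while the true degree may drop where a leading coefficient vanishes; the inductions run
  on \<open>d\<close>.\<close>

definition poly_family :: "('p \<Rightarrow> real) set \<Rightarrow> nat \<Rightarrow> ('p \<Rightarrow> real poly) \<Rightarrow> bool" where
  "poly_family R d q \<longleftrightarrow> (\<forall>i. (\<lambda>p. coeff (q p) i) \<in> R) \<and> (\<forall>p. degree (q p) \<le> d)"

text \<open>Indistinguishability by sign conditions on members of \<open>F\<close>. It replaces
  quantifier-free formulas: a property decided by finitely many signs is one that is invariant under
  this relation for a finite \<open>F\<close>.\<close>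

definition sgn_equiv :: "('p \<Rightarrow> real) set \<Rightarrow> 'p \<Rightarrow> 'p \<Rightarrow> bool" where
  "sgn_equiv F p p' \<longleftrightarrow> (\<forall>f\<in>F. sgn (f p) = sgn (f p'))"

lemma fun_ring_const: "fun_ring R \<Longrightarrow> (\<lambda>_. c) \<in> R"
  and fun_ring_add: "fun_ring R \<Longrightarrow> f \<in> R \<Longrightarrow> g \<in> R \<Longrightarrow> (\<lambda>p. f p + g p) \<in> R"
  and fun_ring_mult: "fun_ring R \<Longrightarrow> f \<in> R \<Longrightarrow> g \<in> R \<Longrightarrow> (\<lambda>p. f p * g p) \<in> R"
  by (auto simp: fun_ring_def)

lemma fun_ring_diff: "fun_ring R \<Longrightarrow> f \<in> R \<Longrightarrow> g \<in> R \<Longrightarrow> (\<lambda>p. f p - g p) \<in> R"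
  using fun_ring_add[of R f "\<lambda>p. -1 * g p"] fun_ring_mult[of R "\<lambda>_. -1" g] fun_ring_const[of R "-1"] by simp

lemma fun_ring_sum:
  assumes "fun_ring R" "\<And>i. i \<in> I \<Longrightarrow> f i \<in> R"
  shows "(\<lambda>p. \<Sum>i\<in>I. f i p) \<in> R"
  using assms(2)
  by (induction I rule: infinite_finite_induct) (simp_all add: fun_ring_const fun_ring_add assms(1))

lemma poly_family_mono: "poly_family R d q \<Longrightarrow> d \<le> d' \<Longrightarrow> poly_family R d' q"
  unfolding poly_family_def by (meson order_trans)

lemma poly_family_pderiv:
  assumes "fun_ring R" "poly_family R (Suc d) q"
  shows "poly_family R d (\<lambda>p. pderiv (q p))"
proof -
  have "degree (pderiv (q p)) \<le> d" for p
    using assms(2) unfolding poly_family_def by (simp add: degree_pderiv le_diff_conv)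
  moreover have "(\<lambda>p. coeff (pderiv (q p)) i) \<in> R" for i
    using fun_ring_mult[OF assms(1) fun_ring_const[OF assms(1)]] assms(2)
    by (simp add: coeff_pderiv poly_family_def del: of_nat_Suc)
  ultimately show ?thesis by (simp add: poly_family_def)
qed

lemma poly_family_cutoff:
  assumes "fun_ring R" "poly_family R d' q"
  shows "poly_family R d (\<lambda>p. poly_cutoff (Suc d) (q p))"
proof -
  have "(\<lambda>p. coeff (poly_cutoff (Suc d) (q p)) i) \<in> R" for i
    using assms(2) fun_ring_const[OF assms(1), of 0]
    by (cases "i < Suc d") (simp_all add: coeff_poly_cutoff poly_family_def)
  then show ?thesis by (auto simp: poly_family_def coeff_poly_cutoff intro!: degree_le)
qed

lemma poly_cutoff_eq: "degree q \<le> d \<Longrightarrow> poly_cutoff (Suc d) q = q"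
  by (auto simp: poly_eq_iff coeff_poly_cutoff coeff_eq_0)

text \<open>
  Multiplying by the square of the leading coefficient of the divisor, rather than by the
  coefficient itself, keeps the sign of the dividend.
\<close>

lemma pseudo_remainder:
  assumes R: "fun_ring R" and r: "poly_family R d' r" and e: "0 < e"
  shows "poly_family R N q \<Longrightarrow> \<exists>s. poly_family R (e - 1) s \<and>
    (\<forall>p x. degree (r p) = e \<longrightarrow> poly (r p) x = 0 \<longrightarrow> sgn (poly (s p) x) = sgn (poly (q p) x))"
proof (induction N arbitrary: q)
  case 0
  then show ?case using poly_family_mono[OF 0, of "e - 1"] by blast
next
  case (Suc N)
  show ?case
  proof (cases "Suc N < e")
    case True
    then have "Suc N \<le> e - 1" by simp
    then show ?thesis using poly_family_mono[OF Suc.prems, of "e - 1"] by blast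
  next
    case False
    define c where "c p = coeff (r p) e" for p
    \<comment> \<open>The truncation equals \<open>r p\<close> wherever the degree is
      \<open>e\<close>, the only case in which the sign claim is made, and it makes the top
      coefficient of \<open>q1\<close> cancel at every parameter, so that the degree bound stays
      uniform.\<close>
    define re where "re p = poly_cutoff (Suc e) (r p)" for p
    define q1 where "q1 p = smult (c p * c p) (q p) - monom (c p * coeff (q p) (Suc N)) (Suc N - e) * re p" for p
    have cR: "c \<in> R" using r unfolding c_def[abs_def] poly_family_def by blast
    have qR: "(\<lambda>p. coeff (q p) i) \<in> R" for i using Suc.prems unfolding poly_family_def by blast
    have reR: "poly_family R e re" unfolding re_def[abs_def] using poly_family_cutoff[OF R r] .
    have cf: "coeff (q1 p) i = c p * c p * coeff (q p) i
        - c p * coeff (q p) (Suc N) * (if Suc N - e \<le> i then coeff (re p) (i - (Suc N - e)) else 0)" for p i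
      by (simp add: q1_def coeff_monom_mult)
    have "(\<lambda>p. coeff (q1 p) i) \<in> R" for i
    proof -
      have "(\<lambda>p. if Suc N - e \<le> i then coeff (re p) (i - (Suc N - e)) else 0) \<in> R"
        using reR fun_ring_const[OF R, of 0] by (cases "Suc N - e \<le> i") (simp_all add: poly_family_def)
      then show ?thesis unfolding cf
        by (intro fun_ring_diff[OF R] fun_ring_mult[OF R] cR qR)
    qed
    moreover have "degree (q1 p) \<le> N" for p
    proof (rule degree_le, intro allI impI)
      fix i assume i: "i > N"
      show "coeff (q1 p) i = 0"
      proof (cases "i = Suc N")
        case True
        then show ?thesis using False unfolding cf by (simp add: re_def coeff_poly_cutoff c_def)
      next
        case F: False
        then have "coeff (q p) i = 0" using Suc.prems i unfolding poly_family_def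
          by (metis coeff_eq_0 le_less_trans less_antisym not_less_eq)
        moreover have "coeff (re p) (i - (Suc N - e)) = 0"
          using F i False by (simp add: re_def coeff_poly_cutoff)
        ultimately show ?thesis unfolding cf by simp
      qed
    qed
    ultimately have "poly_family R N q1" by (simp add: poly_family_def)
    from Suc.IH[OF this] obtain s where s: "poly_family R (e - 1) s"
      "\<And>p x. degree (r p) = e \<Longrightarrow> poly (r p) x = 0 \<Longrightarrow> sgn (poly (s p) x) = sgn (poly (q1 p) x)"
      by blast
    have "sgn (poly (q1 p) x) = sgn (poly (q p) x)" if "degree (r p) = e" "poly (r p) x = 0" for p x
    proof -
      have "re p = r p" using that by (simp add: re_def poly_cutoff_eq)
      then have "poly (q1 p) x = c p * c p * poly (q p) x" using that by (simp add: q1_def)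
      moreover have "c p \<noteq> 0" using that e by (auto simp: c_def)
      then have "sgn (c p * c p) = 1" by (auto simp: sgn_1_pos zero_less_mult_iff)
      ultimately show ?thesis by (simp only: sgn_mult mult_1_left)
    qed
    then show ?thesis using s by (intro exI[of _ s]) simp
  qed
qed

text \<open>Finitely many functions of the parameter fix the common sign table of \<open>Q\<close>
  along the line. An increasing bijection, rather than a mere equality of attained sign patterns, is
  demanded because the induction compares intervals between roots and uses the sign of the
  derivative on them.\<close>

definition sign_determined :: "('p \<Rightarrow> real) set \<Rightarrow> ('p \<Rightarrow> real poly) set \<Rightarrow> bool" where
  "sign_determined R Q \<longleftrightarrow> (\<exists>F. finite F \<and> F \<subseteq> R \<and> (\<forall>p p'. sgn_equiv F p p' \<longrightarrow>
     (\<exists>\<phi>. strict_mono \<phi> \<and> surj \<phi> \<and> (\<forall>q\<in>Q. \<forall>x. sgn (poly (q p) x) = sgn (poly (q p') (\<phi> x))))))"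

lemma sign_determined_constants:
  assumes "finite Q" "\<And>q. q \<in> Q \<Longrightarrow> poly_family R 0 q"
  shows "sign_determined R Q"
proof -
  let ?F = "(\<lambda>q p. coeff (q p) 0) ` Q"
  have c: "poly (q p) x = coeff (q p) 0" if "q \<in> Q" for q p x
  proof -
    have "degree (q p) = 0" using assms(2)[OF that] by (simp add: poly_family_def)
    then obtain a where "q p = [:a:]" by (rule degree_eq_zeroE)
    then show ?thesis by simp
  qed
  show ?thesis unfolding sign_determined_def
  proof (intro exI[of _ ?F] conjI allI impI)
    show "?F \<subseteq> R" using assms(2) by (auto simp: poly_family_def)
    fix p p' assume eq: "sgn_equiv ?F p p'"
    show "\<exists>\<phi>. strict_mono \<phi> \<and> surj \<phi> \<and> (\<forall>q\<in>Q. \<forall>x. sgn (poly (q p) x) = sgn (poly (q p') (\<phi> x)))"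
      using eq c by (intro exI[of _ "\<lambda>x. x"]) (auto simp: sgn_equiv_def strict_mono_def)
  qed (use assms(1) in simp)
qed

lemma degree_cong_sgn:
  fixes p q :: "real poly"
  assumes "\<And>i. i \<le> d \<Longrightarrow> sgn (coeff p i) = sgn (coeff q i)" "degree p \<le> d" "degree q \<le> d"
  shows "degree p = degree q"
proof -
  have z: "coeff p i = 0 \<longleftrightarrow> coeff q i = 0" for i
  proof (cases "i \<le> d")
    case True
    then show ?thesis using assms(1)[of i] by (auto simp: sgn_if split: if_splits)
  next
    case False
    then show ?thesis using assms by (simp add: coeff_eq_0)
  qed
  show ?thesis
  proof (rule antisym)
    show "degree p \<le> degree q" by (intro degree_le allI impI) (use z coeff_eq_0 in blast)
    show "degree q \<le> degree p" by (intro degree_le allI impI) (use z coeff_eq_0 in blast)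
  qed
qed

text \<open>
  The derivative of \<open>q\<close> and the remainders of \<open>q\<close> modulo the other families have smaller degree, and
  the remainders give the sign of \<open>q\<close> at the roots of the other families. The truncation of \<open>q\<close>
  covers the parameters at which its leading coefficient vanishes.
\<close>

lemma sign_determined_insert:
  assumes R: "fun_ring R" and finJ: "finite J" and q: "poly_family R (Suc d) q"
    and J: "\<And>r. r \<in> J \<Longrightarrow> poly_family R (Suc d) r"
    and IH: "\<And>L. finite L \<Longrightarrow> (\<And>r. r \<in> L \<Longrightarrow> poly_family R d r) \<Longrightarrow> sign_determined R (L \<union> J)"
  shows "sign_determined R (insert q J)"
proof -
  define dq where "dq = (\<lambda>p. pderiv (q p))"
  define tq where "tq = (\<lambda>p. poly_cutoff (Suc d) (q p))"
  let ?J = "insert dq J"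
  have dq: "poly_family R d dq" unfolding dq_def by (rule poly_family_pderiv[OF R q])
  have tq: "poly_family R d tq" unfolding tq_def by (rule poly_family_cutoff[OF R q])
  have J': "poly_family R (Suc d) r" if "r \<in> ?J" for r
    using that J poly_family_mono[OF dq, of "Suc d"] by auto
  have "\<forall>r e. \<exists>s. r \<in> ?J \<longrightarrow> 0 < e \<longrightarrow> poly_family R (e - 1) s \<and>
    (\<forall>p x. degree (r p) = e \<longrightarrow> poly (r p) x = 0 \<longrightarrow> sgn (poly (s p) x) = sgn (poly (q p) x))"
    using pseudo_remainder[OF R J' _ q] by blast
  then obtain s where s: "\<And>r e. r \<in> ?J \<Longrightarrow> 0 < e \<Longrightarrow> poly_family R (e - 1) (s r e)"
    "\<And>r e p x. r \<in> ?J \<Longrightarrow> 0 < e \<Longrightarrow> degree (r p) = e \<Longrightarrow> poly (r p) x = 0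
        \<Longrightarrow> sgn (poly (s r e p) x) = sgn (poly (q p) x)"
    by metis
  \<comment> \<open>The degree of \<open>r p\<close> depends on \<open>p\<close>, so a remainder is
    included for every possible degree \<open>e\<close>. Its bound \<open>e - 1\<close> is at most
    \<open>d\<close>, which is what lets \<open>IH\<close> apply.\<close>
  define L where "L = {dq, tq} \<union> (\<Union>r\<in>?J. s r ` {1..Suc d})"
  have finL: "finite L" using finJ by (simp add: L_def)
  have Ld: "poly_family R d r" if rL: "r \<in> L" for r
  proof -
    consider "r = dq" | "r = tq" | r' e where "r' \<in> ?J" "e \<in> {1..Suc d}" "r = s r' e"
      using rL unfolding L_def by blast
    then show ?thesis
    proof cases
      case 1
      show ?thesis unfolding 1 by (rule dq)
    next
      case 2
      show ?thesis unfolding 2 by (rule tq)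
    next
      case 3
      show ?thesis unfolding 3(3)
        by (rule poly_family_mono[OF s(1)[OF 3(1)]]) (use 3(2) in auto)
    qed
  qed
  obtain F1 where F1: "finite F1" "F1 \<subseteq> R" "\<And>p p'. sgn_equiv F1 p p' \<Longrightarrow>
     \<exists>\<phi>. strict_mono \<phi> \<and> surj \<phi> \<and> (\<forall>r\<in>L \<union> J. \<forall>x. sgn (poly (r p) x) = sgn (poly (r p') (\<phi> x)))"
    using IH[OF finL Ld] unfolding sign_determined_def by blast
  \<comment> \<open>The added coefficient functions make the actual degrees and the sign of the
    leading coefficient of \<open>q\<close> agree at \<open>p\<close> and \<open>p'\<close>.\<close>
  define F where "F = F1 \<union> (\<Union>r\<in>insert q ?J. (\<lambda>i p. coeff (r p) i) ` {..Suc d})"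
  have finF: "finite F" using F1(1) finJ by (simp add: F_def)
  have FR: "F \<subseteq> R" using F1(2) q J' unfolding F_def poly_family_def by auto
  have "\<exists>\<phi>. strict_mono \<phi> \<and> surj \<phi> \<and> (\<forall>r\<in>insert q J. \<forall>x. sgn (poly (r p) x) = sgn (poly (r p') (\<phi> x)))"
    if eq: "sgn_equiv F p p'" for p p'
  proof -
    have "sgn_equiv F1 p p'" using eq by (auto simp: sgn_equiv_def F_def)
    from F1(3)[OF this] obtain \<phi> where \<phi>: "strict_mono \<phi>" "surj \<phi>"
      "\<And>r x. r \<in> L \<union> J \<Longrightarrow> sgn (poly (r p) x) = sgn (poly (r p') (\<phi> x))" by blast
    have cf: "sgn (coeff (r p) i) = sgn (coeff (r p') i)" if "r \<in> insert q ?J" "i \<le> Suc d" for r i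
    proof -
      have "(\<lambda>p. coeff (r p) i) \<in> F" unfolding F_def using that(2)
        by (intro UnI2 UN_I[OF that(1)] image_eqI[of _ _ i]) simp_all
      then show ?thesis using eq by (auto simp: sgn_equiv_def)
    qed
    have deg: "degree (r p) = degree (r p')" if "r \<in> insert q ?J" for r
    proof (rule degree_cong_sgn[of "Suc d"])
      show "degree (r p) \<le> Suc d" "degree (r p') \<le> Suc d" using that q J' by (auto simp: poly_family_def)
    qed (use cf that in auto)
    show ?thesis
    proof (cases "degree (q p) \<le> d")
      case True
      then have "tq p = q p" "tq p' = q p'" using deg[of q] by (auto simp: poly_cutoff_eq tq_def)
      moreover have "tq \<in> L \<union> J" by (auto simp: L_def)
      ultimately have "sgn (poly (q p) x) = sgn (poly (q p') (\<phi> x))" for x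
        using \<phi>(3)[of tq x] by simp
      then show ?thesis using \<phi> by auto
    next
      case False
      then have dg: "degree (q p) = Suc d" using q unfolding poly_family_def
        by (metis le_antisym not_less_eq_eq)
      obtain \<psi> where \<psi>: "strict_mono \<psi>" "surj \<psi>"
        "\<And>r x. r \<in> ?J \<Longrightarrow> sgn (poly (r p) x) = sgn (poly (r p') (\<psi> x))"
        "\<And>x. sgn (poly (q p) x) = sgn (poly (q p') (\<psi> x))"
      proof (rule extend_matching[where J="?J" and P="\<lambda>r. r p" and P'="\<lambda>r. r p'" and q="q p" and q'="q p'" and k="dq", OF _ \<phi>(1,2)])
        show "finite ?J" using finJ by simp
        show m: "sgn (poly (r p) x) = sgn (poly (r p') (\<phi> x))" if "r \<in> ?J" for r x
          using \<phi>(3)[of r x] that by (auto simp: L_def)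
        show "dq \<in> ?J" "dq p = pderiv (q p)" "dq p' = pderiv (q p')" by (simp_all add: dq_def)
        show "degree (q p') = degree (q p)" using deg[of q] by simp
        show "0 < degree (q p)" using dg by simp
        show "sgn (lead_coeff (q p)) = sgn (lead_coeff (q p'))"
          using cf[of q "Suc d"] deg[of q] dg by simp
        fix r x assume r: "r \<in> ?J" "r p \<noteq> 0" "poly (r p) x = 0"
        define e where "e = degree (r p)"
        have e0: "0 < e"
        proof (rule ccontr)
          assume "\<not> 0 < e"
          then obtain c where "r p = [:c:]" by (auto simp: e_def elim: degree_eq_zeroE)
          then show False using r by simp
        qed
        have e1: "e \<le> Suc d" using J'[OF r(1)] unfolding e_def poly_family_def by blast
        have "s r e \<in> L" unfolding L_def using e0 e1 by (intro UnI2 UN_I[OF r(1)] imageI) simp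
        then have "sgn (poly (s r e p) x) = sgn (poly (s r e p') (\<phi> x))" using \<phi>(3) by blast
        moreover have "poly (r p') (\<phi> x) = 0" using m[OF r(1), of x] r(3) by (simp add: sgn_0_0)
        ultimately show "sgn (poly (q p) x) = sgn (poly (q p') (\<phi> x))"
          using s(2)[OF r(1) e0, of p x] s(2)[OF r(1) e0, of p' "\<phi> x"] deg[of r] r by (simp add: e_def)
      qed (rule that)
      then show ?thesis by auto
    qed
  qed
  then show ?thesis unfolding sign_determined_def using finF FR by blast
qed

text \<open>A double induction: on the degree bound, and inside it on the number of families of top
  degree. \<open>sign_determined_insert\<close> trades one of these for finitely many families of
  smaller degree.\<close>

theorem poly_family_sign_determined:
  assumes R: "fun_ring R" and "finite Q" "\<And>q. q \<in> Q \<Longrightarrow> poly_family R d q"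
  shows "sign_determined R Q"
  using assms(2,3)
proof (induction d arbitrary: Q)
  case 0
  then show ?case by (rule sign_determined_constants)
next
  case (Suc d)
  have "sign_determined R (L \<union> T)"
    if "finite T" "\<And>q. q \<in> T \<Longrightarrow> poly_family R (Suc d) q"
       "finite L" "\<And>q. q \<in> L \<Longrightarrow> poly_family R d q" for T L
    using that
  proof (induction T arbitrary: L rule: finite_induct)
    case empty
    then show ?case using Suc.IH by simp
  next
    case (insert q T)
    have "sign_determined R (insert q (L \<union> T))"
    proof (rule sign_determined_insert[OF R])
      show "finite (L \<union> T)" using insert by simp
      show "poly_family R (Suc d) q" using insert by simp
      show "poly_family R (Suc d) r" if "r \<in> L \<union> T" for r
        using that insert.prems poly_family_mono[of R d r "Suc d"] by auto
      fix L' assume L': "finite L'" "\<And>r. r \<in> L' \<Longrightarrow> poly_family R d r"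
      have "sign_determined R ((L' \<union> L) \<union> T)"
        using insert.prems L' by (intro insert.IH) auto
      then show "sign_determined R (L' \<union> (L \<union> T))" by (simp add: Un_assoc)
    qed
    then show ?case by simp
  qed
  from this[of Q "{}"] Suc.prems show ?case by simp
qed

section \<open>Elimination of several variables\<close>

inductive_set polyfun :: "'v set \<Rightarrow> (('v \<Rightarrow> real) \<Rightarrow> real) set" for V where
  const: "(\<lambda>_. c) \<in> polyfun V"
| var: "v \<in> V \<Longrightarrow> (\<lambda>e. e v) \<in> polyfun V"
| add: "f \<in> polyfun V \<Longrightarrow> g \<in> polyfun V \<Longrightarrow> (\<lambda>e. f e + g e) \<in> polyfun V"
| mult: "f \<in> polyfun V \<Longrightarrow> g \<in> polyfun V \<Longrightarrow> (\<lambda>e. f e * g e) \<in> polyfun V"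

lemma fun_ring_polyfun: "fun_ring (polyfun V)"
  by (auto simp: fun_ring_def intro: polyfun.intros)

lemma polyfun_cong: "f \<in> polyfun V \<Longrightarrow> (\<And>v. v \<in> V \<Longrightarrow> e v = e' v) \<Longrightarrow> f e = f e'"
  by (induction rule: polyfun.induct) auto

lemma polyfun_insert_poly_family:
  assumes "v \<notin> V" "f \<in> polyfun (insert v V)"
  shows "\<exists>d q. poly_family (polyfun V) d q \<and> (\<forall>e x. f (e(v := x)) = poly (q e) x)"
  using assms(2)
proof (induction rule: polyfun.induct)
  case (const c)
  have "poly_family (polyfun V) 0 (\<lambda>_. [:c:])"
    by (auto simp: poly_family_def coeff_pCons intro: polyfun.intros split: nat.splits)
  then show ?case by (intro exI[of _ 0] exI[of _ "\<lambda>_. [:c:]"]) auto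
next
  case (var w)
  show ?case
  proof (cases "w = v")
    case True
    have "poly_family (polyfun V) 1 (\<lambda>_. [:0, 1:])"
      by (auto simp: poly_family_def intro: polyfun.intros)
    then show ?thesis using True by (intro exI[of _ 1] exI[of _ "\<lambda>_. [:0, 1:]"]) auto
  next
    case False
    have "(\<lambda>e. coeff [:e w:] i) \<in> polyfun V" for i
      using var False by (cases i) (auto intro: polyfun.intros)
    then have "poly_family (polyfun V) 0 (\<lambda>e. [:e w:])" by (simp add: poly_family_def)
    then show ?thesis using False by (intro exI[of _ 0] exI[of _ "\<lambda>e. [:e w:]"]) auto
  qed
next
  case (add f g)
  then obtain d q d' q' where q: "poly_family (polyfun V) d q" "\<And>e x. f (e(v := x)) = poly (q e) x"
    "poly_family (polyfun V) d' q'" "\<And>e x. g (e(v := x)) = poly (q' e) x" by blast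
  have "poly_family (polyfun V) (max d d') (\<lambda>e. q e + q' e)"
    using q by (auto simp: poly_family_def intro!: polyfun.add degree_add_le intro: max.coboundedI1 max.coboundedI2)
  then show ?case using q by (intro exI[of _ "max d d'"] exI[of _ "\<lambda>e. q e + q' e"]) (simp del: fun_upd_apply)
next
  case (mult f g)
  then obtain d q d' q' where q: "poly_family (polyfun V) d q" "\<And>e x. f (e(v := x)) = poly (q e) x"
    "poly_family (polyfun V) d' q'" "\<And>e x. g (e(v := x)) = poly (q' e) x" by blast
  have "degree (q e * q' e) \<le> d + d'" for e
    using q degree_mult_le[of "q e" "q' e"] unfolding poly_family_def by (meson add_mono order_trans)
  moreover have "(\<lambda>e. coeff (q e * q' e) i) \<in> polyfun V" for i
    unfolding coeff_mult using q
    by (intro fun_ring_sum[OF fun_ring_polyfun] polyfun.mult) (auto simp: poly_family_def)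
  ultimately have "poly_family (polyfun V) (d + d') (\<lambda>e. q e * q' e)" by (simp add: poly_family_def)
  then show ?case using q by (intro exI[of _ "d + d'"] exI[of _ "\<lambda>e. q e * q' e"]) (simp del: fun_upd_apply)
qed

text \<open>Read as polynomials in \<open>v\<close>, the members of \<open>Q\<close> are families
  over the remaining variables. The sign-preserving bijection supplies the witness
  \<open>\<phi> x\<close>, which is the semantic content of removing one existential
  quantifier.\<close>

lemma polyfun_eliminate_one:
  assumes "v \<notin> V" "finite Q" "Q \<subseteq> polyfun (insert v V)"
  obtains F where "finite F" "F \<subseteq> polyfun V"
    "\<And>e e' x. sgn_equiv F e e' \<Longrightarrow> \<exists>x'. sgn_equiv Q (e(v := x)) (e'(v := x'))"
proof -
  have "\<forall>f\<in>Q. \<exists>d q. poly_family (polyfun V) d q \<and> (\<forall>e x. f (e(v := x)) = poly (q e) x)"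
    using polyfun_insert_poly_family[OF assms(1)] assms(3) by blast
  then obtain d q where q: "\<And>f. f \<in> Q \<Longrightarrow> poly_family (polyfun V) (d f) (q f)"
    "\<And>f e x. f \<in> Q \<Longrightarrow> f (e(v := x)) = poly (q f e) x"
    by metis
  define D where "D = Max (insert 0 (d ` Q))"
  have D: "d f \<le> D" if "f \<in> Q" for f using that assms(2) by (simp add: D_def)
  have "sign_determined (polyfun V) (q ` Q)"
    using q(1) D assms(2) poly_family_mono
    by (intro poly_family_sign_determined[OF fun_ring_polyfun, where d=D]) blast+
  then obtain F where F: "finite F" "F \<subseteq> polyfun V" "\<And>p p'. sgn_equiv F p p' \<Longrightarrow>
     \<exists>\<phi>. strict_mono \<phi> \<and> surj \<phi> \<and> (\<forall>r\<in>q ` Q. \<forall>x. sgn (poly (r p) x) = sgn (poly (r p') (\<phi> x)))"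
    unfolding sign_determined_def by metis
  show ?thesis
  proof (rule that[OF F(1,2)])
    fix e e' :: "'a \<Rightarrow> real" and x assume "sgn_equiv F e e'"
    from F(3)[OF this] obtain \<phi> where "\<forall>r\<in>q ` Q. \<forall>x. sgn (poly (r e) x) = sgn (poly (r e') (\<phi> x))"
      by blast
    then have "sgn_equiv Q (e(v := x)) (e'(v := \<phi> x))"
      by (auto simp: sgn_equiv_def q(2))
    then show "\<exists>x'. sgn_equiv Q (e(v := x)) (e'(v := x'))" by blast
  qed
qed

theorem polyfun_eliminate:
  assumes "finite W" "W \<inter> V = {}" "finite Q" "Q \<subseteq> polyfun (W \<union> V)"
  shows "\<exists>F. finite F \<and> F \<subseteq> polyfun V \<and>
    (\<forall>e e'. sgn_equiv F e e' \<longrightarrow> (\<exists>e''. (\<forall>v. v \<notin> W \<longrightarrow> e'' v = e' v) \<and> sgn_equiv Q e e''))"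
  using assms
proof (induction W arbitrary: Q rule: finite_induct)
  case empty
  then show ?case by (intro exI[of _ Q]) auto
next
  case (insert w W)
  have "w \<notin> W \<union> V" using insert by auto
  from polyfun_eliminate_one[OF this insert.prems(2)] insert.prems(3)
  obtain F1 where F1: "finite F1" "F1 \<subseteq> polyfun (W \<union> V)"
    "\<And>e e' x. sgn_equiv F1 e e' \<Longrightarrow> \<exists>x'. sgn_equiv Q (e(w := x)) (e'(w := x'))"
    by auto
  have "W \<inter> V = {}" using insert by auto
  from insert.IH[OF this F1(1,2)] obtain F where F: "finite F" "F \<subseteq> polyfun V"
    "\<And>e e'. sgn_equiv F e e' \<Longrightarrow> \<exists>e''. (\<forall>v. v \<notin> W \<longrightarrow> e'' v = e' v) \<and> sgn_equiv F1 e e''"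
    by blast
  have "\<exists>e''. (\<forall>v. v \<notin> insert w W \<longrightarrow> e'' v = e' v) \<and> sgn_equiv Q e e''" if "sgn_equiv F e e'" for e e'
  proof -
    from F(3)[OF that] obtain e1 where e1: "\<forall>v. v \<notin> W \<longrightarrow> e1 v = e' v" "sgn_equiv F1 e e1" by blast
    obtain x' where "sgn_equiv Q (e(w := e w)) (e1(w := x'))" using F1(3)[OF e1(2)] by blast
    then show ?thesis using e1(1) by (intro exI[of _ "e1(w := x')"]) auto
  qed
  then show ?case using F by blast
qed

lemma poly_sgn_eventually_at_right:
  fixes q :: "real poly"
  obtains s where "eventually (\<lambda>t. sgn (poly q t) = s) (at_right 0)"
proof (cases "q = 0")
  case True
  then show ?thesis using that[of 0] by simp
next
  case False
  obtain \<delta> where \<delta>: "\<delta> > 0" "\<And>t. 0 < t \<Longrightarrow> t < \<delta> \<Longrightarrow> poly q t \<noteq> 0"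
  proof -
    let ?S = "insert 1 ({t. poly q t = 0} \<inter> {0<..})"
    have f: "finite ?S" using poly_roots_finite[OF False] by simp
    have "Min ?S \<in> ?S" using f by (intro Min_in) auto
    then have "Min ?S > 0" by auto
    moreover have "poly q t \<noteq> 0" if "0 < t" "t < Min ?S" for t
      using Min_le[OF f, of t] that by auto
    ultimately show ?thesis using that by blast
  qed
  have "sgn (poly q t) = sgn (poly q (\<delta> / 2))" if "0 < t" "t < \<delta>" for t
    using \<delta> that by (intro sgn_poly_eq_no_root) (auto simp: min_def max_def split: if_splits)
  then have "eventually (\<lambda>t. sgn (poly q t) = sgn (poly q (\<delta> / 2))) (at_right 0)"
    unfolding eventually_at_right_field using \<delta>(1) by blast
  then show ?thesis by (rule that)
qed

text \<open>The hypothesis on \<open>P\<close> covers every Boolean combination of sign conditions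
  on \<open>Q\<close>. Eliminating all variables except \<open>v\<close> leaves univariate signs,
  which freeze near 0.\<close>

theorem polyfun_exists_eventually_const:
  fixes v :: "'v::finite"
  assumes "finite Q" "Q \<subseteq> polyfun UNIV"
    and P: "\<And>e e'. sgn_equiv Q e e' \<Longrightarrow> P e \<Longrightarrow> P e'"
  shows "eventually (\<lambda>t. \<exists>e. e v = t \<and> P e) (at_right 0) \<or>
         eventually (\<lambda>t. \<not> (\<exists>e. e v = t \<and> P e)) (at_right 0)"
proof -
  have "Q \<subseteq> polyfun (- {v} \<union> {v})" using assms(2) by (simp only: Compl_partition2)
  from polyfun_eliminate[OF _ _ assms(1) this]
  obtain F where F: "finite F" "F \<subseteq> polyfun {v}"
    "\<And>e e'. sgn_equiv F e e' \<Longrightarrow> \<exists>e''. (\<forall>w. w \<notin> - {v} \<longrightarrow> e'' w = e' w) \<and> sgn_equiv Q e e''"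
    by auto
  have "\<exists>s. eventually (\<lambda>t. sgn (f (\<lambda>_. t)) = s) (at_right 0)" if f: "f \<in> F" for f
  proof -
    obtain d q where q: "poly_family (polyfun {}) d q" "\<And>e x. f (e(v := x)) = poly (q e) x"
      using polyfun_insert_poly_family[of v "{}" f] f F(2) by auto
    have "f (\<lambda>_. t) = poly (q (\<lambda>_. 0)) t" for t
      using q(2)[of "\<lambda>_. 0" t] polyfun_cong[of f "{v}" "\<lambda>_. t" "(\<lambda>_. 0)(v := t)"] f F(2) by auto
    then show ?thesis by (simp only:) (rule poly_sgn_eventually_at_right[of "q (\<lambda>_. 0)"], rule exI)
  qed
  then have "\<forall>f\<in>F. \<exists>s. eventually (\<lambda>t. sgn (f (\<lambda>_. t)) = s) (at_right 0)" by blast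
  from bchoice[OF this] obtain s where "\<And>f. f \<in> F \<Longrightarrow> eventually (\<lambda>t. sgn (f (\<lambda>_. t)) = s f) (at_right 0)"
    by blast
  then have ev: "eventually (\<lambda>t. \<forall>f\<in>F. sgn (f (\<lambda>_. t)) = s f) (at_right 0)"
    using F(1) by (simp add: eventually_ball_finite)
  \<comment> \<open>All \<open>t\<close> in \<open>E\<close> show the same frozen sign pattern, so a
    witness at one of them yields a witness at any other.\<close>
  define E where "E = {t. \<forall>f\<in>F. sgn (f (\<lambda>_. t)) = s f}"
  have key: "\<exists>e. e v = t' \<and> P e" if "t \<in> E" "t' \<in> E" "e v = t" "P e" for t t' e
  proof -
    have f: "f e = f (\<lambda>_. t)" if "f \<in> F" for f
      using polyfun_cong[of f "{v}" e "\<lambda>_. t"] that F(2) \<open>e v = t\<close> by auto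
    have "sgn_equiv F e (\<lambda>_. t')"
      unfolding sgn_equiv_def
    proof
      fix f assume "f \<in> F"
      then show "sgn (f e) = sgn (f (\<lambda>_. t'))"
        using \<open>t \<in> E\<close> \<open>t' \<in> E\<close> f[of f] by (simp add: E_def)
    qed
    from F(3)[OF this] obtain e'' where "e'' v = t'" "sgn_equiv Q e e''" by auto
    then show ?thesis using P \<open>P e\<close> by blast
  qed
  have evE: "eventually (\<lambda>t. t \<in> E) (at_right 0)" using ev by (simp add: E_def)
  show ?thesis
  proof (cases "\<exists>t\<in>E. \<exists>e. e v = t \<and> P e")
    case True
    then show ?thesis using key by (intro disjI1 eventually_mono[OF evE]) blast
  next
    case False
    then show ?thesis by (intro disjI2 eventually_mono[OF evE]) blast
  qed
qed

section \<open>Positive semidefinite matrices and conic duality\<close>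

lemma frob_inner: "frob A B = A \<bullet> B"
  by (simp add: frob_def inner_vec_def)

definition outer :: "real^'n \<Rightarrow> real^'n^'n" where
  "outer v = (\<chi> i j. v $ i * v $ j)"

lemma inner_outer: "M \<bullet> outer v = v \<bullet> (M *v v)"
  by (simp add: outer_def inner_vec_def matrix_vector_mult_def sum_distrib_left mult_ac)

lemma outer_mult: "outer v *v x = (v \<bullet> x) *\<^sub>R v"
  by (simp add: outer_def matrix_vector_mult_def vec_eq_iff inner_vec_def sum_distrib_left mult_ac)

lemma sym_mat_iff: "sym_mat M \<longleftrightarrow> (\<forall>i j. M $ i $ j = M $ j $ i)"
  by (auto simp: sym_mat_def transpose_def vec_eq_iff)

lemma sym_mat_inner_commute: "sym_mat M \<Longrightarrow> x \<bullet> (M *v y) = y \<bullet> (M *v x)"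
  by (metis dot_lmul_matrix inner_commute sym_mat_def transpose_matrix_vector)

lemma quad_scaleR: "x \<bullet> ((c *\<^sub>R M) *v x) = c * (x \<bullet> (M *v x))" for M :: "real^'n^'n"
  by (simp add: scaleR_matrix_vector_assoc[symmetric])

lemma quad_add: "x \<bullet> ((M + N) *v x) = x \<bullet> (M *v x) + x \<bullet> (N *v x)" for M :: "real^'n^'n"
  by (simp add: matrix_vector_mult_add_rdistrib inner_add_right)

lemma quad_diff: "x \<bullet> ((M - N) *v x) = x \<bullet> (M *v x) - x \<bullet> (N *v x)" for M :: "real^'n^'n"
  by (simp add: matrix_vector_mult_diff_rdistrib inner_diff_right)

lemma sym_mat_add: "sym_mat M \<Longrightarrow> sym_mat N \<Longrightarrow> sym_mat (M + N)"
  and sym_mat_diff: "sym_mat M \<Longrightarrow> sym_mat N \<Longrightarrow> sym_mat (M - N)"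
  and sym_mat_scaleR: "sym_mat M \<Longrightarrow> sym_mat (c *\<^sub>R M)"
  and sym_mat_one: "sym_mat (mat 1)"
  and sym_mat_outer: "sym_mat (outer v)"
  by (simp_all add: sym_mat_iff mat_def outer_def mult.commute)

lemma sym_mat_opsum: "(\<And>i. sym_mat (A i)) \<Longrightarrow> sym_mat (opsum A y)"
  by (simp add: sym_mat_iff opsum_def)

lemma psd_sym: "psd M \<Longrightarrow> sym_mat M"
  by (simp add: psd_def)

lemma psd_add: "psd M \<Longrightarrow> psd N \<Longrightarrow> psd (M + N)"
  by (simp add: psd_def sym_mat_add quad_add)

lemma psd_scaleR: "0 \<le> c \<Longrightarrow> psd M \<Longrightarrow> psd (c *\<^sub>R M)"
  by (simp add: psd_def sym_mat_scaleR quad_scaleR)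

lemma psd_zero: "psd 0"
  by (simp add: psd_def sym_mat_iff)

lemma psd_one: "psd (mat 1)"
  by (simp add: psd_def sym_mat_one)

lemma psd_outer: "psd (outer v)"
  by (simp add: psd_def sym_mat_outer outer_mult inner_commute)

lemma psd_sum: "(\<And>i. i \<in> I \<Longrightarrow> psd (f i)) \<Longrightarrow> psd (sum f I)"
  by (induction I rule: infinite_finite_induct) (auto intro: psd_zero psd_add)

lemma psd_Cauchy_Schwarz:
  assumes "psd M"
  shows "(x \<bullet> (M *v y))\<^sup>2 \<le> (x \<bullet> (M *v x)) * (y \<bullet> (M *v y))"
proof -
  let ?a = "x \<bullet> (M *v x)" and ?b = "x \<bullet> (M *v y)" and ?c = "y \<bullet> (M *v y)"
  have expand: "0 \<le> ?a + 2 * s * ?b + s\<^sup>2 * ?c" for s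
  proof -
    have "0 \<le> (x + s *\<^sub>R y) \<bullet> (M *v (x + s *\<^sub>R y))" using assms by (simp add: psd_def)
    also have "\<dots> = ?a + s * ?b + s * (y \<bullet> (M *v x)) + s\<^sup>2 * ?c"
      by (simp add: matrix_vector_right_distrib matrix_vector_mult_scaleR inner_add_left inner_add_right power2_eq_square algebra_simps)
    finally show ?thesis using sym_mat_inner_commute[OF psd_sym[OF assms], of y x] by simp
  qed
  have c: "?c \<ge> 0" and a: "?a \<ge> 0" using assms by (auto simp: psd_def)
  show ?thesis
  proof (cases "?c = 0")
    case True
    have "?b = 0"
    proof (rule ccontr)
      assume "?b \<noteq> 0"
      \<comment> \<open>The form is affine in \<open>s\<close> here, and this value of
        \<open>s\<close> makes it equal to -1.\<close>
      then show False using expand[of "- (?a + 1) / (2 * ?b)"] True by (simp add: field_simps)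
    qed
    then show ?thesis using True by simp
  next
    case False
    then have cpos: "?c > 0" using c by simp
    \<comment> \<open>The chosen \<open>s\<close> is the minimizer of the quadratic.\<close>
    have "0 \<le> ?a + 2 * (- ?b / ?c) * ?b + (- ?b / ?c)\<^sup>2 * ?c" by (rule expand)
    also have "\<dots> = ?a - ?b\<^sup>2 / ?c" using False by (simp add: power2_eq_square field_simps)
    finally have "?b\<^sup>2 / ?c \<le> ?a" by simp
    then show ?thesis using cpos by (simp add: field_simps)
  qed
qed

lemma matrix_axis: "(M *v axis j 1) $ i = M $ i $ j" for M :: "real^'n^'n"
  by (simp add: matrix_vector_mult_basis column_def)

lemma axis_inner: "axis i (1::real) \<bullet> x = x $ i"
  by (simp add: inner_axis')

text \<open>One step of the Cholesky decomposition per index.\<close>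

lemma psd_gram_on:
  fixes F :: "real^'n^'n"
  assumes "finite J" "psd F" "\<And>a b. a \<notin> J \<Longrightarrow> F $ a $ b = 0"
  shows "\<exists>w. F = (\<Sum>k\<in>J. outer (w k))"
  using assms
proof (induction J arbitrary: F rule: finite_induct)
  case empty
  then show ?case by (simp add: vec_eq_iff)
next
  case (insert j J)
  have symF: "F $ a $ b = F $ b $ a" for a b using psd_sym[OF insert.prems(1)] by (simp add: sym_mat_iff)
  let ?e = "axis j 1 :: real^'n"
  have CS: "(x \<bullet> (F *v ?e))\<^sup>2 \<le> (x \<bullet> (F *v x)) * F $ j $ j" for x
    using psd_Cauchy_Schwarz[OF insert.prems(1), of x ?e] by (simp add: axis_inner matrix_axis)
  have Fjj: "F $ j $ j \<ge> 0"
    using insert.prems(1) unfolding psd_def by (metis axis_inner matrix_axis)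
  have ext: "(\<Sum>k\<in>insert j J. outer ((w(j := u)) k)) = outer u + (\<Sum>k\<in>J. outer (w k))"
    for w :: "'n \<Rightarrow> real^'n" and u
    using insert.hyps by (simp) (intro sum.cong, auto)
  show ?case
  proof (cases "F $ j $ j = 0")
    case True
    \<comment> \<open>By Cauchy-Schwarz a zero pivot has a zero column, so index \<open>j\<close>
      contributes the zero vector.\<close>
    have "F $ a $ j = 0" for a
      using CS[of "axis a 1"] True by (simp add: axis_inner matrix_axis)
    then have "F $ a $ b = 0" if "a \<notin> J" for a b
      using that insert.prems(2)[of a b] symF by (cases "a = j") auto
    from insert.IH[OF insert.prems(1) this] obtain w where "F = (\<Sum>k\<in>J. outer (w k))" by blast
    moreover have "outer (0::real^'n) = 0" by (simp add: outer_def vec_eq_iff)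
    ultimately show ?thesis using ext[of w 0] by (intro exI[of _ "w(j := 0)"]) simp
  next
    case False
    then have pos: "F $ j $ j > 0" using Fjj by simp
    \<comment> \<open>The pivot column, scaled so that \<open>outer u\<close> reproduces row and
      column \<open>j\<close> of \<open>F\<close>. That the Schur complement remains positive
      semidefinite is precisely \<open>CS\<close>.\<close>
    define u where "u = (1 / sqrt (F $ j $ j)) *\<^sub>R (F *v ?e)"
    have ou: "outer u $ a $ b = F $ a $ j * F $ b $ j / F $ j $ j" for a b
      using pos by (simp add: outer_def u_def matrix_axis)
    have "psd (F - outer u)"
      unfolding psd_def
    proof (intro conjI allI)
      show "sym_mat (F - outer u)" by (intro sym_mat_diff sym_mat_outer psd_sym insert.prems)
      fix x
      have "x \<bullet> (outer u *v x) = (x \<bullet> (F *v ?e))\<^sup>2 / F $ j $ j"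
        using pos by (simp add: outer_mult u_def inner_commute power2_eq_square)
      also have "\<dots> \<le> x \<bullet> (F *v x)" using CS[of x] pos by (simp add: divide_le_eq)
      finally show "0 \<le> x \<bullet> ((F - outer u) *v x)" by (simp add: quad_diff)
    qed
    moreover have "(F - outer u) $ a $ b = 0" if "a \<notin> J" for a b
    proof (cases "a = j")
      case True
      then show ?thesis using ou[of a b] pos symF[of j b] by simp
    next
      case False
      then have "F $ a $ c = 0" for c using insert.prems(2)[of a c] that by simp
      then show ?thesis using ou[of a b] by simp
    qed
    ultimately obtain w where "F - outer u = (\<Sum>k\<in>J. outer (w k))" using insert.IH by blast
    then show ?thesis using ext[of w u] by (intro exI[of _ "w(j := u)"]) (simp add: algebra_simps)
  qed
qed

lemma psd_iff_gram: "psd F \<longleftrightarrow> (\<exists>w :: 'n \<Rightarrow> real^'n. F = (\<Sum>k\<in>UNIV. outer (w k)))" for F :: "real^'n^'n"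
proof
  show "\<exists>w :: 'n \<Rightarrow> real^'n. F = (\<Sum>k\<in>UNIV. outer (w k))" if "psd F" using psd_gram_on[of UNIV F] that by simp
qed (auto intro: psd_sum psd_outer)

lemma psd_inner_nonneg:
  assumes "psd W" "psd G"
  shows "0 \<le> W \<bullet> G"
proof -
  obtain w :: "'a \<Rightarrow> real^'a" where "G = (\<Sum>k\<in>UNIV. outer (w k))" using assms(2) psd_iff_gram by blast
  then have "W \<bullet> G = (\<Sum>k\<in>UNIV. w k \<bullet> (W *v w k))" by (simp add: inner_sum_right inner_outer)
  then show ?thesis using assms(1) by (simp add: psd_def sum_nonneg)
qed

lemma psd_of_inner_nonneg:
  assumes "sym_mat W" "\<And>G. psd G \<Longrightarrow> 0 \<le> W \<bullet> G"
  shows "psd W"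
  using assms psd_outer by (auto simp: psd_def simp flip: inner_outer)

lemma abs_quad_le: "\<bar>x \<bullet> (H *v x)\<bar> \<le> norm H * (x \<bullet> x)" for H :: "real^'n^'n"
proof -
  have "\<bar>H \<bullet> outer x\<bar> \<le> norm H * norm (outer x)" by (rule Cauchy_Schwarz_ineq2)
  moreover have "norm (outer x) = x \<bullet> x"
  proof -
    have "outer x \<bullet> outer x = (x \<bullet> x)\<^sup>2" by (simp add: inner_outer outer_mult power2_eq_square)
    then show ?thesis by (simp add: norm_eq_sqrt_inner)
  qed
  ultimately show ?thesis by (simp add: inner_outer)
qed

lemma inner_opsum: "opsum A y \<bullet> X = (\<Sum>i\<in>UNIV. y $ i * (A i \<bullet> X))"
  by (simp add: opsum_def inner_sum_left)

lemma inner_opsum_feasible: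
  assumes "\<And>i. A i \<bullet> X = b $ i"
  shows "opsum A y \<bullet> X = b \<bullet> y"
  using assms by (simp add: inner_opsum inner_vec_def[of b] mult.commute)

lemma opsum_add: "opsum A (y + z) = opsum A y + opsum A z"
  and opsum_scaleR: "opsum A (c *\<^sub>R y) = c *\<^sub>R opsum A y"
  and opsum_diff: "opsum A (y - z) = opsum A y - opsum A z"
  by (simp_all add: opsum_def scaleR_left_distrib scaleR_left_diff_distrib sum.distrib sum_subtractf scaleR_right.sum)

section \<open>Weak and strong duality\<close>

lemma primal_feasible_iff: "primal_feasible A b X \<longleftrightarrow> psd X \<and> (\<forall>i. A i \<bullet> X = b $ i)"
  by (simp add: primal_feasible_def frob_inner)

lemma weak_duality:
  assumes "primal_feasible A b X" "dual_feasible C A y"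
  shows "b \<bullet> y \<le> C \<bullet> X"
proof -
  have "0 \<le> (C - opsum A y) \<bullet> X"
    using assms by (intro psd_inner_nonneg) (auto simp: primal_feasible_iff dual_feasible_def)
  also have "\<dots> = C \<bullet> X - b \<bullet> y"
    using assms(1) by (simp add: inner_diff_left inner_opsum_feasible primal_feasible_iff)
  finally show ?thesis by simp
qed

lemma vP_bdd: "dual_feasible C A y \<Longrightarrow> bdd_below {frob C X | X. primal_feasible A b X}"
  by (rule bdd_belowI[of _ "b \<bullet> y"]) (auto simp: frob_inner intro: weak_duality)

lemma vP_le: "dual_feasible C A y \<Longrightarrow> primal_feasible A b X \<Longrightarrow> vP C A b \<le> C \<bullet> X"
  unfolding vP_def by (rule cInf_lower[OF _ vP_bdd]) (auto simp: frob_inner)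

lemma vP_ge:
  "primal_feasible A b X0 \<Longrightarrow> (\<And>X. primal_feasible A b X \<Longrightarrow> c \<le> C \<bullet> X) \<Longrightarrow> c \<le> vP C A b"
  unfolding vP_def by (rule cInf_greatest) (auto simp: frob_inner)

lemma vP_less_iff:
  "dual_feasible C A y \<Longrightarrow> primal_feasible A b X0 \<Longrightarrow>
    vP C A b < c \<longleftrightarrow> (\<exists>X. primal_feasible A b X \<and> C \<bullet> X < c)"
  unfolding vP_def by (subst cInf_less_iff[OF _ vP_bdd]) (auto simp: frob_inner)

lemma vD_ge: "primal_feasible A b X \<Longrightarrow> dual_feasible C A y \<Longrightarrow> b \<bullet> y \<le> vD C A b"
  unfolding vD_def by (rule cSup_upper) (auto intro!: bdd_aboveI[of _ "C \<bullet> X"] weak_duality)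

lemma vD_le: "dual_feasible C A y0 \<Longrightarrow> (\<And>y. dual_feasible C A y \<Longrightarrow> b \<bullet> y \<le> c) \<Longrightarrow> vD C A b \<le> c"
  unfolding vD_def by (rule cSup_least) auto

text \<open>The point \<open>(0, p)\<close> lies in the closure of the convex set \<open>S\<close>
  of attainable constraint residuals and upper objective bounds, but not in its relative interior. A
  supporting hyperplane there gives the multiplier; the strictly feasible point
  \<open>X0 + \<eta> *\<^sub>R mat 1\<close> prevents it from being vertical, so the dual optimum is
  attained.\<close>

lemma strong_duality_Slater:
  fixes C :: "real^'n^'n" and A :: "'m::finite \<Rightarrow> real^'n^'n"
  assumes symC: "sym_mat C" and symA: "\<And>i. sym_mat (A i)"
    and X0: "psd X0" and \<eta>: "\<eta> > 0" and feas: "primal_feasible A b (X0 + \<eta> *\<^sub>R mat 1)"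
    and y0: "dual_feasible C A y0"
  obtains y where "dual_feasible C A y" "vP C A b \<le> b \<bullet> y"
proof -
  define p where "p = vP C A b"
  define Xs where "Xs = X0 + \<eta> *\<^sub>R mat 1"
  define \<A> where "\<A> X = (\<chi> i. A i \<bullet> X)" for X
  have \<A>_add: "\<A> (X + Y) = \<A> X + \<A> Y" and \<A>_scale: "\<A> (c *\<^sub>R X) = c *\<^sub>R \<A> X" for X Y c
    by (simp_all add: \<A>_def vec_eq_iff inner_add_right)
  have \<A>_Xs: "\<A> Xs = b" using feas by (simp add: \<A>_def Xs_def primal_feasible_iff vec_eq_iff)
  have dualA: "u \<bullet> \<A> X = opsum A u \<bullet> X" for u X
    by (simp add: inner_opsum \<A>_def inner_vec_def[of u])
  have psdXs: "psd Xs" using feas by (simp add: Xs_def primal_feasible_iff)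
  define S where "S = {(\<A> X - b, C \<bullet> X + s) | X s. psd X \<and> 0 \<le> s}"
  have "convex S"
    unfolding convex_alt
  proof (intro ballI allI impI)
    fix x y and u :: real assume "x \<in> S" "y \<in> S" and u: "0 \<le> u \<and> u \<le> 1"
    then obtain X s Y t where *: "x = (\<A> X - b, C \<bullet> X + s)" "psd X" "0 \<le> s"
      "y = (\<A> Y - b, C \<bullet> Y + t)" "psd Y" "0 \<le> t" unfolding S_def by auto
    have "(1 - u) *\<^sub>R x + u *\<^sub>R y =
      (\<A> ((1 - u) *\<^sub>R X + u *\<^sub>R Y) - b, C \<bullet> ((1 - u) *\<^sub>R X + u *\<^sub>R Y) + ((1 - u) * s + u * t))"
      unfolding * \<A>_add \<A>_scale by (simp add: inner_add_right algebra_simps)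
    moreover have "psd ((1 - u) *\<^sub>R X + u *\<^sub>R Y)" using * u by (intro psd_add psd_scaleR) auto
    moreover have "0 \<le> (1 - u) * s + u * t" using * u by auto
    ultimately show "(1 - u) *\<^sub>R x + u *\<^sub>R y \<in> S" unfolding S_def by blast
  qed
  have S_bound: "p \<le> r" if zr: "(0, r) \<in> S" for r
  proof -
    obtain X s where X: "\<A> X = b" "r = C \<bullet> X + s" "psd X" "0 \<le> s" using zr unfolding S_def by auto
    then have "primal_feasible A b X" by (auto simp: primal_feasible_iff \<A>_def)
    then show ?thesis using vP_le[OF y0] X unfolding p_def by force
  qed
  have clos: "(0, p) \<in> closure S"
    unfolding closure_approachable
  proof (intro allI impI)
    fix e :: real assume "e > 0"
    then have "vP C A b < p + e" by (simp add: p_def)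
    then obtain X where X: "primal_feasible A b X" "C \<bullet> X < p + e"
      unfolding vP_less_iff[OF y0 feas] by blast
    then have "\<A> X = b" by (simp add: primal_feasible_iff \<A>_def vec_eq_iff)
    then have "(0, C \<bullet> X) = (\<A> X - b, C \<bullet> X + 0) \<and> psd X" using X(1) by (simp add: primal_feasible_iff)
    then have "(0, C \<bullet> X) \<in> S" unfolding S_def by blast
    moreover have "dist (0 :: real^'m, C \<bullet> X) (0, p) < e"
      using X vP_le[OF y0 X(1)] by (simp add: dist_prod_def dist_real_def p_def)
    ultimately show "\<exists>y\<in>S. dist y (0, p) < e" by blast
  qed
  have XsS: "(0, C \<bullet> Xs + 1) \<in> S"
  proof -
    have "(0, C \<bullet> Xs + 1) = (\<A> Xs - b, C \<bullet> Xs + 1)" using \<A>_Xs by simp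
    then show ?thesis unfolding S_def using psdXs zero_le_one by blast
  qed
  \<comment> \<open>From the relative interior one could move a little past \<open>(0, p)\<close>,
    away from the higher point \<open>(0, C \<bullet> Xs + 1)\<close>, and reach a value below
    \<open>p\<close>.\<close>
  have notri: "(0, p) \<notin> rel_interior S"
  proof
    assume "(0, p) \<in> rel_interior S"
    then obtain e where e: "e > 1" "(1 - e) *\<^sub>R (0, C \<bullet> Xs + 1) + e *\<^sub>R (0, p) \<in> S"
      using convex_rel_interior_iff[OF \<open>convex S\<close>, of "(0, p)"] XsS by blast
    then have "(0, (1 - e) * (C \<bullet> Xs + 1) + e * p) \<in> S" by simp
    then have "p \<le> (1 - e) * (C \<bullet> Xs + 1) + e * p" by (rule S_bound)
    then have "(e - 1) * (C \<bullet> Xs + 1 - p) \<le> 0" by (simp add: algebra_simps)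
    moreover have "C \<bullet> Xs + 1 - p > 0" using vP_le[OF y0 feas] by (simp add: p_def Xs_def)
    ultimately show False using e(1) by (simp add: mult_le_0_iff)
  qed
  obtain a where a: "\<And>y. y \<in> closure S \<Longrightarrow> a \<bullet> (0, p) \<le> a \<bullet> y"
    "\<And>y. y \<in> rel_interior S \<Longrightarrow> a \<bullet> (0, p) < a \<bullet> y"
    using supporting_hyperplane_relative_frontier[OF \<open>convex S\<close> clos notri] by metis
  obtain u l where ul: "a = (u, l)" by (cases a)
  have sep: "l * p \<le> u \<bullet> (\<A> X - b) + l * (C \<bullet> X + s)" if "psd X" "0 \<le> s" for X s
  proof -
    have "(\<A> X - b, C \<bullet> X + s) \<in> S" unfolding S_def using that by blast
    then show ?thesis using a(1)[of "(\<A> X - b, C \<bullet> X + s)"] closure_subset[of S] by (auto simp: ul)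
  qed
  have l0: "l \<ge> 0"
  proof (rule ccontr)
    assume neg: "\<not> l \<ge> 0"
    define s where "s = max 0 (p - C \<bullet> Xs + 1)"
    have "l * p \<le> l * (C \<bullet> Xs + s)" using sep[OF psdXs, of s] by (simp add: \<A>_Xs s_def)
    then have "C \<bullet> Xs + s \<le> p" using neg by (simp add: mult_le_cancel_left)
    then show False unfolding s_def by simp
  qed
  \<comment> \<open>For a vertical hyperplane, \<open>u\<close> is nonnegative on all residuals. As
    \<open>Xs\<close> can also be left in the direction opposite to any \<open>X\<close>,
    \<open>u\<close> vanishes on all of them, against the strict inequality on the relative
    interior.\<close>
  have "l \<noteq> 0"
  proof
    assume l: "l = 0"
    have nonneg: "0 \<le> u \<bullet> (\<A> X - b)" if "psd X" for X using sep[OF that, of 0] l by simp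
    have zero: "u \<bullet> (\<A> X - b) = 0" if X: "psd X" for X
    proof -
      define H where "H = X - Xs"
      \<comment> \<open>Since \<open>Xs\<close> dominates \<open>\<eta>\<close> times the identity,
        this step length keeps \<open>Xs - e *\<^sub>R H\<close> in the cone; the added 1 covers
        \<open>H = 0\<close>.\<close>
      define e where "e = \<eta> / (norm H + 1)"
      have e: "e > 0" "e * norm H \<le> \<eta>" using \<eta> by (auto simp: e_def field_simps add_pos_nonneg)
      have "psd (Xs - e *\<^sub>R H)"
        unfolding psd_def
      proof (intro conjI allI)
        show "sym_mat (Xs - e *\<^sub>R H)" unfolding H_def
          using psdXs X by (intro sym_mat_diff sym_mat_scaleR psd_sym)
        fix x :: "real^'n"
        have "e * (x \<bullet> (H *v x)) \<le> e * (norm H * (x \<bullet> x))" using abs_quad_le[of x H] e(1) by (intro mult_left_mono) auto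
        also have "\<dots> \<le> \<eta> * (x \<bullet> x)" using e(2) mult_right_mono[OF e(2), of "x \<bullet> x"] by (simp add: mult_ac)
        also have "\<dots> \<le> x \<bullet> (Xs *v x)" using X0 by (simp add: Xs_def quad_add quad_scaleR psd_def)
        finally show "0 \<le> x \<bullet> ((Xs - e *\<^sub>R H) *v x)" by (simp add: quad_diff quad_scaleR)
      qed
      from nonneg[OF this] have "0 \<le> u \<bullet> (\<A> Xs - e *\<^sub>R \<A> H - b)"
        using \<A>_add[of Xs "- e *\<^sub>R H"] \<A>_scale[of "- e" H] by simp
      then have "e * (u \<bullet> \<A> H) \<le> 0" using \<A>_Xs by simp
      then have "u \<bullet> \<A> H \<le> 0" using e(1) by (simp add: mult_le_0_iff)
      moreover have "\<A> H = \<A> X - b" using \<A>_add[of H Xs] \<A>_Xs by (simp add: H_def)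
      ultimately show ?thesis using nonneg[OF X] by simp
    qed
    have "rel_interior S \<noteq> {}" using XsS \<open>convex S\<close> rel_interior_eq_empty by blast
    then obtain y where y: "y \<in> rel_interior S" by blast
    then have "y \<in> S" using rel_interior_subset by blast
    then have "a \<bullet> y = 0" unfolding S_def ul using zero l by auto
    then show False using a(2)[OF y] l by (simp add: ul)
  qed
  then have lpos: "l > 0" using l0 by simp
  define y where "y = (- 1 / l) *\<^sub>R u"
  have key: "p - b \<bullet> y \<le> (C - opsum A y) \<bullet> X" if "psd X" for X
  proof -
    have "l * p \<le> u \<bullet> \<A> X - u \<bullet> b + l * (C \<bullet> X)" using sep[OF that, of 0] by (simp add: inner_diff_right)
    then have "p \<le> (u \<bullet> \<A> X - u \<bullet> b) / l + C \<bullet> X" using lpos by (simp add: field_simps)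
    moreover have "opsum A y \<bullet> X = - (u \<bullet> \<A> X) / l" unfolding y_def opsum_scaleR dualA by simp
    moreover have "b \<bullet> y = - (u \<bullet> b) / l" by (simp add: y_def inner_commute)
    ultimately show ?thesis by (simp add: inner_diff_left diff_divide_distrib)
  qed
  show ?thesis
  proof (rule that)
    show "vP C A b \<le> b \<bullet> y" using key[OF psd_zero] by (simp add: p_def)
    show "dual_feasible C A y" unfolding dual_feasible_def
    proof (rule psd_of_inner_nonneg)
      show "sym_mat (C - opsum A y)" using symC symA by (intro sym_mat_diff sym_mat_opsum)
      fix G :: "real^'n^'n" assume G: "psd G"
      let ?q = "(C - opsum A y) \<bullet> G"
      show "0 \<le> ?q"
      proof (rule ccontr)
        assume neg: "\<not> 0 \<le> ?q"
        \<comment> \<open>A negative value on \<open>G\<close> could be scaled along the ray through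
          \<open>G\<close> until it falls below the constant lower bound in
          \<open>key\<close>.\<close>
        define k where "k = (\<bar>p - b \<bullet> y\<bar> + 1) / (- ?q)"
        have k: "k \<ge> 0" "k * ?q = - (\<bar>p - b \<bullet> y\<bar> + 1)" using neg by (auto simp: k_def divide_nonneg_neg field_simps)
        have "p - b \<bullet> y \<le> k * ?q" using key[OF psd_scaleR[OF k(1) G]] by simp
        then show False using k(2) by linarith
      qed
    qed
  qed
qed

section \<open>Facial correction\<close>

lemma trace_inner: "mat 1 \<bullet> M = (\<Sum>j\<in>UNIV. M $ j $ j)" for M :: "real^'n^'n"
  by (simp add: inner_vec_def mat_def if_distrib[of "\<lambda>x. x * _"] cong: if_cong)

lemma trace_psd_nonneg: "psd M \<Longrightarrow> 0 \<le> mat 1 \<bullet> M"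
  by (rule psd_inner_nonneg[OF psd_one])

text \<open>Cauchy-Schwarz for \<open>W\<close> bounds each entry of the product by a diagonal entry
  of \<open>W\<close> times the form of \<open>W\<close> at a column of \<open>F\<close>. Those
  forms sum to the inner product of \<open>W\<close> with the square of \<open>F\<close>, and that
  square is at most the trace of \<open>F\<close> times \<open>F\<close>.\<close>

lemma norm_psd_mult_psd:
  fixes W F :: "real^'n^'n"
  assumes W: "psd W" and F: "psd F"
  shows "(norm (W ** F))\<^sup>2 \<le> (mat 1 \<bullet> W) * (mat 1 \<bullet> F) * (W \<bullet> F)"
proof -
  let ?f = "\<lambda>j. F *v axis j 1 :: real^'n"
  have entry: "(W ** F) $ i $ j = axis i 1 \<bullet> (W *v ?f j)" for i j
    by (simp add: axis_inner matrix_vector_mul_assoc matrix_axis)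
  have diag: "axis i 1 \<bullet> (M *v axis i 1) = M $ i $ i" for i and M :: "real^'n^'n"
    by (simp add: axis_inner matrix_axis)
  have nn: "0 \<le> W $ i $ i" for i using W diag[of i W] unfolding psd_def by metis
  have "(norm (W ** F))\<^sup>2 = (\<Sum>i\<in>UNIV. \<Sum>j\<in>UNIV. ((W ** F) $ i $ j)\<^sup>2)"
    unfolding power2_norm_eq_inner by (simp add: inner_vec_def power2_eq_square)
  also have "\<dots> \<le> (\<Sum>i\<in>UNIV. \<Sum>j\<in>UNIV. W $ i $ i * (?f j \<bullet> (W *v ?f j)))"
    using psd_Cauchy_Schwarz[OF W] unfolding entry diag[symmetric] by (intro sum_mono)
  also have "\<dots> = (mat 1 \<bullet> W) * (\<Sum>j\<in>UNIV. ?f j \<bullet> (W *v ?f j))"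
    by (simp add: trace_inner sum_product)
  also have "(\<Sum>j\<in>UNIV. ?f j \<bullet> (W *v ?f j)) \<le> (mat 1 \<bullet> F) * (W \<bullet> F)"
  proof -
    \<comment> \<open>The sum of the outer products of the columns of \<open>F\<close> is the square
      of \<open>F\<close>.\<close>
    let ?G = "(mat 1 \<bullet> F) *\<^sub>R F - (\<Sum>j\<in>UNIV. outer (?f j))"
    have "psd ?G"
      unfolding psd_def
    proof (intro conjI allI)
      show "sym_mat ?G"
        by (intro sym_mat_diff sym_mat_scaleR psd_sym F psd_sum psd_outer)
      fix x
      have "x \<bullet> ((\<Sum>j\<in>UNIV. outer (?f j)) *v x) = (\<Sum>j\<in>UNIV. (x \<bullet> ?f j)\<^sup>2)"
        unfolding inner_outer[symmetric] inner_sum_left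
        by (simp add: inner_outer outer_mult power2_eq_square inner_commute)
      also have "\<dots> \<le> (\<Sum>j\<in>UNIV. (x \<bullet> (F *v x)) * F $ j $ j)"
        using psd_Cauchy_Schwarz[OF F] unfolding diag[symmetric] by (intro sum_mono)
      also have "\<dots> = (mat 1 \<bullet> F) * (x \<bullet> (F *v x))"
        by (simp add: trace_inner sum_distrib_left mult.commute)
      finally show "0 \<le> x \<bullet> (?G *v x)" by (simp add: quad_diff quad_scaleR)
    qed
    then have "0 \<le> W \<bullet> ?G" by (intro psd_inner_nonneg W)
    then show ?thesis by (simp add: inner_diff_right inner_sum_right inner_outer)
  qed
  finally show ?thesis using trace_psd_nonneg[OF W] by (simp add: mult.assoc mult_left_mono)
qed

lemma
  fixes M N F :: "real^'n^'n"
  shows matrix_mult_add_left: "(M + N) ** F = M ** F + N ** F"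
  and matrix_mult_diff_left: "(M - N) ** F = M ** F - N ** F"
  and matrix_mult_scaleR_left: "(c *\<^sub>R M) ** F = c *\<^sub>R (M ** F)"
  by (simp_all add: matrix_matrix_mult_def vec_eq_iff sum.distrib sum_subtractf sum_distrib_left algebra_simps)

lemma psd_inner_eq_0_imp_mult_eq_0:
  assumes "psd W" "psd F" "W \<bullet> F = 0"
  shows "W ** F = 0"
  using norm_psd_mult_psd[OF assms(1,2)] assms(3) by simp

lemma sym_mat_mult_commute_0:
  assumes "sym_mat Z" "sym_mat F" "Z ** F = 0"
  shows "F *v (Z *v x) = 0"
proof -
  have "F ** Z = transpose (Z ** F)" using assms(1,2) unfolding matrix_transpose_mul sym_mat_def by simp
  then have "F ** Z = 0" unfolding assms(3) by (simp add: transpose_def vec_eq_iff)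
  then show ?thesis by (simp add: matrix_vector_mul_assoc)
qed

text \<open>For \<open>u\<close> in the kernel of \<open>F\<close>, \<open>outer u\<close> belongs
  to the face, and the segment from it to \<open>Y0\<close> extends beyond \<open>Y0\<close> inside
  the face; this makes the form of \<open>Y0\<close> positive at \<open>u\<close>. Compactness of
  the unit sphere of the kernel makes the bound uniform.\<close>

lemma face_rel_interior_pos:
  fixes F Y0 :: "real^'n^'n"
  assumes Y0: "Y0 \<in> rel_interior {Z. psd Z \<and> Z \<bullet> F = 0}"
  obtains c where "c > 0" "\<And>u. F *v u = 0 \<Longrightarrow> c * (u \<bullet> u) \<le> u \<bullet> (Y0 *v u)"
proof -
  let ?face = "{Z. psd Z \<and> Z \<bullet> F = 0}"
  have conv: "convex ?face"
    unfolding convex_alt by (auto intro!: psd_add psd_scaleR simp: inner_add_left)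
  have pos: "0 < u \<bullet> (Y0 *v u)" if u: "F *v u = 0" "u \<noteq> 0" for u
  proof -
    have "outer u \<bullet> F = 0" using u by (simp add: inner_commute[of _ F] inner_outer)
    then have "outer u \<in> ?face" by (simp add: psd_outer)
    then obtain e where e: "e > 1" "(1 - e) *\<^sub>R outer u + e *\<^sub>R Y0 \<in> ?face"
      using convex_rel_interior_iff[OF conv, of Y0] Y0 by blast
    then have "0 \<le> u \<bullet> (((1 - e) *\<^sub>R outer u + e *\<^sub>R Y0) *v u)" by (simp add: psd_def)
    then have "(e - 1) * (u \<bullet> u)\<^sup>2 \<le> e * (u \<bullet> (Y0 *v u))"
      by (simp add: quad_add quad_scaleR outer_mult power2_eq_square algebra_simps)
    moreover have "0 < (e - 1) * (u \<bullet> u)\<^sup>2" using e u by simp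
    ultimately have "0 < e * (u \<bullet> (Y0 *v u))" by linarith
    then show ?thesis using e by (simp add: zero_less_mult_iff)
  qed
  let ?S = "sphere 0 1 \<inter> {u. F *v u = 0}"
  show ?thesis
  proof (cases "?S = {}")
    case True
    have "u = 0" if "F *v u = 0" for u
    proof (rule ccontr)
      assume "u \<noteq> 0"
      then have "(1 / norm u) *\<^sub>R u \<in> ?S" using that by (simp add: matrix_vector_mult_scaleR)
      then show False using True by blast
    qed
    then show ?thesis by (intro that[of 1]) (simp, metis inner_zero_left mult_zero_right order_refl)
  next
    case False
    have cl: "closed {u. F *v u = 0}"
      by (intro closed_Collect_eq linear_continuous_on) (auto simp: linear_linear)
    have comp: "compact ?S" by (intro compact_Int_closed cl) simp
    have cont: "continuous_on ?S (\<lambda>u. u \<bullet> (Y0 *v u))"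
      by (intro continuous_on_inner continuous_on_id linear_continuous_on) (simp add: linear_linear)
    from continuous_attains_inf[OF comp False cont]
    obtain u0 where u0: "u0 \<in> ?S" "\<And>u. u \<in> ?S \<Longrightarrow> u0 \<bullet> (Y0 *v u0) \<le> u \<bullet> (Y0 *v u)"
      by blast
    show ?thesis
    proof (rule that)
      show "0 < u0 \<bullet> (Y0 *v u0)" using u0(1) by (intro pos) auto
      fix u :: "real^'n" assume u: "F *v u = 0"
      show "u0 \<bullet> (Y0 *v u0) * (u \<bullet> u) \<le> u \<bullet> (Y0 *v u)"
      proof (cases "u = 0")
        case False
        have "(1 / norm u) *\<^sub>R u \<in> ?S" using u False by (simp add: matrix_vector_mult_scaleR)
        from u0(2)[OF this] have "u0 \<bullet> (Y0 *v u0) \<le> (u \<bullet> (Y0 *v u)) / (norm u)\<^sup>2"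
          by (simp add: matrix_vector_mult_scaleR power2_eq_square)
        then show ?thesis using False by (simp add: pos_le_divide_eq power2_norm_eq_inner)
      qed simp
    qed
  qed
qed

text \<open>An error bound for the cone along an affine space. First a small \<open>D\<close> in
  \<open>L\<close> restores the equation \<open>(Z - D) ** F = 0\<close>, after which only the
  kernel of \<open>F\<close> matters; there a small multiple of \<open>Y0\<close> absorbs the
  remaining negativity. Corrections stay in \<open>L\<close> and the span of \<open>Y0\<close>, so
  the linear constraints survive division by \<open>1 + \<kappa>\<close>.\<close>

lemma facial_correction:
  fixes F Y0 :: "real^'n^'n"
  assumes F: "psd F" and L: "subspace L" "\<And>D. D \<in> L \<Longrightarrow> sym_mat D"
    and Y0: "Y0 \<in> rel_interior {Z. psd Z \<and> Z \<bullet> F = 0}"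
  obtains K where "K \<ge> 0"
    "\<And>Z \<delta>. Z - Y0 \<in> L \<Longrightarrow> Z \<bullet> F = 0 \<Longrightarrow> 0 \<le> \<delta> \<Longrightarrow> psd (Z + \<delta> *\<^sub>R mat 1) \<Longrightarrow>
      \<exists>D \<kappa>. D \<in> L \<and> 0 \<le> \<kappa> \<and> psd (Z - D + \<kappa> *\<^sub>R Y0) \<and>
        norm D \<le> K * (sqrt (\<delta> * (mat 1 \<bullet> (Z + \<delta> *\<^sub>R mat 1))) + \<delta>) \<and>
        \<kappa> \<le> K * (sqrt (\<delta> * (mat 1 \<bullet> (Z + \<delta> *\<^sub>R mat 1))) + \<delta>)"
proof -
  have Y0f: "psd Y0" "Y0 \<bullet> F = 0" using rel_interior_subset Y0 by blast+
  have Y0F: "Y0 ** F = 0" by (rule psd_inner_eq_0_imp_mult_eq_0[OF Y0f(1) F Y0f(2)])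
  obtain c where c: "c > 0" "\<And>u. F *v u = 0 \<Longrightarrow> c * (u \<bullet> u) \<le> u \<bullet> (Y0 *v u)"
    using face_rel_interior_pos[OF Y0] by metis
  \<comment> \<open>The right inverse \<open>g\<close> picks the correction linearly from the defect
    \<open>Z ** F\<close>, hence with a norm bound \<open>B\<close> that does not depend on
    \<open>Z\<close>.\<close>
  have "linear (\<lambda>D :: real^'n^'n. D ** F)"
    by (intro linearI) (simp_all add: matrix_mult_add_left matrix_mult_scaleR_left)
  from linear_exists_right_inverse_on[OF this L(1)]
  obtain g where g: "range g \<subseteq> L" "linear g" "\<And>D. D \<in> L \<Longrightarrow> g (D ** F) ** F = D ** F"
    by auto
  obtain B where B: "B > 0" "\<And>M. norm (g M) \<le> B * norm M" using linear_bounded_pos[OF g(2)] by metis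
  define B' where "B' = B * (mat 1 \<bullet> F + norm F)"
  have trF: "0 \<le> mat 1 \<bullet> F" by (rule trace_psd_nonneg[OF F])
  have B'0: "0 \<le> B'" using B trF by (simp add: B'_def)
  define K where "K = B' + (1 + B') / c"
  show ?thesis
  proof (rule that[of K])
    show "K \<ge> 0" using B'0 c by (simp add: K_def)
    fix Z :: "real^'n^'n" and \<delta> :: real
    assume ZL: "Z - Y0 \<in> L" and ZF: "Z \<bullet> F = 0" and \<delta>: "0 \<le> \<delta>" and W: "psd (Z + \<delta> *\<^sub>R mat 1)"
    define W where "W = Z + \<delta> *\<^sub>R mat 1"
    define m where "m = sqrt (\<delta> * (mat 1 \<bullet> W)) + \<delta>"
    have psdW: "psd W" using W by (simp add: W_def)
    have trW: "0 \<le> mat 1 \<bullet> W" by (rule trace_psd_nonneg[OF psdW])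
    have m0: "0 \<le> m" "\<delta> \<le> m" using \<delta> trW by (auto simp: m_def)
    \<comment> \<open>As \<open>Z\<close> is orthogonal to \<open>F\<close>, only
      \<open>\<delta>\<close> times the trace of \<open>F\<close> is left of
      \<open>W \<bullet> F\<close>; this factor \<open>\<delta>\<close> is the origin of the square
      root.\<close>
    have WF: "norm (W ** F) \<le> (mat 1 \<bullet> F) * sqrt (\<delta> * (mat 1 \<bullet> W))"
    proof (rule power2_le_imp_le)
      have "W \<bullet> F = \<delta> * (mat 1 \<bullet> F)" using ZF by (simp add: W_def inner_add_left)
      then have "(norm (W ** F))\<^sup>2 \<le> (mat 1 \<bullet> W) * (mat 1 \<bullet> F) * (\<delta> * (mat 1 \<bullet> F))"
        using norm_psd_mult_psd[OF psdW F] by simp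
      also have "\<dots> = ((mat 1 \<bullet> F) * sqrt (\<delta> * (mat 1 \<bullet> W)))\<^sup>2"
        using \<delta> trW by (simp add: power_mult_distrib power2_eq_square)
      finally show "(norm (W ** F))\<^sup>2 \<le> ((mat 1 \<bullet> F) * sqrt (\<delta> * (mat 1 \<bullet> W)))\<^sup>2" .
      show "0 \<le> (mat 1 \<bullet> F) * sqrt (\<delta> * (mat 1 \<bullet> W))" using trF \<delta> trW by simp
    qed
    have "Z = W - \<delta> *\<^sub>R mat 1" by (simp add: W_def)
    then have "Z ** F = W ** F - \<delta> *\<^sub>R F"
      by (simp add: matrix_mult_diff_left matrix_mult_scaleR_left)
    then have "norm (Z ** F) \<le> norm (W ** F) + \<delta> * norm F"
      using norm_triangle_ineq4[of "W ** F" "\<delta> *\<^sub>R F"] \<delta> by simp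
    also have "\<dots> \<le> (mat 1 \<bullet> F) * m + norm F * m"
    proof (rule add_mono)
      have "(mat 1 \<bullet> F) * sqrt (\<delta> * (mat 1 \<bullet> W)) \<le> (mat 1 \<bullet> F) * m"
        using trF \<delta> by (intro mult_left_mono) (auto simp: m_def)
      with WF show "norm (W ** F) \<le> (mat 1 \<bullet> F) * m" by linarith
      show "\<delta> * norm F \<le> norm F * m" using mult_right_mono[OF m0(2), of "norm F"] by (simp add: mult.commute)
    qed
    finally have nZF: "norm (Z ** F) \<le> (mat 1 \<bullet> F + norm F) * m" by (simp add: algebra_simps)
    define D where "D = g (Z ** F)"
    have DL: "D \<in> L" using g(1) by (auto simp: D_def)
    have "norm D \<le> B * norm (Z ** F)" unfolding D_def by (rule B)
    also have "\<dots> \<le> B * ((mat 1 \<bullet> F + norm F) * m)" using nZF B(1) by (intro mult_left_mono) auto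
    finally have nD: "norm D \<le> B' * m" by (simp add: B'_def mult.assoc)
    have "(Z - Y0) ** F = Z ** F" by (simp add: matrix_mult_diff_left Y0F)
    then have DF: "D ** F = Z ** F" using g(3)[OF ZL] by (simp add: D_def)
    define Z1 where "Z1 = Z - D"
    have Z1F: "Z1 ** F = 0" using DF by (simp add: Z1_def matrix_mult_diff_left)
    have symZ: "sym_mat Z" using sym_mat_add[OF L(2)[OF ZL] psd_sym[OF Y0f(1)]] by simp
    have symZ1: "sym_mat Z1" unfolding Z1_def by (intro sym_mat_diff symZ L(2) DL)
    define k where "k = \<delta> + norm D"
    have k0: "0 \<le> k" using \<delta> by (simp add: k_def)
    have Z1low: "- k * (x \<bullet> x) \<le> x \<bullet> (Z1 *v x)" for x
    proof -
      have "0 \<le> x \<bullet> (W *v x)" using psdW by (simp add: psd_def)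
      then have "- \<delta> * (x \<bullet> x) \<le> x \<bullet> (Z *v x)" by (simp add: W_def quad_add quad_scaleR)
      then show ?thesis using abs_quad_le[of x D] by (simp add: Z1_def quad_diff k_def algebra_simps abs_le_iff)
    qed
    \<comment> \<open>On the kernel of \<open>F\<close>, \<open>Z1\<close> is at least
      \<open>-k\<close> and \<open>Y0\<close> at least \<open>c\<close>, so \<open>k / c\<close> is
      just enough.\<close>
    define \<kappa> where "\<kappa> = k / c"
    define M where "M = Z1 + \<kappa> *\<^sub>R Y0"
    have symM: "sym_mat M" unfolding M_def by (intro sym_mat_add sym_mat_scaleR symZ1 psd_sym Y0f)
    have MF: "M ** F = 0" by (simp add: M_def matrix_mult_add_left Z1F matrix_mult_scaleR_left Y0F)
    have "0 \<le> x \<bullet> (M *v x)" for x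
    proof -
      let ?N = "{u. F *v u = 0}"
      have sub: "subspace ?N"
        by (auto simp: subspace_def matrix_vector_right_distrib matrix_vector_mult_scaleR)
      obtain u w where uw: "u \<in> span ?N" "\<And>n. n \<in> span ?N \<Longrightarrow> orthogonal w n" "x = u + w"
        using orthogonal_subspace_decomp_exists[of ?N x] by metis
      have u: "F *v u = 0" using uw(1) sub by (simp add: span_eq_iff[THEN iffD2])
      \<comment> \<open>By symmetry \<open>M\<close> maps into the kernel of \<open>F\<close>, to
        which \<open>w\<close> is orthogonal. Hence \<open>M *v w\<close> has norm zero and the form
        of \<open>M\<close> sees only the component \<open>u\<close>.\<close>
      have "F *v (M *v (M *v w)) = 0" by (rule sym_mat_mult_commute_0[OF symM psd_sym[OF F] MF])
      then have "orthogonal w (M *v (M *v w))" using uw(2) by (simp add: span_base)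
      then have "w \<bullet> (M *v (M *v w)) = 0" by (simp add: orthogonal_def)
      then have Mw: "M *v w = 0" using sym_mat_inner_commute[OF symM, of w "M *v w"] by simp
      have "x \<bullet> (M *v x) = u \<bullet> (M *v u)"
        using sym_mat_inner_commute[OF symM, of w u] Mw
        by (simp add: uw(3) matrix_vector_right_distrib inner_add_left)
      also have "\<dots> \<ge> 0"
      proof -
        have "k * (u \<bullet> u) = \<kappa> * (c * (u \<bullet> u))" using c(1) by (simp add: \<kappa>_def)
        also have "\<dots> \<le> \<kappa> * (u \<bullet> (Y0 *v u))" using c(2)[OF u] k0 c(1) by (intro mult_left_mono) (auto simp: \<kappa>_def)
        finally show ?thesis using Z1low[of u] by (simp add: M_def quad_add quad_scaleR)
      qed
      finally show ?thesis .
    qed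
    then have psdM: "psd (Z - D + \<kappa> *\<^sub>R Y0)" using symM unfolding M_def Z1_def psd_def by blast
    have KB: "B' * m \<le> K * m" using m0 B'0 c by (intro mult_right_mono) (auto simp: K_def)
    have "k \<le> (1 + B') * m" using nD m0 by (simp add: k_def algebra_simps)
    then have "\<kappa> \<le> (1 + B') * m / c" unfolding \<kappa>_def using c(1) by (intro divide_right_mono) auto
    also have "\<dots> \<le> K * m" using m0 B'0 by (simp add: K_def algebra_simps)
    finally have "\<kappa> \<le> K * m" .
    moreover have "0 \<le> \<kappa>" using k0 c by (simp add: \<kappa>_def)
    moreover have "norm D \<le> K * m" using nD KB by linarith
    ultimately show "\<exists>D \<kappa>. D \<in> L \<and> 0 \<le> \<kappa> \<and> psd (Z - D + \<kappa> *\<^sub>R Y0) \<and>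
        norm D \<le> K * (sqrt (\<delta> * (mat 1 \<bullet> (Z + \<delta> *\<^sub>R mat 1))) + \<delta>) \<and>
        \<kappa> \<le> K * (sqrt (\<delta> * (mat 1 \<bullet> (Z + \<delta> *\<^sub>R mat 1))) + \<delta>)"
      using DL psdM unfolding m_def W_def by blast
  qed
qed

section \<open>The limiting value function\<close>

text \<open>A function that is eventually on one side of every level cannot oscillate; its limit is
  the supremum of the levels it eventually stays at or above, finite by the two bounds.\<close>

lemma limit_exists_if_levels_decided:
  fixes f :: "'a \<Rightarrow> real"
  assumes F: "F \<noteq> bot"
    and dec: "\<And>c. eventually (\<lambda>t. f t < c) F \<or> eventually (\<lambda>t. \<not> f t < c) F"
    and lo: "eventually (\<lambda>t. lo < f t) F" and hi: "eventually (\<lambda>t. f t < hi) F"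
  shows "\<exists>L. (f \<longlongrightarrow> L) F"
proof -
  define K where "K = {c. eventually (\<lambda>t. \<not> f t < c) F}"
  have K: "lo \<in> K" using lo unfolding K_def by (auto elim: eventually_mono)
  have bd: "c \<le> hi" if "c \<in> K" for c
  proof (rule ccontr)
    assume "\<not> c \<le> hi"
    then have "eventually (\<lambda>t. False) F"
      using hi \<open>c \<in> K\<close> unfolding K_def by (auto elim: eventually_elim2)
    then show False using F by (simp add: eventually_False)
  qed
  have bdd: "bdd_above K" using bd by (rule bdd_aboveI)
  have "(f \<longlongrightarrow> Sup K) F"
  proof (rule order_tendstoI)
    fix a assume "a < Sup K"
    then obtain c where c: "c \<in> K" "a < c" using less_cSup_iff[OF _ bdd] K by auto
    then have "eventually (\<lambda>t. \<not> f t < c) F" by (simp add: K_def)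
    then show "eventually (\<lambda>t. a < f t) F" by eventually_elim (use c in auto)
  next
    fix a assume "Sup K < a"
    then have "a \<notin> K" using cSup_upper[OF _ bdd, of a] by auto
    then show "eventually (\<lambda>t. f t < a) F" using dec[of a] by (auto simp: K_def)
  qed
  then show ?thesis by blast
qed

lemma dual_feasible_regC:
  assumes "dual_feasible C A y" "0 \<le> \<epsilon>"
  shows "dual_feasible (regC C \<epsilon>) A y"
proof -
  have "regC C \<epsilon> - opsum A y = (C - opsum A y) + \<epsilon> *\<^sub>R mat 1" by (simp add: regC_def)
  then show ?thesis
    unfolding dual_feasible_def using assms by (metis dual_feasible_def psd_add psd_scaleR psd_one)
qed

lemma primal_feasible_regb:
  assumes "primal_feasible A b X" "0 \<le> \<eta>"
  shows "primal_feasible A (regb A b \<eta>) (X + \<eta> *\<^sub>R mat 1)"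
  using assms by (simp add: primal_feasible_iff regb_def frob_inner inner_add_right psd_add psd_scaleR psd_one)

lemma regC_inner: "regC C \<epsilon> \<bullet> X = C \<bullet> X + \<epsilon> * (mat 1 \<bullet> X)"
  by (simp add: regC_def inner_add_left)

lemma regb_inner: "regb A b \<eta> \<bullet> y = b \<bullet> y + \<eta> * (opsum A y \<bullet> mat 1)"
proof -
  have "(\<chi> i. A i \<bullet> mat 1) \<bullet> y = opsum A y \<bullet> mat 1"
    by (simp add: inner_opsum inner_vec_def[of _ y] mult.commute)
  then show ?thesis by (simp add: regb_def frob_inner inner_add_left)
qed

lemma eventually_at_right_pos:
  assumes "\<And>t::real. 0 < t \<Longrightarrow> Q t"
  shows "eventually Q (at_right 0)"
  using eventually_at_right_less[of "0::real"] by eventually_elim (use assms in auto)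

locale sdp_pair =
  fixes C :: "real^'n^'n" and A :: "'m::finite \<Rightarrow> real^'n^'n" and b :: "real^'m"
  assumes symC: "sym_mat C"
    and symA: "\<And>i. sym_mat (A i)"
    and Pfeas: "\<exists>X. primal_feasible A b X"
    and Dfeas: "\<exists>y. dual_feasible C A y"
begin

abbreviation "v \<equiv> vreg C A b"

definition Lv :: "real \<Rightarrow> real \<Rightarrow> real" where
  "Lv \<epsilon> \<eta> = Lim (at_right 0) (\<lambda>t. v (t * \<epsilon>) (t * \<eta>))"

lemma v_less_iff:
  assumes "0 \<le> \<epsilon>" "0 \<le> \<eta>"
  shows "v \<epsilon> \<eta> < c \<longleftrightarrow> (\<exists>X. primal_feasible A (regb A b \<eta>) X \<and> regC C \<epsilon> \<bullet> X < c)"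
  using vP_less_iff dual_feasible_regC primal_feasible_regb Pfeas Dfeas assms unfolding vreg_def by metis

lemma v_le:
  assumes "0 \<le> \<epsilon>" "primal_feasible A (regb A b \<eta>) X"
  shows "v \<epsilon> \<eta> \<le> regC C \<epsilon> \<bullet> X"
  using vP_le dual_feasible_regC Dfeas assms unfolding vreg_def by metis

lemma v_ge:
  assumes "0 \<le> \<eta>" "\<And>X. primal_feasible A (regb A b \<eta>) X \<Longrightarrow> c \<le> regC C \<epsilon> \<bullet> X"
  shows "c \<le> v \<epsilon> \<eta>"
  using vP_ge primal_feasible_regb Pfeas assms unfolding vreg_def by metis

lemma v_upper:
  assumes "primal_feasible A b X" "0 \<le> \<epsilon>" "0 \<le> \<eta>"
  shows "v \<epsilon> \<eta> \<le> C \<bullet> X + \<epsilon> * (mat 1 \<bullet> X) + \<eta> * (C \<bullet> mat 1) + \<epsilon> * \<eta> * (mat 1 \<bullet> (mat 1 :: real^'n^'n))"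
  using v_le[OF assms(2) primal_feasible_regb[OF assms(1,3)]]
  by (simp add: regC_inner inner_add_right algebra_simps)

lemma v_lower:
  assumes "dual_feasible C A y" "0 \<le> \<epsilon>" "0 \<le> \<eta>"
  shows "b \<bullet> y + \<eta> * (opsum A y \<bullet> mat 1) \<le> v \<epsilon> \<eta>"
  using v_ge[OF assms(3)] weak_duality[OF _ dual_feasible_regC[OF assms(1,2)]] by (metis regb_inner)

text \<open>The strict inequality matters: an infimum is below \<open>c\<close> exactly when some
  feasible point is, whether or not the infimum is attained, so the condition is purely
  existential.\<close>

lemma v_level_decided:
  assumes "0 \<le> \<epsilon>" "0 \<le> \<eta>"
  shows "eventually (\<lambda>t. v (t * \<epsilon>) (t * \<eta>) < c) (at_right 0) \<or>
         eventually (\<lambda>t. \<not> v (t * \<epsilon>) (t * \<eta>) < c) (at_right 0)"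
proof -
  \<comment> \<open>The variable \<open>None\<close> carries \<open>t\<close>, and
    \<open>Some (k, i)\<close> carries entry \<open>i\<close> of the \<open>k\<close>-th Gram vector
    of the matrix.\<close>
  let ?V = "UNIV :: ('n \<times> 'n) option set"
  define X :: "(('n \<times> 'n) option \<Rightarrow> real) \<Rightarrow> real^'n^'n"
    where "X e = (\<Sum>k\<in>UNIV. outer (\<chi> i. e (Some (k, i))))" for e
  define f where "f i e = A i \<bullet> X e - regb A b (e None * \<eta>) $ i" for i e
  define g where "g e = regC C (e None * \<epsilon>) \<bullet> X e - c" for e
  note ring = fun_ring_polyfun[of ?V]
  have Xpf: "(\<lambda>e. X e $ i $ j) \<in> polyfun ?V" for i j
    by (simp add: X_def outer_def) (intro fun_ring_sum[OF ring] polyfun.intros, auto)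
  have inpf: "(\<lambda>e. M \<bullet> X e) \<in> polyfun ?V" for M :: "real^'n^'n"
    unfolding inner_vec_def inner_real_def
    by (intro fun_ring_sum[OF ring] polyfun.mult polyfun.const Xpf)
  have fpf: "f i \<in> polyfun ?V" for i
    unfolding f_def regb_def by (simp, intro fun_ring_diff[OF ring] polyfun.add polyfun.mult polyfun.const inpf polyfun.var) auto
  have gpf: "g \<in> polyfun ?V"
    unfolding g_def regC_inner by (intro fun_ring_diff[OF ring] polyfun.add polyfun.mult polyfun.const inpf polyfun.var) auto
  define Q where "Q = insert g (range f)"
  define P where "P e \<longleftrightarrow> (\<forall>i. f i e = 0) \<and> g e < 0" for e
  have "eventually (\<lambda>t. \<exists>e. e None = t \<and> P e) (at_right 0) \<or>
        eventually (\<lambda>t. \<not> (\<exists>e. e None = t \<and> P e)) (at_right 0)"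
  proof (rule polyfun_exists_eventually_const[of Q])
    show "finite Q" by (simp add: Q_def)
    show "Q \<subseteq> polyfun UNIV" using fpf gpf by (auto simp: Q_def)
    fix e e' assume eq: "sgn_equiv Q e e'" and Pe: "P e"
    have s: "sgn (g e) = sgn (g e')" "sgn (f i e) = sgn (f i e')" for i
      using eq by (auto simp: sgn_equiv_def Q_def)
    have "f i e' = 0" for i using s(2)[of i] Pe by (simp add: P_def sgn_0_0)
    moreover have "g e' < 0" using s(1) Pe sgn_1_neg[of "g e'"] by (simp add: P_def)
    ultimately show "P e'" by (simp add: P_def)
  qed
  moreover have "(\<exists>e. e None = t \<and> P e) \<longleftrightarrow> v (t * \<epsilon>) (t * \<eta>) < c" if "0 < t" for t
  proof -
    have "v (t * \<epsilon>) (t * \<eta>) < c \<longleftrightarrow> (\<exists>X. primal_feasible A (regb A b (t * \<eta>)) X \<and> regC C (t * \<epsilon>) \<bullet> X < c)"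
      using v_less_iff assms that by simp
    also have "\<dots> \<longleftrightarrow> (\<exists>e. e None = t \<and> P e)"
    proof
      assume "\<exists>X. primal_feasible A (regb A b (t * \<eta>)) X \<and> regC C (t * \<epsilon>) \<bullet> X < c"
      then obtain Y where Y: "primal_feasible A (regb A b (t * \<eta>)) Y" "regC C (t * \<epsilon>) \<bullet> Y < c" by blast
      then have "psd Y" by (simp add: primal_feasible_iff)
      then obtain w :: "'n \<Rightarrow> real^'n" where w: "Y = (\<Sum>k\<in>UNIV. outer (w k))"
        unfolding psd_iff_gram by blast
      define e where "e = (\<lambda>x. case x of None \<Rightarrow> t | Some (k, i) \<Rightarrow> w k $ i)"
      have "X e = Y" by (simp add: X_def e_def w)
      moreover have "e None = t" by (simp add: e_def)
      ultimately show "\<exists>e. e None = t \<and> P e" using Y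
        by (intro exI[of _ e]) (simp add: P_def f_def g_def primal_feasible_iff)
    next
      assume "\<exists>e. e None = t \<and> P e"
      then obtain e where e: "e None = t" "P e" by blast
      have "psd (X e)" unfolding X_def by (intro psd_sum psd_outer)
      then show "\<exists>X. primal_feasible A (regb A b (t * \<eta>)) X \<and> regC C (t * \<epsilon>) \<bullet> X < c"
        using e by (intro exI[of _ "X e"]) (simp add: P_def f_def g_def primal_feasible_iff)
    qed
    finally show ?thesis by simp
  qed
  then have iff: "eventually (\<lambda>t. (\<exists>e. e None = t \<and> P e) \<longleftrightarrow> v (t * \<epsilon>) (t * \<eta>) < c) (at_right 0)"
    by (rule eventually_mono[OF eventually_at_right_less])
  ultimately show ?thesis
  proof (elim disjE)
    assume "eventually (\<lambda>t. \<exists>e. e None = t \<and> P e) (at_right 0)"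
    with iff have "eventually (\<lambda>t. v (t * \<epsilon>) (t * \<eta>) < c) (at_right 0)"
      by eventually_elim blast
    then show ?thesis ..
  next
    assume "eventually (\<lambda>t. \<not> (\<exists>e. e None = t \<and> P e)) (at_right 0)"
    with iff have "eventually (\<lambda>t. \<not> v (t * \<epsilon>) (t * \<eta>) < c) (at_right 0)"
      by eventually_elim blast
    then show ?thesis ..
  qed
qed

lemma Lv_tendsto:
  assumes "0 \<le> \<epsilon>" "0 \<le> \<eta>"
  shows "((\<lambda>t. v (t * \<epsilon>) (t * \<eta>)) \<longlongrightarrow> Lv \<epsilon> \<eta>) (at_right 0)"
proof -
  obtain X where X: "primal_feasible A b X" using Pfeas by blast
  obtain y where y: "dual_feasible C A y" using Dfeas by blast
  have pos: "eventually (\<lambda>t::real. 0 < t) (at_right 0)" by (simp add: eventually_at_right_less)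
  have "\<exists>L. ((\<lambda>t. v (t * \<epsilon>) (t * \<eta>)) \<longlongrightarrow> L) (at_right 0)"
  proof (rule limit_exists_if_levels_decided[OF _ v_level_decided[OF assms]])
    let ?h = "\<lambda>t. C \<bullet> X + t * \<epsilon> * (mat 1 \<bullet> X) + t * \<eta> * (C \<bullet> mat 1) + t * \<epsilon> * (t * \<eta>) * (mat 1 \<bullet> (mat 1 :: real^'n^'n))"
    have "(?h \<longlongrightarrow> C \<bullet> X + 0 * \<epsilon> * (mat 1 \<bullet> X) + 0 * \<eta> * (C \<bullet> mat 1) + 0 * \<epsilon> * (0 * \<eta>) * (mat 1 \<bullet> (mat 1 :: real^'n^'n))) (at_right 0)"
      by (intro tendsto_intros)
    then have "eventually (\<lambda>t. ?h t < C \<bullet> X + 1) (at_right 0)" by (rule order_tendstoD) simp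
    then show "eventually (\<lambda>t. v (t * \<epsilon>) (t * \<eta>) < C \<bullet> X + 1) (at_right 0)"
      using pos
    proof eventually_elim
      case (elim t)
      then have "0 \<le> t * \<epsilon>" "0 \<le> t * \<eta>" using assms by auto
      from v_upper[OF X this] elim(1) show ?case by (rule le_less_trans)
    qed
    let ?l = "\<lambda>t. b \<bullet> y + t * \<eta> * (opsum A y \<bullet> mat 1)"
    have "(?l \<longlongrightarrow> b \<bullet> y + 0 * \<eta> * (opsum A y \<bullet> mat 1)) (at_right 0)"
      by (intro tendsto_intros)
    then have "eventually (\<lambda>t. b \<bullet> y - 1 < ?l t) (at_right 0)" by (rule order_tendstoD) simp
    then show "eventually (\<lambda>t. b \<bullet> y - 1 < v (t * \<epsilon>) (t * \<eta>)) (at_right 0)"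
      using pos
    proof eventually_elim
      case (elim t)
      then have "0 \<le> t * \<epsilon>" "0 \<le> t * \<eta>" using assms by auto
      from elim(1) v_lower[OF y this] show ?case by (rule less_le_trans)
    qed
  qed simp
  then show ?thesis unfolding Lv_def by (auto simp: tendsto_Lim)
qed

lemma Lv_eqI:
  assumes "((\<lambda>t. v (t * \<epsilon>) (t * \<eta>)) \<longlongrightarrow> L) (at_right 0)"
  shows "Lv \<epsilon> \<eta> = L"
  unfolding Lv_def using assms by (intro tendsto_Lim) auto

lemma Lv_le:
  assumes "0 \<le> \<epsilon>" "0 \<le> \<eta>" "(h \<longlongrightarrow> L) (at_right 0)"
    and "eventually (\<lambda>t. v (t * \<epsilon>) (t * \<eta>) \<le> h t) (at_right 0)"
  shows "Lv \<epsilon> \<eta> \<le> L"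
  using assms by (intro tendsto_le[OF _ assms(3) Lv_tendsto]) auto

lemma Lv_ge:
  assumes "0 \<le> \<epsilon>" "0 \<le> \<eta>" "(h \<longlongrightarrow> L) (at_right 0)"
    and "eventually (\<lambda>t. h t \<le> v (t * \<epsilon>) (t * \<eta>)) (at_right 0)"
  shows "L \<le> Lv \<epsilon> \<eta>"
  using assms by (intro tendsto_le[OF _ Lv_tendsto assms(3)]) auto

lemma Lv_le_vP:
  assumes "0 \<le> \<epsilon>" "0 \<le> \<eta>"
  shows "Lv \<epsilon> \<eta> \<le> vP C A b"
proof -
  have "Lv \<epsilon> \<eta> \<le> C \<bullet> X" if X: "primal_feasible A b X" for X
  proof (rule Lv_le[OF assms])
    let ?h = "\<lambda>t. C \<bullet> X + t * \<epsilon> * (mat 1 \<bullet> X) + t * \<eta> * (C \<bullet> mat 1) + t * \<epsilon> * (t * \<eta>) * (mat 1 \<bullet> (mat 1 :: real^'n^'n))"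
    have "(?h \<longlongrightarrow> C \<bullet> X + 0 * \<epsilon> * (mat 1 \<bullet> X) + 0 * \<eta> * (C \<bullet> mat 1) + 0 * \<epsilon> * (0 * \<eta>) * (mat 1 \<bullet> (mat 1 :: real^'n^'n))) (at_right 0)"
      by (intro tendsto_intros)
    then show "(?h \<longlongrightarrow> C \<bullet> X) (at_right 0)" by simp
    show "eventually (\<lambda>t. v (t * \<epsilon>) (t * \<eta>) \<le> ?h t) (at_right 0)"
      by (rule eventually_at_right_pos) (use v_upper[OF X] assms in simp)
  qed
  then show ?thesis using vP_ge Pfeas by metis
qed

lemma Lv_ge_vD:
  assumes "0 \<le> \<epsilon>" "0 \<le> \<eta>"
  shows "vD C A b \<le> Lv \<epsilon> \<eta>"
proof -
  have "b \<bullet> y \<le> Lv \<epsilon> \<eta>" if y: "dual_feasible C A y" for y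
  proof (rule Lv_ge[OF assms])
    let ?l = "\<lambda>t. b \<bullet> y + t * \<eta> * (opsum A y \<bullet> mat 1)"
    have "(?l \<longlongrightarrow> b \<bullet> y + 0 * \<eta> * (opsum A y \<bullet> mat 1)) (at_right 0)"
      by (intro tendsto_intros)
    then show "(?l \<longlongrightarrow> b \<bullet> y) (at_right 0)" by simp
    show "eventually (\<lambda>t. ?l t \<le> v (t * \<epsilon>) (t * \<eta>)) (at_right 0)"
      by (rule eventually_at_right_pos) (use v_lower[OF y] assms in simp)
  qed
  then show ?thesis using vD_le Dfeas by metis
qed

lemma Lv_eq_vP:
  assumes "0 < \<epsilon>"
  shows "Lv \<epsilon> 0 = vP C A b"
proof (rule antisym)
  show "Lv \<epsilon> 0 \<le> vP C A b" using Lv_le_vP assms by simp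
  show "vP C A b \<le> Lv \<epsilon> 0"
  proof (rule Lv_ge[OF _ _ tendsto_const])
    show "eventually (\<lambda>t. vP C A b \<le> v (t * \<epsilon>) (t * 0)) (at_right 0)"
    proof (rule eventually_at_right_pos, rule v_ge)
      fix t :: real and X assume t: "0 < t" and "primal_feasible A (regb A b (t * 0)) X"
      then have X: "primal_feasible A b X" by (simp add: regb_def)
      have "0 \<le> (t * \<epsilon>) * (mat 1 \<bullet> X)" using X t assms
        by (intro mult_nonneg_nonneg psd_inner_nonneg) (auto simp: primal_feasible_iff psd_one)
      then show "vP C A b \<le> regC C (t * \<epsilon>) \<bullet> X" using vP_le Dfeas X by (force simp: regC_inner)
    qed simp
  qed (use assms in auto)
qed

lemma reg_dual_attained:
  assumes "0 \<le> \<epsilon>" "0 < \<eta>"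
  obtains y where "dual_feasible (regC C \<epsilon>) A y" "v \<epsilon> \<eta> \<le> regb A b \<eta> \<bullet> y"
proof -
  obtain X where X: "primal_feasible A b X" using Pfeas by blast
  obtain y where y: "dual_feasible C A y" using Dfeas by blast
  have "sym_mat (regC C \<epsilon>)" unfolding regC_def by (intro sym_mat_add sym_mat_scaleR sym_mat_one symC)
  from strong_duality_Slater[OF this symA _ assms(2) primal_feasible_regb[OF X] dual_feasible_regC[OF y assms(1)]]
  show ?thesis using X assms that unfolding vreg_def by (auto simp: primal_feasible_iff)
qed

text \<open>The dual feasible set is unchanged for \<open>\<epsilon> = 0\<close>, and its objective
  grows by at most \<open>t * \<eta>\<close> times the trace of \<open>C\<close>, since slacks have
  nonnegative trace. As \<open>v\<close> is a primal value, dual attainment for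
  \<open>t * \<eta> > 0\<close> is needed to reach this picture.\<close>

lemma Lv_eq_vD:
  assumes "0 < \<eta>"
  shows "Lv 0 \<eta> = vD C A b"
proof (rule antisym)
  show "vD C A b \<le> Lv 0 \<eta>" using Lv_ge_vD assms by simp
  let ?h = "\<lambda>t. vD C A b + t * \<eta> * (C \<bullet> mat 1)"
  have "(?h \<longlongrightarrow> vD C A b + 0 * \<eta> * (C \<bullet> mat 1)) (at_right 0)" by (intro tendsto_intros)
  then have lim: "(?h \<longlongrightarrow> vD C A b) (at_right 0)" by simp
  show "Lv 0 \<eta> \<le> vD C A b"
  proof (rule Lv_le[OF _ _ lim])
    show "eventually (\<lambda>t. v (t * 0) (t * \<eta>) \<le> ?h t) (at_right 0)"
    proof (rule eventually_at_right_pos)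
      fix t :: real assume t: "0 < t"
      obtain X where X: "primal_feasible A b X" using Pfeas by blast
      obtain y where y: "dual_feasible (regC C 0) A y" "v 0 (t * \<eta>) \<le> regb A b (t * \<eta>) \<bullet> y"
        using reg_dual_attained[of 0 "t * \<eta>"] t assms by auto
      have yD: "dual_feasible C A y" using y(1) by (simp add: regC_def)
      then have "0 \<le> (C - opsum A y) \<bullet> mat 1" by (intro psd_inner_nonneg psd_one) (simp add: dual_feasible_def)
      then have "t * \<eta> * (opsum A y \<bullet> mat 1) \<le> t * \<eta> * (C \<bullet> mat 1)"
        using t assms by (intro mult_left_mono) (auto simp: inner_diff_left)
      then show "v (t * 0) (t * \<eta>) \<le> ?h t" using y(2) vD_ge[OF X yD] by (simp add: regb_inner)
    qed
  qed (use assms in auto)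
qed

lemma Lv_scale:
  assumes "0 < s" "0 \<le> \<epsilon>" "0 \<le> \<eta>"
  shows "Lv (s * \<epsilon>) (s * \<eta>) = Lv \<epsilon> \<eta>"
proof (rule Lv_eqI)
  have "filterlim (\<lambda>t. t * s) (at_right 0) (at_right (0::real))"
    unfolding filterlim_at
  proof
    have "((\<lambda>t. t * s) \<longlongrightarrow> 0 * s) (at_right 0)" by (intro tendsto_intros)
    then show "((\<lambda>t. t * s) \<longlongrightarrow> 0) (at_right 0)" by simp
    show "eventually (\<lambda>t. t * s \<in> {0<..} \<and> t * s \<noteq> 0) (at_right 0)"
      by (rule eventually_at_right_pos) (use assms in simp)
  qed
  from filterlim_compose[OF Lv_tendsto[OF assms(2,3)] this]
  show "((\<lambda>t. v (t * (s * \<epsilon>)) (t * (s * \<eta>))) \<longlongrightarrow> Lv \<epsilon> \<eta>) (at_right 0)"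
    by (simp add: mult.assoc)
qed

text \<open>Only the objective depends on \<open>\<epsilon>\<close>, so \<open>v\<close> is an
  infimum of affine functions over a fixed set.\<close>

lemma v_concave:
  assumes "0 \<le> \<epsilon>1" "0 \<le> \<epsilon>2" "0 \<le> \<eta>" "0 \<le> l" "l \<le> 1"
  shows "(1 - l) * v \<epsilon>1 \<eta> + l * v \<epsilon>2 \<eta> \<le> v ((1 - l) * \<epsilon>1 + l * \<epsilon>2) \<eta>"
proof (rule v_ge[OF assms(3)])
  fix X assume X: "primal_feasible A (regb A b \<eta>) X"
  have "(1 - l) * v \<epsilon>1 \<eta> + l * v \<epsilon>2 \<eta> \<le> (1 - l) * (regC C \<epsilon>1 \<bullet> X) + l * (regC C \<epsilon>2 \<bullet> X)"
    using v_le[OF _ X] assms by (intro add_mono mult_left_mono) auto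
  also have "\<dots> = regC C ((1 - l) * \<epsilon>1 + l * \<epsilon>2) \<bullet> X" by (simp add: regC_inner algebra_simps)
  finally show "(1 - l) * v \<epsilon>1 \<eta> + l * v \<epsilon>2 \<eta> \<le> regC C ((1 - l) * \<epsilon>1 + l * \<epsilon>2) \<bullet> X" .
qed

text \<open>Only the right-hand side depends on \<open>\<eta>\<close>, so feasible points can be
  mixed; the slack \<open>d\<close> replaces optimal points, which need not exist.\<close>

lemma v_convex:
  assumes "0 \<le> \<epsilon>" "0 \<le> \<eta>1" "0 \<le> \<eta>2" "0 \<le> l" "l \<le> 1"
  shows "v \<epsilon> ((1 - l) * \<eta>1 + l * \<eta>2) \<le> (1 - l) * v \<epsilon> \<eta>1 + l * v \<epsilon> \<eta>2"
proof (rule field_le_epsilon)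
  fix d :: real assume d: "d > 0"
  obtain X1 where X1: "primal_feasible A (regb A b \<eta>1) X1" "regC C \<epsilon> \<bullet> X1 < v \<epsilon> \<eta>1 + d"
    using v_less_iff[of \<epsilon> \<eta>1 "v \<epsilon> \<eta>1 + d"] assms d by auto
  obtain X2 where X2: "primal_feasible A (regb A b \<eta>2) X2" "regC C \<epsilon> \<bullet> X2 < v \<epsilon> \<eta>2 + d"
    using v_less_iff[of \<epsilon> \<eta>2 "v \<epsilon> \<eta>2 + d"] assms d by auto
  let ?X = "(1 - l) *\<^sub>R X1 + l *\<^sub>R X2"
  have "psd ?X" using X1 X2 assms by (intro psd_add psd_scaleR) (auto simp: primal_feasible_iff)
  then have "primal_feasible A (regb A b ((1 - l) * \<eta>1 + l * \<eta>2)) ?X"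
    using X1 X2 by (simp add: primal_feasible_iff regb_def inner_add_right algebra_simps)
  then have "v \<epsilon> ((1 - l) * \<eta>1 + l * \<eta>2) \<le> regC C \<epsilon> \<bullet> ?X" using v_le assms by blast
  also have "\<dots> = (1 - l) * (regC C \<epsilon> \<bullet> X1) + l * (regC C \<epsilon> \<bullet> X2)" by (simp add: inner_add_right)
  also have "\<dots> \<le> (1 - l) * (v \<epsilon> \<eta>1 + d) + l * (v \<epsilon> \<eta>2 + d)"
    using X1 X2 assms by (intro add_mono mult_left_mono) auto
  also have "\<dots> = (1 - l) * v \<epsilon> \<eta>1 + l * v \<epsilon> \<eta>2 + d" by (simp add: algebra_simps)
  finally show "v \<epsilon> ((1 - l) * \<eta>1 + l * \<eta>2) \<le> (1 - l) * v \<epsilon> \<eta>1 + l * v \<epsilon> \<eta>2 + d" .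
qed

lemma Lv_concave:
  assumes "0 \<le> r1" "0 \<le> r2" "0 \<le> l" "l \<le> 1"
  shows "(1 - l) * Lv r1 1 + l * Lv r2 1 \<le> Lv ((1 - l) * r1 + l * r2) 1"
proof (rule Lv_ge)
  show "((\<lambda>t. (1 - l) * v (t * r1) (t * 1) + l * v (t * r2) (t * 1)) \<longlongrightarrow> (1 - l) * Lv r1 1 + l * Lv r2 1) (at_right 0)"
    using assms by (intro tendsto_intros Lv_tendsto) auto
  show "eventually (\<lambda>t. (1 - l) * v (t * r1) (t * 1) + l * v (t * r2) (t * 1)
      \<le> v (t * ((1 - l) * r1 + l * r2)) (t * 1)) (at_right 0)"
  proof (rule eventually_at_right_pos)
    fix t :: real assume t: "0 < t"
    have "t * ((1 - l) * r1 + l * r2) = (1 - l) * (t * r1) + l * (t * r2)" by (simp add: algebra_simps)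
    then show "(1 - l) * v (t * r1) (t * 1) + l * v (t * r2) (t * 1) \<le> v (t * ((1 - l) * r1 + l * r2)) (t * 1)"
      using v_concave[of "t * r1" "t * r2" "t * 1" l] assms t by simp
  qed
qed (use assms in auto)

lemma Lv_convex:
  assumes "0 \<le> s1" "0 \<le> s2" "0 \<le> l" "l \<le> 1"
  shows "Lv 1 ((1 - l) * s1 + l * s2) \<le> (1 - l) * Lv 1 s1 + l * Lv 1 s2"
proof (rule Lv_le)
  show "((\<lambda>t. (1 - l) * v (t * 1) (t * s1) + l * v (t * 1) (t * s2)) \<longlongrightarrow> (1 - l) * Lv 1 s1 + l * Lv 1 s2) (at_right 0)"
    using assms by (intro tendsto_intros Lv_tendsto) auto
  show "eventually (\<lambda>t. v (t * 1) (t * ((1 - l) * s1 + l * s2))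
      \<le> (1 - l) * v (t * 1) (t * s1) + l * v (t * 1) (t * s2)) (at_right 0)"
  proof (rule eventually_at_right_pos)
    fix t :: real assume t: "0 < t"
    have "t * ((1 - l) * s1 + l * s2) = (1 - l) * (t * s1) + l * (t * s2)" by (simp add: algebra_simps)
    then show "v (t * 1) (t * ((1 - l) * s1 + l * s2)) \<le> (1 - l) * v (t * 1) (t * s1) + l * v (t * 1) (t * s2)"
      using v_convex[of "t * 1" "t * s1" "t * s2" l] assms t by simp
  qed
qed (use assms in auto)

end

section \<open>Singularity degree one\<close>

lemma le_if_sqrt_bound:
  fixes x y K :: real
  assumes "0 < d" "\<And>s. 0 < s \<Longrightarrow> s < d \<Longrightarrow> x \<le> y + K * sqrt s"
  shows "x \<le> y"
proof -
  have "((\<lambda>s. y + K * sqrt s) \<longlongrightarrow> y + K * sqrt 0) (at_right 0)" by (intro tendsto_intros)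
  then have "((\<lambda>s. y + K * sqrt s) \<longlongrightarrow> y) (at_right 0)" by simp
  moreover have "eventually (\<lambda>s. x \<le> y + K * sqrt s) (at_right 0)"
    unfolding eventually_at_right_field using assms by blast
  ultimately show ?thesis by (intro tendsto_lowerbound[of _ y]) auto
qed

context sdp_pair
begin

text \<open>An optimal \<open>y\<close> of the regularized dual is repaired by
  \<open>facial_correction\<close> to a feasible point of the original dual. The cost of the repair
  is proportional to \<open>m\<close>, and the trace bound on the slack converts \<open>m\<close>
  into the ratio of the two parameters.\<close>

lemma v_upper_D_sing_deg_one:
  assumes "D_sing_deg_one C A b"
  obtains K where "\<And>\<epsilon> \<eta>. 0 < \<epsilon> \<Longrightarrow> \<epsilon> \<le> 1 \<Longrightarrow> 0 < \<eta> \<Longrightarrow> \<eta> \<le> 1 \<Longrightarrow>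
    v \<epsilon> \<eta> \<le> vD C A b + K * (sqrt (\<epsilon> / \<eta>) + \<epsilon> + \<eta>)"
proof -
  obtain F y0 where F: "psd F" "C \<bullet> F = 0" "\<And>i. A i \<bullet> F = 0"
    and S0: "C - opsum A y0 \<in> rel_interior {Z. psd Z \<and> Z \<bullet> F = 0}"
    using assms unfolding D_sing_deg_one_def frob_inner by blast
  let ?L = "range (opsum A)"
  have L: "subspace ?L"
    by (intro linear_subspace_image linearI) (auto simp: opsum_add opsum_scaleR)
  obtain K where K: "K \<ge> 0" "\<And>Z \<delta>. Z - (C - opsum A y0) \<in> ?L \<Longrightarrow> Z \<bullet> F = 0 \<Longrightarrow> 0 \<le> \<delta> \<Longrightarrow> psd (Z + \<delta> *\<^sub>R mat 1) \<Longrightarrow>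
      \<exists>D \<kappa>. D \<in> ?L \<and> 0 \<le> \<kappa> \<and> psd (Z - D + \<kappa> *\<^sub>R (C - opsum A y0)) \<and>
        norm D \<le> K * (sqrt (\<delta> * (mat 1 \<bullet> (Z + \<delta> *\<^sub>R mat 1))) + \<delta>) \<and>
        \<kappa> \<le> K * (sqrt (\<delta> * (mat 1 \<bullet> (Z + \<delta> *\<^sub>R mat 1))) + \<delta>)"
    using facial_correction[OF F(1) L _ S0] sym_mat_opsum[of A, OF symA] by blast
  obtain X where X: "primal_feasible A b X" using Pfeas by blast
  obtain y1 where y1: "dual_feasible C A y1" using Dfeas by blast
  have psdX: "psd X" using X by (simp add: primal_feasible_iff)
  have trX: "0 \<le> mat 1 \<bullet> X" by (rule trace_psd_nonneg[OF psdX])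
  define n where "n = (mat 1 :: real^'n^'n) \<bullet> mat 1"
  have n0: "0 \<le> n" by (simp add: n_def)
  define T where "T = \<bar>C \<bullet> X\<bar> + mat 1 \<bullet> X + \<bar>C \<bullet> mat 1\<bar> + \<bar>b \<bullet> y1\<bar> + \<bar>opsum A y1 \<bullet> mat 1\<bar> + n"
  have T0: "0 \<le> T" using trX n0 by (simp add: T_def)
  define K1 where "K1 = K * (\<bar>vD C A b - b \<bullet> y0\<bar> + norm X)"
  define K2 where "K2 = \<bar>C \<bullet> mat 1\<bar> + n"
  have K12: "0 \<le> K1" "0 \<le> K2" using K(1) n0 by (auto simp: K1_def K2_def)
  show ?thesis
  proof (rule that[of "K1 * sqrt T + K1 + K2"])
    fix \<epsilon> \<eta> :: real assume \<epsilon>: "0 < \<epsilon>" "\<epsilon> \<le> 1" and \<eta>: "0 < \<eta>" "\<eta> \<le> 1"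
    obtain y where y: "dual_feasible (regC C \<epsilon>) A y" "v \<epsilon> \<eta> \<le> regb A b \<eta> \<bullet> y"
      using reg_dual_attained[of \<epsilon> \<eta>] \<epsilon> \<eta> by auto
    define S where "S = C - opsum A y"
    have W: "psd (S + \<epsilon> *\<^sub>R mat 1)"
      using y(1) by (simp add: dual_feasible_def S_def regC_def algebra_simps)
    \<comment> \<open>Objective values are read off matrices through a fixed feasible
      \<open>X\<close>. No bound on \<open>y\<close> or \<open>d\<close> is then needed, only bounds
      on slacks and on \<open>D\<close>.\<close>
    have by_eq: "b \<bullet> z = opsum A z \<bullet> X" for z
      using X inner_opsum_feasible[of A X b z] by (simp add: primal_feasible_iff)
    have byS: "b \<bullet> y = C \<bullet> X - S \<bullet> X" by (simp add: by_eq S_def inner_diff_left)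
    have "0 \<le> (S + \<epsilon> *\<^sub>R mat 1) \<bullet> X" by (rule psd_inner_nonneg[OF W psdX])
    then have SX: "- (S \<bullet> X) \<le> \<epsilon> * (mat 1 \<bullet> X)" by (simp add: inner_add_left)
    have "0 \<le> (S + \<epsilon> *\<^sub>R mat 1) \<bullet> mat 1" by (rule psd_inner_nonneg[OF W psd_one])
    then have SI: "- (S \<bullet> mat 1) \<le> \<epsilon> * n" by (simp add: inner_add_left n_def)
    have vy: "v \<epsilon> \<eta> \<le> b \<bullet> y + \<eta> * (C \<bullet> mat 1) - \<eta> * (S \<bullet> mat 1)"
      using y(2) by (simp add: regb_inner S_def inner_diff_left algebra_simps)
    let ?tr = "mat 1 \<bullet> (S + \<epsilon> *\<^sub>R mat 1)"
    \<comment> \<open>The regularized dual objective contains \<open>-\<eta>\<close> times the trace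
      of the slack, while its value is bounded below through the fixed \<open>y1\<close>.
      \<open>T\<close> collects the remaining terms, with both parameters at most 1.\<close>
    have "\<eta> * ?tr \<le> T"
    proof -
      have a: "b \<bullet> y1 + \<eta> * (opsum A y1 \<bullet> mat 1) \<le> v \<epsilon> \<eta>" using v_lower[OF y1] \<epsilon> \<eta> by simp
      have "\<bar>\<eta> * (opsum A y1 \<bullet> mat 1)\<bar> \<le> 1 * \<bar>opsum A y1 \<bullet> mat 1\<bar>"
        unfolding abs_mult using \<eta> by (intro mult_right_mono) auto
      moreover have "\<bar>\<eta> * (C \<bullet> mat 1)\<bar> \<le> 1 * \<bar>C \<bullet> mat 1\<bar>"
        unfolding abs_mult using \<eta> by (intro mult_right_mono) auto
      moreover have "\<epsilon> * (mat 1 \<bullet> X) \<le> 1 * (mat 1 \<bullet> X)" using \<epsilon> trX by (intro mult_right_mono) auto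
      moreover have "\<eta> * (\<epsilon> * n) \<le> 1 * (1 * n)" using \<epsilon> \<eta> n0 by (intro mult_mono) auto
      moreover have "\<eta> * ?tr = \<eta> * (S \<bullet> mat 1) + \<eta> * (\<epsilon> * n)"
        by (simp add: inner_add_right n_def inner_commute algebra_simps)
      ultimately show ?thesis using a vy SX byS unfolding T_def by linarith
    qed
    then have tr: "?tr \<le> T / \<eta>" using \<eta> by (simp add: pos_le_divide_eq mult.commute)
    have "\<epsilon> * ?tr \<le> T * (\<epsilon> / \<eta>)" using mult_left_mono[OF tr, of \<epsilon>] \<epsilon> by (simp add: mult.commute)
    then have m: "sqrt (\<epsilon> * ?tr) + \<epsilon> \<le> sqrt T * sqrt (\<epsilon> / \<eta>) + \<epsilon>"
      by (simp add: real_sqrt_mult[symmetric] del: real_sqrt_mult)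
    define m where "m = sqrt (\<epsilon> * ?tr) + \<epsilon>"
    have "S - (C - opsum A y0) = opsum A (y0 - y)" by (simp add: S_def opsum_diff)
    moreover have "S \<bullet> F = 0" using F by (simp add: S_def inner_diff_left inner_opsum)
    ultimately obtain D \<kappa> where D: "D \<in> ?L" "0 \<le> \<kappa>" "psd (S - D + \<kappa> *\<^sub>R (C - opsum A y0))"
      "norm D \<le> K * m" "\<kappa> \<le> K * m"
      using K(2)[of S \<epsilon>] W \<epsilon> unfolding m_def by auto
    obtain d where d: "D = opsum A d" using D(1) by blast
    \<comment> \<open>Dividing by \<open>1 + \<kappa>\<close> restores the coefficient 1 of
      \<open>C\<close> in the repaired slack.\<close>
    define z where "z = (1 / (1 + \<kappa>)) *\<^sub>R (y + d + \<kappa> *\<^sub>R y0)"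
    have "C - opsum A z = (1 / (1 + \<kappa>)) *\<^sub>R (S - D + \<kappa> *\<^sub>R (C - opsum A y0))"
    proof -
      have "S - D + \<kappa> *\<^sub>R (C - opsum A y0) = (1 + \<kappa>) *\<^sub>R C - opsum A (y + d + \<kappa> *\<^sub>R y0)"
        by (simp add: S_def d opsum_add opsum_scaleR algebra_simps)
      then show ?thesis using D(2) by (simp add: z_def opsum_scaleR scaleR_diff_right)
    qed
    then have "dual_feasible C A z" unfolding dual_feasible_def using D by (simp add: psd_scaleR)
    from vD_ge[OF X this] have "(1 / (1 + \<kappa>)) * (b \<bullet> (y + d + \<kappa> *\<^sub>R y0)) \<le> vD C A b" by (simp add: z_def)
    then have "b \<bullet> (y + d + \<kappa> *\<^sub>R y0) \<le> vD C A b * (1 + \<kappa>)" using D(2) by (simp add: divide_le_eq)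
    then have "b \<bullet> y \<le> vD C A b + \<kappa> * (vD C A b - b \<bullet> y0) - D \<bullet> X"
      by (simp add: inner_add_right by_eq[of d] d algebra_simps)
    also have "\<dots> \<le> vD C A b + (K * m) * \<bar>vD C A b - b \<bullet> y0\<bar> + (K * m) * norm X"
    proof -
      have "\<kappa> * (vD C A b - b \<bullet> y0) \<le> \<kappa> * \<bar>vD C A b - b \<bullet> y0\<bar>" using D by (intro mult_left_mono) auto
      also have "\<dots> \<le> (K * m) * \<bar>vD C A b - b \<bullet> y0\<bar>" using D by (intro mult_right_mono) auto
      finally have 1: "\<kappa> * (vD C A b - b \<bullet> y0) \<le> (K * m) * \<bar>vD C A b - b \<bullet> y0\<bar>" .
      have "- (D \<bullet> X) \<le> norm D * norm X" using Cauchy_Schwarz_ineq2[of D X] by linarith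
      also have "\<dots> \<le> (K * m) * norm X" using D by (intro mult_right_mono) auto
      finally show ?thesis using 1 by linarith
    qed
    also have "\<dots> = vD C A b + K1 * m" by (simp add: K1_def algebra_simps)
    finally have by_le: "b \<bullet> y \<le> vD C A b + K1 * m" .
    have "K1 * m \<le> K1 * (sqrt T * sqrt (\<epsilon> / \<eta>) + \<epsilon>)"
      using m K12(1) unfolding m_def by (intro mult_left_mono)
    moreover have "\<eta> * (C \<bullet> mat 1) - \<eta> * (S \<bullet> mat 1) \<le> \<eta> * K2"
    proof -
      have "\<epsilon> * n \<le> 1 * n" using \<epsilon> n0 by (intro mult_right_mono) auto
      then have "C \<bullet> mat 1 - S \<bullet> mat 1 \<le> K2" using SI unfolding K2_def by linarith
      then show ?thesis using mult_left_mono[of _ _ \<eta>] \<eta> by (simp add: right_diff_distrib[symmetric])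
    qed
    ultimately have "v \<epsilon> \<eta> \<le> vD C A b + K1 * (sqrt T * sqrt (\<epsilon> / \<eta>) + \<epsilon>) + \<eta> * K2"
      using vy by_le by linarith
    also have "\<dots> \<le> vD C A b + (K1 * sqrt T + K1 + K2) * (sqrt (\<epsilon> / \<eta>) + \<epsilon> + \<eta>)"
    proof -
      have "0 \<le> (K1 * sqrt T) * (\<epsilon> + \<eta>)" "0 \<le> K1 * (sqrt (\<epsilon> / \<eta>) + \<eta>)" "0 \<le> K2 * (sqrt (\<epsilon> / \<eta>) + \<epsilon>)"
        using K12 T0 \<epsilon> \<eta> by auto
      then show ?thesis by (simp only: distrib_left distrib_right mult_ac)
    qed
    finally show "v \<epsilon> \<eta> \<le> vD C A b + (K1 * sqrt T + K1 + K2) * (sqrt (\<epsilon> / \<eta>) + \<epsilon> + \<eta>)" .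
  qed
qed

text \<open>The mirror image, with \<open>X - \<eta> *\<^sub>R mat 1\<close> in place of the slack
  and the symmetric solutions of the homogeneous equations as correction space.\<close>

lemma v_lower_P_sing_deg_one:
  assumes "P_sing_deg_one C A b"
  obtains K where "\<And>\<epsilon> \<eta>. 0 < \<epsilon> \<Longrightarrow> \<epsilon> \<le> 1 \<Longrightarrow> 0 < \<eta> \<Longrightarrow> \<eta> \<le> 1 \<Longrightarrow>
    vP C A b - K * (sqrt (\<eta> / \<epsilon>) + \<eta>) \<le> v \<epsilon> \<eta>"
proof -
  obtain yf X0 where F: "psd (opsum A yf)" "b \<bullet> yf = 0" and AX0: "\<And>i. A i \<bullet> X0 = b $ i"
    and X0: "X0 \<in> rel_interior {Z. psd Z \<and> Z \<bullet> opsum A yf = 0}"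
    using assms unfolding P_sing_deg_one_def frob_inner by blast
  have psdX0: "psd X0" using rel_interior_subset X0 by blast
  let ?L = "{D. sym_mat D \<and> (\<forall>i. A i \<bullet> D = 0)}"
  have L: "subspace ?L"
    unfolding subspace_def
    by (auto simp: inner_add_right intro: sym_mat_add sym_mat_scaleR psd_sym psd_zero)
  obtain K where K: "K \<ge> 0" "\<And>Z \<delta>. Z - X0 \<in> ?L \<Longrightarrow> Z \<bullet> opsum A yf = 0 \<Longrightarrow> 0 \<le> \<delta> \<Longrightarrow> psd (Z + \<delta> *\<^sub>R mat 1) \<Longrightarrow>
      \<exists>D \<kappa>. D \<in> ?L \<and> 0 \<le> \<kappa> \<and> psd (Z - D + \<kappa> *\<^sub>R X0) \<and>
        norm D \<le> K * (sqrt (\<delta> * (mat 1 \<bullet> (Z + \<delta> *\<^sub>R mat 1))) + \<delta>) \<and>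
        \<kappa> \<le> K * (sqrt (\<delta> * (mat 1 \<bullet> (Z + \<delta> *\<^sub>R mat 1))) + \<delta>)"
    using facial_correction[OF F(1) L _ X0] by blast
  obtain y1 where y1: "dual_feasible C A y1" using Dfeas by blast
  define T where "T = \<bar>vP C A b\<bar> + \<bar>b \<bullet> y1\<bar> + \<bar>opsum A y1 \<bullet> mat 1\<bar>"
  have T0: "0 \<le> T" by (simp add: T_def)
  define K1 where "K1 = K * (\<bar>vP C A b - C \<bullet> X0\<bar> + norm C)"
  define K2 where "K2 = \<bar>C \<bullet> mat 1\<bar>"
  have K12: "0 \<le> K1" "0 \<le> K2" using K(1) by (auto simp: K1_def K2_def)
  show ?thesis
  proof (rule that[of "K1 * sqrt T + K1 + K2"])
    fix \<epsilon> \<eta> :: real assume \<epsilon>: "0 < \<epsilon>" "\<epsilon> \<le> 1" and \<eta>: "0 < \<eta>" "\<eta> \<le> 1"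
    show "vP C A b - (K1 * sqrt T + K1 + K2) * (sqrt (\<eta> / \<epsilon>) + \<eta>) \<le> v \<epsilon> \<eta>"
    proof (rule v_ge)
      show "0 \<le> \<eta>" using \<eta> by simp
      fix X assume X: "primal_feasible A (regb A b \<eta>) X"
      have psdX: "psd X" using X by (simp add: primal_feasible_iff)
      have trX: "0 \<le> mat 1 \<bullet> X" by (rule trace_psd_nonneg[OF psdX])
      show "vP C A b - (K1 * sqrt T + K1 + K2) * (sqrt (\<eta> / \<epsilon>) + \<eta>) \<le> regC C \<epsilon> \<bullet> X"
      \<comment> \<open>Points whose objective exceeds \<open>vP C A b\<close> satisfy the bound at
        once; for the others the objective bound limits the trace to order
        \<open>1 / \<epsilon>\<close>.\<close>
      proof (cases "regC C \<epsilon> \<bullet> X \<le> vP C A b")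
        case False
        moreover have "0 \<le> (K1 * sqrt T + K1 + K2) * (sqrt (\<eta> / \<epsilon>) + \<eta>)" using K12 T0 \<epsilon> \<eta> by auto
        ultimately show ?thesis by linarith
      next
        case True
        have "regb A b \<eta> \<bullet> y1 \<le> C \<bullet> X" by (rule weak_duality[OF X y1])
        moreover have "\<bar>\<eta> * (opsum A y1 \<bullet> mat 1)\<bar> \<le> 1 * \<bar>opsum A y1 \<bullet> mat 1\<bar>"
          unfolding abs_mult using \<eta> by (intro mult_right_mono) auto
        ultimately have "\<epsilon> * (mat 1 \<bullet> X) \<le> T" using True unfolding T_def regb_inner regC_inner by linarith
        then have tr: "mat 1 \<bullet> X \<le> T / \<epsilon>" using \<epsilon> by (simp add: pos_le_divide_eq mult.commute)
        have "\<eta> * (mat 1 \<bullet> X) \<le> T * (\<eta> / \<epsilon>)" using mult_left_mono[OF tr, of \<eta>] \<eta> by (simp add: mult.commute)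
        then have m: "sqrt (\<eta> * (mat 1 \<bullet> X)) + \<eta> \<le> sqrt T * sqrt (\<eta> / \<epsilon>) + \<eta>"
          by (simp add: real_sqrt_mult[symmetric] del: real_sqrt_mult)
        define m where "m = sqrt (\<eta> * (mat 1 \<bullet> X)) + \<eta>"
        \<comment> \<open>Undoing the shift restores the original equations, hence orthogonality to
          the certificate, at the price of an eigenvalue bound \<open>-\<eta>\<close>.\<close>
        define Z where "Z = X - \<eta> *\<^sub>R mat 1"
        have AZ: "A i \<bullet> Z = b $ i" for i
          using X by (simp add: primal_feasible_iff Z_def regb_def frob_inner inner_diff_right)
        have "Z - X0 \<in> ?L"
        proof -
          have "sym_mat (Z - X0)" unfolding Z_def
            by (intro sym_mat_diff sym_mat_scaleR sym_mat_one psd_sym[OF psdX] psd_sym[OF psdX0])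
          then show ?thesis using AZ AX0 by (simp add: inner_diff_right)
        qed
        moreover have "Z \<bullet> opsum A yf = 0"
          using inner_opsum_feasible[of A Z b yf] AZ F(2) by (simp add: inner_commute)
        moreover have ZX: "Z + \<eta> *\<^sub>R mat 1 = X" by (simp add: Z_def)
        ultimately obtain D \<kappa> where D: "D \<in> ?L" "0 \<le> \<kappa>" "psd (Z - D + \<kappa> *\<^sub>R X0)"
          "norm D \<le> K * m" "\<kappa> \<le> K * m"
          using K(2)[of Z \<eta>] psdX \<eta> unfolding m_def by auto
        define Y where "Y = (1 / (1 + \<kappa>)) *\<^sub>R (Z - D + \<kappa> *\<^sub>R X0)"
        have "A i \<bullet> Y = b $ i" for i
        proof -
          have "A i \<bullet> Y = (b $ i + \<kappa> * b $ i) / (1 + \<kappa>)"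
            using D(1) AZ AX0 by (simp add: Y_def inner_add_right inner_diff_right)
          also have "\<dots> = b $ i" using D(2) by (simp add: field_simps)
          finally show ?thesis .
        qed
        moreover have "psd Y" unfolding Y_def using D by (simp add: psd_scaleR)
        ultimately have "primal_feasible A b Y" by (simp add: primal_feasible_iff)
        from vP_le[OF y1 this] have "vP C A b * (1 + \<kappa>) \<le> C \<bullet> (Z - D + \<kappa> *\<^sub>R X0)"
          using D(2) by (simp add: Y_def pos_le_divide_eq)
        then have low: "vP C A b + \<kappa> * (vP C A b - C \<bullet> X0) + C \<bullet> D \<le> C \<bullet> Z"
          by (simp add: inner_add_right inner_diff_right algebra_simps)
        have "- (\<kappa> * (vP C A b - C \<bullet> X0)) \<le> \<kappa> * \<bar>vP C A b - C \<bullet> X0\<bar>"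
          unfolding mult_minus_right[symmetric] using D(2) by (intro mult_left_mono) auto
        also have "\<dots> \<le> (K * m) * \<bar>vP C A b - C \<bullet> X0\<bar>" using D by (intro mult_right_mono) auto
        finally have 1: "- (\<kappa> * (vP C A b - C \<bullet> X0)) \<le> (K * m) * \<bar>vP C A b - C \<bullet> X0\<bar>" .
        have "- (C \<bullet> D) \<le> norm C * norm D" using Cauchy_Schwarz_ineq2[of C D] by linarith
        also have "\<dots> \<le> norm C * (K * m)" using D by (intro mult_left_mono) auto
        finally have 2: "- (C \<bullet> D) \<le> (K * m) * norm C" by (simp add: mult.commute)
        have "(K * m) * \<bar>vP C A b - C \<bullet> X0\<bar> + (K * m) * norm C = K1 * m" by (simp add: K1_def algebra_simps)
        then have CZ: "vP C A b - K1 * m \<le> C \<bullet> Z" using low 1 2 by linarith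
        have "K1 * m \<le> K1 * (sqrt T * sqrt (\<eta> / \<epsilon>) + \<eta>)"
          using m K12(1) unfolding m_def by (intro mult_left_mono)
        moreover have "regC C \<epsilon> \<bullet> X = C \<bullet> Z + \<eta> * (C \<bullet> mat 1) + \<epsilon> * (mat 1 \<bullet> X)"
          by (simp add: regC_inner Z_def inner_diff_right)
        moreover have "0 \<le> \<epsilon> * (mat 1 \<bullet> X)" using \<epsilon> trX by simp
        moreover have "- (\<eta> * (C \<bullet> mat 1)) \<le> \<eta> * K2"
          unfolding K2_def using \<eta> mult_left_mono[of "- (C \<bullet> mat 1)" "\<bar>C \<bullet> mat 1\<bar>" \<eta>] by simp
        ultimately have "vP C A b - K1 * (sqrt T * sqrt (\<eta> / \<epsilon>) + \<eta>) - \<eta> * K2 \<le> regC C \<epsilon> \<bullet> X"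
          using CZ by linarith
        moreover have "K1 * (sqrt T * sqrt (\<eta> / \<epsilon>) + \<eta>) + \<eta> * K2
            \<le> (K1 * sqrt T + K1 + K2) * (sqrt (\<eta> / \<epsilon>) + \<eta>)"
        proof -
          have "0 \<le> (K1 * sqrt T) * \<eta>" "0 \<le> K1 * sqrt (\<eta> / \<epsilon>)" "0 \<le> K2 * sqrt (\<eta> / \<epsilon>)"
            using K12 T0 \<epsilon> \<eta> by auto
          then show ?thesis by (simp only: distrib_left distrib_right mult_ac)
        qed
        ultimately show ?thesis by linarith
      qed
    qed
  qed
qed

text \<open>Along a ray the ratio of the parameters stays equal to \<open>r\<close> while the two
  linear terms vanish. The case \<open>r = 0\<close> is separate because the estimate requires
  \<open>\<epsilon> > 0\<close>.\<close>

lemma Lv_D_sing_deg_one: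
  assumes "D_sing_deg_one C A b"
  obtains K where "\<And>r. 0 \<le> r \<Longrightarrow> r \<le> 1 \<Longrightarrow> Lv r 1 \<le> vD C A b + K * sqrt r"
proof -
  obtain K where K: "\<And>\<epsilon> \<eta>. 0 < \<epsilon> \<Longrightarrow> \<epsilon> \<le> 1 \<Longrightarrow> 0 < \<eta> \<Longrightarrow> \<eta> \<le> 1 \<Longrightarrow>
    v \<epsilon> \<eta> \<le> vD C A b + K * (sqrt (\<epsilon> / \<eta>) + \<epsilon> + \<eta>)"
    using v_upper_D_sing_deg_one[OF assms] by metis
  have "Lv r 1 \<le> vD C A b + K * sqrt r" if r: "0 \<le> r" "r \<le> 1" for r
  proof (cases "r = 0")
    case True
    then show ?thesis using Lv_eq_vD[of 1] by simp
  next
    case False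
    have "((\<lambda>t. vD C A b + K * (sqrt r + t * r + t)) \<longlongrightarrow> vD C A b + K * (sqrt r + 0 * r + 0)) (at_right 0)"
      by (intro tendsto_intros)
    then have lim: "((\<lambda>t. vD C A b + K * (sqrt r + t * r + t)) \<longlongrightarrow> vD C A b + K * sqrt r) (at_right 0)"
      by simp
    show ?thesis
    proof (rule Lv_le[OF r(1) _ lim])
      have "eventually (\<lambda>t::real. t < 1) (at_right 0)" by (rule order_tendstoD(2)[OF tendsto_ident_at]) simp
      then show "eventually (\<lambda>t. v (t * r) (t * 1) \<le> vD C A b + K * (sqrt r + t * r + t)) (at_right 0)"
        using eventually_at_right_less[of "0::real"]
      proof eventually_elim
        case (elim t)
        have "t * r \<le> 1 * 1" using elim r by (intro mult_mono) auto
        then show ?case using K[of "t * r" t] elim r False by simp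
      qed
    qed simp
  qed
  then show ?thesis by (rule that)
qed

lemma Lv_P_sing_deg_one:
  assumes "P_sing_deg_one C A b"
  obtains K where "\<And>s. 0 \<le> s \<Longrightarrow> s \<le> 1 \<Longrightarrow> vP C A b - K * sqrt s \<le> Lv 1 s"
proof -
  obtain K where K: "\<And>\<epsilon> \<eta>. 0 < \<epsilon> \<Longrightarrow> \<epsilon> \<le> 1 \<Longrightarrow> 0 < \<eta> \<Longrightarrow> \<eta> \<le> 1 \<Longrightarrow>
    vP C A b - K * (sqrt (\<eta> / \<epsilon>) + \<eta>) \<le> v \<epsilon> \<eta>"
    using v_lower_P_sing_deg_one[OF assms] by metis
  have "vP C A b - K * sqrt s \<le> Lv 1 s" if s: "0 \<le> s" "s \<le> 1" for s
  proof (cases "s = 0")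
    case True
    then show ?thesis using Lv_eq_vP[of 1] by simp
  next
    case False
    have "((\<lambda>t. vP C A b - K * (sqrt s + t * s)) \<longlongrightarrow> vP C A b - K * (sqrt s + 0 * s)) (at_right 0)"
      by (intro tendsto_intros)
    then have lim: "((\<lambda>t. vP C A b - K * (sqrt s + t * s)) \<longlongrightarrow> vP C A b - K * sqrt s) (at_right 0)"
      by simp
    show ?thesis
    proof (rule Lv_ge[OF _ s(1) lim])
      have "eventually (\<lambda>t::real. t < 1) (at_right 0)" by (rule order_tendstoD(2)[OF tendsto_ident_at]) simp
      then show "eventually (\<lambda>t. vP C A b - K * (sqrt s + t * s) \<le> v (t * 1) (t * s)) (at_right 0)"
        using eventually_at_right_less[of "0::real"]
      proof eventually_elim
        case (elim t)
        have "t * s \<le> 1 * 1" using elim s by (intro mult_mono) auto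
        then show ?case using K[of t "t * s"] elim s False by simp
      qed
    qed simp
  qed
  then show ?thesis by (rule that)
qed

section \<open>Strict monotonicity in the slope of the ray\<close>

lemma Lv_mono:
  assumes "0 \<le> r1" "r1 \<le> r2"
  shows "Lv r1 1 \<le> Lv r2 1"
proof (rule tendsto_le[OF _ Lv_tendsto Lv_tendsto])
  show "eventually (\<lambda>t. v (t * r1) (t * 1) \<le> v (t * r2) (t * 1)) (at_right 0)"
  proof (rule eventually_at_right_pos, rule v_ge)
    fix t :: real and X assume t: "0 < t" and X: "primal_feasible A (regb A b (t * 1)) X"
    have "0 \<le> mat 1 \<bullet> X" using X by (auto simp: primal_feasible_iff intro: trace_psd_nonneg)
    then have "t * r1 * (mat 1 \<bullet> X) \<le> t * r2 * (mat 1 \<bullet> X)"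
      using t assms by (intro mult_right_mono mult_left_mono) auto
    moreover have "v (t * r1) (t * 1) \<le> regC C (t * r1) \<bullet> X" using t assms by (intro v_le X) auto
    ultimately show "v (t * r1) (t * 1) \<le> regC C (t * r2) \<bullet> X" by (simp add: regC_inner)
  qed simp
qed (use assms in auto)

lemma Lv_flip: "0 < s \<Longrightarrow> Lv 1 s = Lv (1 / s) 1"
  using Lv_scale[of s "1 / s" 1] by simp

lemma vD_le_vP: "vD C A b \<le> vP C A b"
  using Lv_ge_vD[of 1 1] Lv_le_vP[of 1 1] by simp

text \<open>Equal values at \<open>a\<close> and \<open>a'\<close> make the concave nondecreasing
  function constant from \<open>a'\<close> on, that is for all small \<open>s\<close> in
  \<open>Lv 1 s\<close>. The primal estimate shows this constant to be v(P), convexity in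
  \<open>s\<close> extends the value to large \<open>s\<close>, and there the dual estimate forces
  v(P) to be at most v(D).\<close>

lemma Lv_strict_mono:
  assumes P: "P_sing_deg_one C A b" and D: "D_sing_deg_one C A b" and gap: "vP C A b \<noteq> vD C A b"
    and ab: "0 \<le> a" "a < a'"
  shows "Lv a 1 < Lv a' 1"
proof (rule ccontr)
  assume "\<not> Lv a 1 < Lv a' 1"
  then have eq: "Lv a' 1 = Lv a 1" using Lv_mono[of a a'] ab by simp
  have const: "Lv r 1 = Lv a 1" if r: "a' \<le> r" for r
  proof (cases "r = a'")
    case False
    \<comment> \<open>The weight that expresses \<open>a'\<close> as a convex combination of
      \<open>a\<close> and \<open>r\<close>.\<close>
    define l where "l = (a' - a) / (r - a)"
    have l: "0 < l" "l \<le> 1" using r ab by (auto simp: l_def)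
    have "(r - a) * l = a' - a" using r ab by (simp add: l_def)
    then have "(1 - l) * a + l * r = a'" by (simp add: algebra_simps)
    then have "(1 - l) * Lv a 1 + l * Lv r 1 \<le> Lv a 1" using Lv_concave[of a r l] ab r l eq by simp
    then have "l * (Lv r 1 - Lv a 1) \<le> 0" by (simp add: algebra_simps)
    then have "Lv r 1 \<le> Lv a 1" using l by (simp add: mult_le_0_iff)
    then show ?thesis using Lv_mono[of a r] ab r by simp
  qed (use eq in simp)
  define s1 where "s1 = 1 / a'"
  have s1: "0 < s1" using ab by (simp add: s1_def)
  have U: "Lv 1 s = Lv a 1" if "0 < s" "s \<le> s1" for s
  proof -
    have "a' \<le> 1 / s" using that ab by (simp add: s1_def field_simps)
    then show ?thesis using Lv_flip[OF that(1)] const by simp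
  qed
  obtain K where K: "\<And>s. 0 \<le> s \<Longrightarrow> s \<le> 1 \<Longrightarrow> vP C A b - K * sqrt s \<le> Lv 1 s"
    using Lv_P_sing_deg_one[OF P] by metis
  have "vP C A b \<le> Lv a 1"
  proof (rule le_if_sqrt_bound[of "min 1 s1"])
    show "0 < min 1 s1" using s1 by simp
    show "vP C A b \<le> Lv a 1 + K * sqrt s" if "0 < s" "s < min 1 s1" for s
      using K[of s] U[of s] that by simp
  qed
  then have top: "Lv a 1 = vP C A b" using Lv_le_vP[of a 1] ab by simp
  have U_top: "vP C A b \<le> Lv 1 s" if s: "0 < s" for s
  proof (cases "s \<le> s1")
    case True
    then show ?thesis using U s top by simp
  next
    case False
    \<comment> \<open>Here \<open>s1\<close> lies between 0 and \<open>s\<close>. A convex function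
      equal to v(P) at 0 and at \<open>s1\<close> cannot be smaller at \<open>s\<close>.\<close>
    define l where "l = s1 / s"
    have l: "0 < l" "l \<le> 1" using False s s1 by (auto simp: l_def)
    have "(1 - l) * 0 + l * s = s1" using s by (simp add: l_def)
    then have "Lv 1 s1 \<le> (1 - l) * Lv 1 0 + l * Lv 1 s" using Lv_convex[of 0 s l] s l by simp
    then have "vP C A b \<le> (1 - l) * vP C A b + l * Lv 1 s" using U[of s1] s1 top Lv_eq_vP[of 1] by simp
    then have "0 \<le> l * (Lv 1 s - vP C A b)" by (simp add: algebra_simps)
    then show ?thesis using l by (simp add: zero_le_mult_iff)
  qed
  obtain K' where K': "\<And>r. 0 \<le> r \<Longrightarrow> r \<le> 1 \<Longrightarrow> Lv r 1 \<le> vD C A b + K' * sqrt r"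
    using Lv_D_sing_deg_one[OF D] by metis
  have "vP C A b \<le> vD C A b"
  proof (rule le_if_sqrt_bound[of 1])
    show "vP C A b \<le> vD C A b + K' * sqrt r" if "0 < r" "r < 1" for r
      using U_top[of "1 / r"] Lv_flip[of "1 / r"] K'[of r] that by simp
  qed simp
  then show False using gap vD_le_vP by simp
qed

section \<open>The value function in the angle\<close>

lemma va_eq: "va C A b \<theta> = Lv (cos \<theta>) (sin \<theta>)"
  by (simp add: va_def Lv_def)

lemma va_cot:
  assumes "0 < \<theta>" "\<theta> \<le> pi / 2"
  shows "va C A b \<theta> = Lv (cos \<theta> / sin \<theta>) 1"
proof -
  have "0 < sin \<theta>" using assms pi_gt_zero by (intro sin_gt_zero) linarith+
  moreover have "0 \<le> cos \<theta>" using assms by (intro cos_ge_zero) auto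
  ultimately show ?thesis using Lv_scale[of "sin \<theta>" "cos \<theta> / sin \<theta>" 1] by (simp add: va_eq)
qed

lemma va_tan:
  assumes "0 \<le> \<theta>" "\<theta> < pi / 2"
  shows "va C A b \<theta> = Lv 1 (sin \<theta> / cos \<theta>)"
proof -
  have "0 < cos \<theta>" using assms by (intro cos_gt_zero_pi) auto
  moreover have "0 \<le> sin \<theta>" using assms pi_gt_zero by (intro sin_ge_zero) linarith+
  ultimately show ?thesis using Lv_scale[of "cos \<theta>" 1 "sin \<theta> / cos \<theta>"] by (simp add: va_eq)
qed

lemma va_0: "va C A b 0 = vP C A b"
  using Lv_eq_vP[of 1] by (simp add: va_eq)

lemma va_pi_half: "va C A b (pi / 2) = vD C A b"
  using Lv_eq_vD[of 1] by (simp add: va_eq)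

lemma va_bounds:
  assumes "0 \<le> \<theta>" "\<theta> \<le> pi / 2"
  shows "vD C A b \<le> va C A b \<theta>" "va C A b \<theta> \<le> vP C A b"
proof -
  have "0 \<le> cos \<theta>" using assms by (intro cos_ge_zero) auto
  moreover have "0 \<le> sin \<theta>" using assms pi_gt_zero by (intro sin_ge_zero) linarith+
  ultimately show "vD C A b \<le> va C A b \<theta>" "va C A b \<theta> \<le> vP C A b"
    using Lv_ge_vD Lv_le_vP by (auto simp: va_eq)
qed

lemma va_continuous_pi_half:
  assumes "D_sing_deg_one C A b"
  shows "continuous (at (pi/2) within {0..pi/2}) (va C A b)"
proof -
  obtain K where K: "\<And>r. 0 \<le> r \<Longrightarrow> r \<le> 1 \<Longrightarrow> Lv r 1 \<le> vD C A b + K * sqrt r"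
    using Lv_D_sing_deg_one[OF assms] by metis
  let ?F = "at (pi/2) within {0..pi/2}"
  have "((\<lambda>\<theta>. cos \<theta> / sin \<theta>) \<longlongrightarrow> cos (pi/2) / sin (pi/2)) ?F"
    by (intro tendsto_intros) auto
  then have lim: "((\<lambda>\<theta>. cos \<theta> / sin \<theta>) \<longlongrightarrow> 0) ?F" by simp
  have "((\<lambda>\<theta>. vD C A b + K * sqrt (cos \<theta> / sin \<theta>)) \<longlongrightarrow> vD C A b + K * sqrt 0) ?F"
    by (intro tendsto_intros lim)
  then have up: "((\<lambda>\<theta>. vD C A b + K * sqrt (cos \<theta> / sin \<theta>)) \<longlongrightarrow> vD C A b) ?F" by simp
  have dom: "eventually (\<lambda>\<theta>. \<theta> \<in> {0..pi/2}) ?F" by (simp add: eventually_at_filter)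
  have pos: "eventually (\<lambda>\<theta>. 0 < \<theta>) ?F" by (rule order_tendstoD(1)[OF tendsto_ident_at]) simp
  have small: "eventually (\<lambda>\<theta>. cos \<theta> / sin \<theta> < 1) ?F" by (rule order_tendstoD(2)[OF lim]) simp
  have "(va C A b \<longlongrightarrow> vD C A b) ?F"
  proof (rule tendsto_sandwich[OF _ _ tendsto_const up])
    show "eventually (\<lambda>\<theta>. vD C A b \<le> va C A b \<theta>) ?F"
      using dom by eventually_elim (simp add: va_bounds)
    show "eventually (\<lambda>\<theta>. va C A b \<theta> \<le> vD C A b + K * sqrt (cos \<theta> / sin \<theta>)) ?F"
      using dom pos small
    proof eventually_elim
      case (elim \<theta>)
      then have "0 \<le> cos \<theta>" by (intro cos_ge_zero) auto
      moreover have "0 \<le> sin \<theta>" using elim pi_gt_zero by (intro sin_ge_zero) auto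
      ultimately show ?case using elim K[of "cos \<theta> / sin \<theta>"] by (simp add: va_cot)
    qed
  qed
  then show ?thesis by (simp add: continuous_within va_pi_half)
qed

lemma va_continuous_0:
  assumes "P_sing_deg_one C A b"
  shows "continuous (at 0 within {0..pi/2}) (va C A b)"
proof -
  obtain K where K: "\<And>s. 0 \<le> s \<Longrightarrow> s \<le> 1 \<Longrightarrow> vP C A b - K * sqrt s \<le> Lv 1 s"
    using Lv_P_sing_deg_one[OF assms] by metis
  let ?F = "at 0 within {0..pi/2}"
  have "((\<lambda>\<theta>. sin \<theta> / cos \<theta>) \<longlongrightarrow> sin 0 / cos 0) ?F"
    by (intro tendsto_intros) auto
  then have lim: "((\<lambda>\<theta>. sin \<theta> / cos \<theta>) \<longlongrightarrow> 0) ?F" by simp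
  have "((\<lambda>\<theta>. vP C A b - K * sqrt (sin \<theta> / cos \<theta>)) \<longlongrightarrow> vP C A b - K * sqrt 0) ?F"
    by (intro tendsto_intros lim)
  then have lo: "((\<lambda>\<theta>. vP C A b - K * sqrt (sin \<theta> / cos \<theta>)) \<longlongrightarrow> vP C A b) ?F" by simp
  have dom: "eventually (\<lambda>\<theta>. \<theta> \<in> {0..pi/2}) ?F" by (simp add: eventually_at_filter)
  have less: "eventually (\<lambda>\<theta>. \<theta> < pi/2) ?F" by (rule order_tendstoD(2)[OF tendsto_ident_at]) simp
  have small: "eventually (\<lambda>\<theta>. sin \<theta> / cos \<theta> < 1) ?F" by (rule order_tendstoD(2)[OF lim]) simp
  have "(va C A b \<longlongrightarrow> vP C A b) ?F"
  proof (rule tendsto_sandwich[OF _ _ lo tendsto_const])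
    show "eventually (\<lambda>\<theta>. va C A b \<theta> \<le> vP C A b) ?F"
      using dom by eventually_elim (simp add: va_bounds)
    show "eventually (\<lambda>\<theta>. vP C A b - K * sqrt (sin \<theta> / cos \<theta>) \<le> va C A b \<theta>) ?F"
      using dom less small
    proof eventually_elim
      case (elim \<theta>)
      then have "0 \<le> cos \<theta>" by (intro cos_ge_zero) auto
      moreover have "0 \<le> sin \<theta>" using elim pi_gt_zero by (intro sin_ge_zero) auto
      ultimately show ?case using elim K[of "sin \<theta> / cos \<theta>"] by (simp add: va_tan)
    qed
  qed
  then show ?thesis by (simp add: continuous_within va_0)
qed

text \<open>A concave function is continuous on an open interval, and the cotangent maps the open
  angle range into the positive half-line.\<close>

lemma va_continuous_interior:
  assumes "0 < \<theta>" "\<theta> < pi/2"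
  shows "continuous (at \<theta>) (va C A b)"
proof -
  have "convex_on {0<..} (\<lambda>r. - Lv r 1)"
  proof (rule convex_onI)
    fix t x y :: real assume "0 < t" "t < 1" "x \<in> {0<..}" "y \<in> {0<..}"
    then show "- Lv ((1 - t) *\<^sub>R x + t *\<^sub>R y) 1 \<le> (1 - t) * - Lv x 1 + t * - Lv y 1"
      using Lv_concave[of x y t] by simp
  qed simp
  then have "continuous_on {0<..} (\<lambda>r. - (- Lv r 1))"
    by (intro continuous_on_minus convex_on_continuous) auto
  then have W: "continuous_on {0<..} (\<lambda>r. Lv r 1)" by simp
  have sc: "0 < sin x" "0 < cos x" if "x \<in> {0<..<pi/2}" for x
    using that pi_gt_zero by (auto intro!: sin_gt_zero cos_gt_zero_pi)
  have "continuous_on {0<..<pi/2} (\<lambda>\<theta>. Lv (cos \<theta> / sin \<theta>) 1)"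
    by (rule continuous_on_compose2[OF W]) (use sc in \<open>auto intro!: continuous_intros simp: less_imp_neq[symmetric]\<close>)
  then have "continuous_on {0<..<pi/2} (va C A b)"
    by (rule continuous_on_eq) (simp add: va_cot)
  then show ?thesis using assms by (simp add: continuous_on_eq_continuous_at)
qed

lemma va_strict_antimono:
  assumes "P_sing_deg_one C A b" "D_sing_deg_one C A b" "vP C A b \<noteq> vD C A b"
    and st: "0 \<le> s" "s < t" "t \<le> pi/2"
  shows "va C A b t < va C A b s"
proof -
  have sint: "0 < sin t" using st pi_gt_zero by (intro sin_gt_zero) linarith+
  have cost: "0 \<le> cos t" using st by (intro cos_ge_zero) auto
  show ?thesis
  proof (cases "s = 0")
    case True
    \<comment> \<open>The angle 0 corresponds to no finite slope; any larger finite slope, here one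
      more, separates the value at \<open>t\<close> from v(P).\<close>
    have "Lv (cos t / sin t) 1 < Lv (cos t / sin t + 1) 1"
      using sint cost by (intro Lv_strict_mono[OF assms(1-3)]) auto
    also have "\<dots> \<le> vP C A b" using sint cost by (intro Lv_le_vP) auto
    finally show ?thesis using st True by (simp add: va_cot va_0)
  next
    case False
    then have sins: "0 < sin s" using st pi_gt_zero by (intro sin_gt_zero) linarith+
    \<comment> \<open>The addition formula turns this into the strict decrease of the
      cotangent.\<close>
    have "0 < sin (t - s)" using st pi_gt_zero by (intro sin_gt_zero) linarith+
    then have "cos t / sin t < cos s / sin s"
      using sins sint by (simp add: sin_diff divide_less_eq less_divide_eq field_simps)
    then have "Lv (cos t / sin t) 1 < Lv (cos s / sin s) 1"
      using sint cost by (intro Lv_strict_mono[OF assms(1-3)]) auto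
    then show ?thesis using st False by (simp add: va_cot)
  qed
qed

lemma va_continuous_on:
  assumes "P_sing_deg_one C A b" "D_sing_deg_one C A b"
  shows "continuous_on {0..pi/2} (va C A b)"
  unfolding continuous_on_eq_continuous_within
proof
  fix \<theta> assume "\<theta> \<in> {0..pi/2}"
  then consider "\<theta> = 0" | "\<theta> = pi/2" | "0 < \<theta>" "\<theta> < pi/2" by fastforce
  then show "continuous (at \<theta> within {0..pi/2}) (va C A b)"
  proof cases
    case 1
    show ?thesis unfolding 1 by (rule va_continuous_0[OF assms(1)])
  next
    case 2
    show ?thesis unfolding 2 by (rule va_continuous_pi_half[OF assms(2)])
  next
    case 3
    then show ?thesis by (rule continuous_at_imp_continuous_at_within[OF va_continuous_interior])
  qed
qed

lemma va_bij_betw: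
  assumes "P_sing_deg_one C A b" "D_sing_deg_one C A b" "vP C A b \<noteq> vD C A b"
  shows "bij_betw (va C A b) {0..pi/2} {vD C A b..vP C A b}"
proof (rule bij_betw_imageI)
  show "inj_on (va C A b) {0..pi/2}"
  proof (rule linorder_inj_onI)
    show "va C A b s \<noteq> va C A b t" if "s < t" "s \<in> {0..pi/2}" "t \<in> {0..pi/2}" for s t
      using va_strict_antimono[OF assms, of s t] that by auto
  qed auto
  show "va C A b ` {0..pi/2} = {vD C A b..vP C A b}"
  proof
    show "va C A b ` {0..pi/2} \<subseteq> {vD C A b..vP C A b}" using va_bounds by auto
    show "{vD C A b..vP C A b} \<subseteq> va C A b ` {0..pi/2}"
    proof
      fix y assume y: "y \<in> {vD C A b..vP C A b}"
      have "\<exists>x\<ge>0. x \<le> pi/2 \<and> va C A b x = y"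
        using y va_continuous_on[OF assms(1,2)] by (intro IVT2') (auto simp: va_0 va_pi_half)
      then show "y \<in> va C A b ` {0..pi/2}" by auto
    qed
  qed
qed

end

theorem theorem2:
  fixes C :: "real^'n^'n" and A :: "'m::finite \<Rightarrow> real^'n^'n" and b :: "real^'m"
  assumes symC: "sym_mat C"
    and symA: "\<And>i. sym_mat (A i)"
    and Pfeas: "\<exists>X. primal_feasible A b X"
    and Dfeas: "\<exists>y. dual_feasible C A y"
  shows "(D_sing_deg_one C A b \<longrightarrow>
            continuous (at (pi/2) within {0..pi/2}) (va C A b))
       \<and> (P_sing_deg_one C A b \<longrightarrow>
            continuous (at 0 within {0..pi/2}) (va C A b))
       \<and> (P_sing_deg_one C A b \<and> D_sing_deg_one C A b \<longrightarrow>
            continuous (at 0 within {0..pi/2}) (va C A b)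
          \<and> continuous (at (pi/2) within {0..pi/2}) (va C A b)
          \<and> (vP C A b \<noteq> vD C A b \<longrightarrow>
               (\<forall>s\<in>{0..pi/2}. \<forall>t\<in>{0..pi/2}. s \<le> t \<longrightarrow> va C A b t \<le> va C A b s)
             \<and> continuous_on {0..pi/2} (va C A b)
             \<and> bij_betw (va C A b) {0..pi/2} {vD C A b..vP C A b}))"
proof -
  interpret sdp_pair C A b by unfold_locales (fact assms)+
  have "va C A b t \<le> va C A b s"
    if "P_sing_deg_one C A b" "D_sing_deg_one C A b" "vP C A b \<noteq> vD C A b"
      "s \<in> {0..pi/2}" "t \<in> {0..pi/2}" "s \<le> t" for s t
    using va_strict_antimono[OF that(1-3), of s t] that(4-6) by (cases "s = t") auto
  then show ?thesis
    using va_continuous_pi_half va_continuous_0 va_continuous_on va_bij_betw by simp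
qed

end
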